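(* In the associative plane model on $n$ variables, as $n\to\infty$, \[\lim_{m\to\infty}\mathbb{P}^a_{m,n}(True)=\frac{51-36\sqrt2}{n}+O\!\left(\frac{1}{n^2}\right).\]
   Context: A labelled associative tree on $n$ variables is a plane (ordered) rooted tree in which every internal node has out-degree at least $2$, every internal node is labelled $\land$ or $\lor$ with no internal node carrying the same label as its parent, and every leaf is labelled by a literal from $\{x_1,\bar x_1,\dots,x_n,\bar x_n\}$. Its size is its number of leaves; it computes a Boolean function of $x_1,\dots,x_n$ (an $\land$/$\lor$ node computes the conjunction/disjunction of all its children). $\mathbb{P}^a_{m,n}$ is the probability distribution on Boolean functions of $n$ variables induced by the uniform distribution on labelled associative trees of size $m$; $True$ is the constant-true function. *)

theory Defs
  imports "HOL-Probability.Probability" "HOL-Library.Landau_Symbols"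
begin

datatype literal = Pos nat | Neg nat

primrec lit_var :: "literal \<Rightarrow> nat" where
  "lit_var (Pos i) = i"
| "lit_var (Neg i) = i"

primrec lit_eval :: "(nat \<Rightarrow> bool) \<Rightarrow> literal \<Rightarrow> bool" where
  "lit_eval a (Pos i) = a i"
| "lit_eval a (Neg i) = (\<not> a i)"

datatype connective = Conj | Disj

datatype assoc_tree = Leaf literal | Node connective "assoc_tree list"

primrec root_label :: "assoc_tree \<Rightarrow> connective option" where
  "root_label (Leaf l) = None"
| "root_label (Node c ts) = Some c"

fun leaves :: "assoc_tree \<Rightarrow> nat" where
  "leaves (Leaf l) = 1"
| "leaves (Node c ts) = sum_list (map leaves ts)"

fun labelled_assoc :: "nat \<Rightarrow> assoc_tree \<Rightarrow> bool" where
  "labelled_assoc n (Leaf l) \<longleftrightarrow> lit_var l \<in> {1..n}"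
| "labelled_assoc n (Node c ts) \<longleftrightarrow>
     length ts \<ge> 2 \<and> (\<forall>t\<in>set ts. root_label t \<noteq> Some c \<and> labelled_assoc n t)"

fun tree_eval :: "assoc_tree \<Rightarrow> (nat \<Rightarrow> bool) \<Rightarrow> bool" where
  "tree_eval (Leaf l) a = lit_eval a l"
| "tree_eval (Node Conj ts) a = (\<forall>t\<in>set ts. tree_eval t a)"
| "tree_eval (Node Disj ts) a = (\<exists>t\<in>set ts. tree_eval t a)"

definition assoc_trees :: "nat \<Rightarrow> nat \<Rightarrow> assoc_tree set" where
  "assoc_trees m n = {t. labelled_assoc n t \<and> leaves t = m}"

text \<open>
  A Boolean function of the variables \<open>x\<^sub>1, \<dots>, x\<^sub>n\<close> is represented by the function on assignments
  \<open>nat \<Rightarrow> bool\<close> that ignores all coordinates outside \<open>{1..n}\<close>; lemma \<open>tree_eval_cong\<close> shows that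
  every tree on \<open>n\<close> variables computes such a function.
  The distribution below is meaningful for \<open>m \<ge> 1\<close> and \<open>n \<ge> 1\<close>, when the set of trees is nonempty.
\<close>

definition assoc_dist :: "nat \<Rightarrow> nat \<Rightarrow> ((nat \<Rightarrow> bool) \<Rightarrow> bool) pmf" where
  "assoc_dist m n = map_pmf tree_eval (pmf_of_set (assoc_trees m n))"

definition True_fun :: "(nat \<Rightarrow> bool) \<Rightarrow> bool" where
  "True_fun = (\<lambda>a. True)"

lemma tree_eval_cong:
  assumes "labelled_assoc n t" and "\<And>i. i \<in> {1..n} \<Longrightarrow> a i = b i"
  shows "tree_eval t a = tree_eval t b"
  using assms(1)
proof (induction t)
  case (Leaf l)
  then show ?case using assms(2) by (cases l) auto
next
  case (Node c ts)
  then show ?case by (cases c) auto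
qed

lemma leaves_pos: "labelled_assoc n t \<Longrightarrow> leaves t \<ge> 1"
proof (induction t)
  case (Leaf l)
  then show ?case by simp
next
  case (Node c ts)
  then obtain t where t: "t \<in> set ts" by (cases ts) auto
  with Node have "leaves t \<ge> 1" by auto
  moreover have "leaves t \<le> sum_list (map leaves ts)"
    using t by (intro member_le_sum_list) auto
  ultimately show ?case by simp
qed

lemma finite_assoc_trees: "finite (assoc_trees m n)"
proof (induction m rule: less_induct)
  case (less m)
  define S where "S = (\<Union>k<m. assoc_trees k n)"
  have fS: "finite S" unfolding S_def using less by blast
  have fL: "finite {l. lit_var l \<in> {1..n}}"
  proof (rule finite_subset)
    show "{l. lit_var l \<in> {1..n}} \<subseteq> Pos ` {1..n} \<union> Neg ` {1..n}"
    proof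
      fix l assume "l \<in> {l. lit_var l \<in> {1..n}}"
      then show "l \<in> Pos ` {1..n} \<union> Neg ` {1..n}" by (cases l) auto
    qed
  qed simp
  have fT: "finite {ts. set ts \<subseteq> S \<and> length ts \<le> m}"
    using fS by (rule finite_lists_length_le)
  have "assoc_trees m n \<subseteq> Leaf ` {l. lit_var l \<in> {1..n}}
      \<union> (\<Union>c\<in>{Conj, Disj}. Node c ` {ts. set ts \<subseteq> S \<and> length ts \<le> m})"
  proof
    fix t assume t: "t \<in> assoc_trees m n"
    show "t \<in> Leaf ` {l. lit_var l \<in> {1..n}}
      \<union> (\<Union>c\<in>{Conj, Disj}. Node c ` {ts. set ts \<subseteq> S \<and> length ts \<le> m})"
    proof (cases t)
      case (Leaf l)
      then show ?thesis using t by (auto simp: assoc_trees_def)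
    next
      case (Node c ts)
      have len: "length ts \<ge> 2" and lab: "\<And>u. u \<in> set ts \<Longrightarrow> labelled_assoc n u"
        and sum: "sum_list (map leaves ts) = m"
        using t Node by (auto simp: assoc_trees_def)
      have bound: "length us \<le> sum_list (map leaves us)" if "set us \<subseteq> set ts" for us
        using that
      proof (induction us)
        case (Cons u us)
        have "leaves u \<ge> 1" using Cons.prems lab leaves_pos by auto
        then show ?case using Cons by auto
      qed simp
      have "u \<in> S" if u: "u \<in> set ts" for u
      proof -
        obtain xs ys where ts: "ts = xs @ u # ys" using u by (meson split_list)
        have "length (xs @ ys) \<le> sum_list (map leaves (xs @ ys))"
          by (rule bound) (auto simp: ts)
        moreover have "length (xs @ ys) \<ge> 1" using len by (simp add: ts)
        moreover have "leaves u + sum_list (map leaves (xs @ ys)) = m"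
          using sum by (simp add: ts)
        ultimately have "leaves u < m" by linarith
        then show ?thesis using lab[OF u] by (auto simp: S_def assoc_trees_def)
      qed
      moreover have "length ts \<le> m" using bound[of ts] sum by simp
      ultimately show ?thesis using Node by (cases c) auto
    qed
  qed
  then show ?case by (rule finite_subset) (use fL fT in auto)
qed

lemma assoc_trees_nonempty:
  assumes "m \<ge> 1" and "n \<ge> 1"
  shows "assoc_trees m n \<noteq> {}"
proof (cases "m = 1")
  case True
  then have "Leaf (Pos 1) \<in> assoc_trees m n"
    using assms by (simp add: assoc_trees_def)
  then show ?thesis by blast
next
  case False
  then have "Node Conj (replicate m (Leaf (Pos 1))) \<in> assoc_trees m n"
    using assms by (simp add: assoc_trees_def sum_list_replicate)
  then show ?thesis by blast
qed

end

theory Submission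
  imports Defs "HOL-Computational_Algebra.Formal_Power_Series" "HOL-Real_Asymp.Real_Asymp"
begin

unbundle no vec_syntax
unbundle fps_syntax

text \<open>
  After scaling each leaf by \<open>1 / (2 * n)\<close>, the trees whose root does not carry a given label are
  counted by the little Schroeder numbers, whose ratios converge to \<open>3 + 2 * sqrt 2\<close> and whose
  convolution is subexponential: in a product of such series only one factor is large.

  For fixed \<open>n\<close>, this turns the recursive description of the trees computing each Boolean function
  into linear inequalities between the oscillations (limsup minus liminf) of the proportions of these
  trees. A node is evaluated independently of a given child as soon as its other children force its
  value, which makes the system strictly contracting; so the oscillations vanish and the limit exists.

  For the asymptotics, falsifying the leaves of a suitable subtree (all children of a disjunction, one
  child of a conjunction) falsifies the tree. A tautology therefore repeats a variable among these
  leaves, and unless its root is a disjunction with two complementary leaf children, exchanging the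
  child chosen at a conjunction yields a second, independent repetition, which has probability
  \<open>O(1 / n\<^sup>2)\<close> because the fourth moment of the number of leaves involved is bounded. A pair of leaf
  children of the root is complementary with probability \<open>1 / (2 * n)\<close>, and the limiting mean number
  of such pairs is the coefficient ratio of \<open>X\<^sup>2 / (1 - T)\<^sup>3\<close> and \<open>T\<close>, namely \<open>12 * rho\<^sup>2\<close>.
\<close>

section \<open>The generating function of associative tree shapes\<close>

text \<open>The proof is shaped by the fact that the quadratic equation for the tree series has a
  double root at \<open>rho\<close>. This makes the inequalities between oscillations exactly
  critical: estimated term by term, they only say that the total oscillation does not grow. The
  strictness has to come from a cancellation, and forced nodes supply it. On the other hand, the
  quadratic expresses the square of the series linearly, so the convolution limit is explicit and no
  analytic singularity analysis is involved.

  Since \<open>m\<close> tends to infinity before \<open>n\<close> does, the error bound has to be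
  uniform in \<open>m\<close>. The moments are therefore compared with the tree counts at every
  size; after scaling, their equations no longer mention \<open>n\<close>, so one constant serves
  all \<open>n\<close>. Because a conjunction records only two children, the kernel of these
  equations has mass \<open>2 * sqrt 2 - 2 < 1\<close> at \<open>rho\<close>: the moments are
  subcritical although the trees are critical.

  The constant: half of the trees have a disjunction at the root, and \<open>12 * rho ^ 2\<close>
  pairs, each complementary with probability \<open>1 / (2 * n)\<close>, give
  \<open>3 * rho ^ 2 / n\<close> with \<open>rho ^ 2 = 17 - 12 * sqrt 2\<close>.\<close>

definition schroeder_sqrt :: "real fps" where
  "schroeder_sqrt = fps_radical (\<lambda>_ _. 1) 2 (1 - 6 * fps_X + fps_X ^ 2)"

text \<open>The root of \<open>2 * T ^ 2 - (1 + X) * T + X\<close> that vanishes at 0, with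
  coefficients 0, 1, 1, 3, 11, ...\<close>

definition schroeder :: "real fps" where
  "schroeder = fps_const (1 / 4) * (1 + fps_X - schroeder_sqrt)"

text \<open>The geometric series \<open>1 / (1 - T)\<close>, which counts lists of children; the
  quadratic equation makes it linear in \<open>T\<close>.\<close>

definition schroeder_inv :: "real fps" where
  "schroeder_inv = 1 - fps_X + 2 * schroeder"

lemma schroeder_sqrt_square: "schroeder_sqrt ^ 2 = 1 - 6 * fps_X + fps_X ^ 2"
  using power_radical[of "1 - 6 * fps_X + fps_X ^ 2 :: real fps" "\<lambda>_ _. 1" 1]
  by (simp add: schroeder_sqrt_def numeral_2_eq_2)

lemma schroeder_sqrt_0: "schroeder_sqrt $ 0 = 1"
  by (simp add: schroeder_sqrt_def)

lemma schroeder_sqrt_eq: "schroeder_sqrt = 1 + fps_X - 4 * schroeder"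
proof -
  have "4 * fps_const (1 / 4 :: real) = 1"
    by (simp add: fps_numeral_fps_const)
  then have "4 * schroeder = 1 + fps_X - schroeder_sqrt"
    unfolding schroeder_def by (metis mult.assoc mult_1)
  then show ?thesis by simp
qed

lemma schroeder_quadratic: "2 * schroeder ^ 2 - (1 + fps_X) * schroeder + fps_X = 0"
proof -
  have "8 * (2 * schroeder ^ 2 - (1 + fps_X) * schroeder + fps_X)
      = schroeder_sqrt ^ 2 - (1 - 6 * fps_X + fps_X ^ 2)"
    unfolding schroeder_sqrt_eq by (simp add: algebra_simps power2_eq_square)
  then have "8 * (2 * schroeder ^ 2 - (1 + fps_X) * schroeder + fps_X) = 0"
    by (simp only: schroeder_sqrt_square diff_self)
  then show ?thesis by (metis mult_eq_0_iff zero_neq_numeral)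
qed

lemma schroeder_0 [simp]: "schroeder $ 0 = 0"
  by (simp add: schroeder_def schroeder_sqrt_0)

lemma schroeder_inv_mult: "(1 - schroeder) * schroeder_inv = 1"
  using schroeder_quadratic unfolding schroeder_inv_def
  by (simp add: algebra_simps power2_eq_square)

lemma schroeder_inv_square: "schroeder_inv ^ 2 = (3 - fps_X) * schroeder_inv - 2"
proof -
  have "schroeder_inv ^ 2 - ((3 - fps_X) * schroeder_inv - 2)
      = 2 * (2 * schroeder ^ 2 - (1 + fps_X) * schroeder + fps_X)"
    unfolding schroeder_inv_def by (simp add: algebra_simps power2_eq_square)
  then show ?thesis by (simp add: schroeder_quadratic)
qed

text \<open>\<open>Y\<close> and \<open>Z\<close> stand for the series of trees allowed below the
  two connectives. The difference of the crossed equations has the factor \<open>Y - Z\<close>, the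
  other factor having constant coefficient 1. Then \<open>Y\<close> solves the quadratic, whose
  second root does not vanish at 0.\<close>

lemma schroeder_unique:
  fixes Y Z :: "real fps"
  assumes "Y * (1 - Z) = fps_X * (1 - Z) + Z ^ 2" and "Z * (1 - Y) = fps_X * (1 - Y) + Y ^ 2"
    and "Y $ 0 = 0" and "Z $ 0 = 0"
  shows "Y = schroeder"
proof -
  have "(Y - Z) * (1 - fps_X + Y + Z) = (Y * (1 - Z) - (fps_X * (1 - Z) + Z ^ 2))
      - (Z * (1 - Y) - (fps_X * (1 - Y) + Y ^ 2))"
    by (simp add: algebra_simps power2_eq_square)
  then have "(Y - Z) * (1 - fps_X + Y + Z) = 0"
    using assms(1,2) by simp
  moreover have "1 - fps_X + Y + Z \<noteq> 0"
    by (rule fps_nonzeroI[of _ 0]) (use assms(3,4) in simp)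
  ultimately have YZ: "Y = Z" by auto
  have "(Y - schroeder) * (2 * (Y + schroeder) - (1 + fps_X))
      = - (Y * (1 - Y) - (fps_X * (1 - Y) + Y ^ 2))
        - (2 * schroeder ^ 2 - (1 + fps_X) * schroeder + fps_X)"
    by (simp add: algebra_simps power2_eq_square)
  then have "(Y - schroeder) * (2 * (Y + schroeder) - (1 + fps_X)) = 0"
    using assms(1) YZ by (simp add: schroeder_quadratic)
  moreover have "2 * (Y + schroeder) - (1 + fps_X) \<noteq> 0"
    by (rule fps_nonzeroI[of _ 0]) (use assms(3) in simp)
  ultimately show ?thesis by auto
qed

section \<open>Recurrence and growth of the little Schroeder numbers\<close>

lemma schroeder_sqrt_ode:
  "(1 - 6 * fps_X + fps_X ^ 2) * fps_deriv schroeder_sqrt = (fps_X - 3) * schroeder_sqrt"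
proof -
  let ?D = schroeder_sqrt
  have "fps_deriv (?D ^ 2) = fps_deriv (1 - 6 * fps_X + fps_X ^ 2)"
    by (simp add: schroeder_sqrt_square)
  then have d: "2 * (?D * fps_deriv ?D) = 2 * (fps_X - 3)"
    by (simp add: power2_eq_square algebra_simps)
  then have d: "?D * fps_deriv ?D = fps_X - 3"
    by (metis mult_cancel_left zero_neq_numeral)
  have "(1 - 6 * fps_X + fps_X ^ 2) * fps_deriv ?D = ?D * (?D * fps_deriv ?D)"
    by (subst schroeder_sqrt_square[symmetric]) (simp only: power2_eq_square mult.assoc)
  also have "\<dots> = (fps_X - 3) * ?D" by (simp add: d mult.commute)
  finally show ?thesis .
qed

lemma schroeder_nth_sqrt:
  assumes "k \<ge> 2"
  shows "schroeder $ k = - schroeder_sqrt $ k / 4"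
  using assms by (simp add: schroeder_def)

lemma schroeder_1 [simp]: "schroeder $ Suc 0 = 1"
proof -
  have "(2 * schroeder ^ 2 - (1 + fps_X) * schroeder + fps_X) $ 1 = 0"
    by (simp add: schroeder_quadratic)
  then show ?thesis by (simp add: power2_eq_square algebra_simps numeral_fps_const)
qed

lemma schroeder_2 [simp]: "schroeder $ Suc (Suc 0) = 1"
proof -
  have "(2 * schroeder ^ 2 - (1 + fps_X) * schroeder + fps_X) $ 2 = 0"
    by (simp add: schroeder_quadratic)
  then show ?thesis
    by (simp add: power2_eq_square algebra_simps numeral_fps_const fps_mult_nth numeral_2_eq_2)
qed

text \<open>Coefficient \<open>k + 2\<close> of the linear differential equation for the square
  root. The case \<open>k = 0\<close> is separate because \<open>schroeder\<close> is a multiple of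
  the square root only from index 2 on.\<close>

lemma schroeder_rec:
  "real (k + 3) * schroeder $ (k + 3)
    = (6 * real k + 9) * schroeder $ (k + 2) - real k * schroeder $ (k + 1)"
proof (cases k)
  case 0
  have "(2 * schroeder ^ 2 - (1 + fps_X) * schroeder + fps_X) $ 3 = 0"
    by (simp add: schroeder_quadratic)
  then have "schroeder $ 3 = 3"
    by (simp add: power2_eq_square algebra_simps numeral_fps_const fps_mult_nth numeral_3_eq_3)
  with 0 show ?thesis by (simp add: numeral_3_eq_3 numeral_2_eq_2)
next
  case (Suc j)
  let ?D = schroeder_sqrt
  have "((1 - 6 * fps_X + fps_X ^ 2) * fps_deriv ?D) $ (k + 2) = ((fps_X - 3) * ?D) $ (k + 2)"
    by (simp add: schroeder_sqrt_ode)
  then have "real (k + 3) * ?D $ (k + 3) - 6 * (real (k + 2) * ?D $ (k + 2))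
      + real (k + 1) * ?D $ (k + 1) = ?D $ (k + 1) - 3 * ?D $ (k + 2)"
    unfolding numeral_3_eq_3 numeral_2_eq_2 One_nat_def add_Suc_right add_0_right
    by (simp add: algebra_simps numeral_fps_const mult.assoc)
  moreover have "?D $ (k + 1) = - 4 * schroeder $ (k + 1)" "?D $ (k + 2) = - 4 * schroeder $ (k + 2)"
    "?D $ (k + 3) = - 4 * schroeder $ (k + 3)"
    using Suc by (simp_all add: schroeder_nth_sqrt)
  ultimately show ?thesis
    by (simp only:) (simp add: algebra_simps)
qed

text \<open>The factor 3 keeps the ratios in a region where the limiting recursion
  \<open>6 - 1 / r\<close> for them is a contraction.\<close>

lemma schroeder_growth:
  "schroeder $ (k + 2) > 0 \<and> schroeder $ (k + 3) \<ge> 3 * schroeder $ (k + 2)"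
proof (induction k)
  case 0
  then show ?case using schroeder_rec[of 0] by (simp add: numeral_2_eq_2)
next
  case (Suc k)
  let ?a = "schroeder $ (k + 2)" and ?b = "schroeder $ (k + 3)" and ?c = "schroeder $ (k + 4)"
  have rec: "(real k + 4) * ?c = (6 * real k + 15) * ?b - (real k + 1) * ?a"
    using schroeder_rec[of "Suc k"] by (simp add: algebra_simps eval_nat_numeral)
  have ab: "?a > 0" "?b \<ge> 3 * ?a" using Suc by auto
  have "(real k + 1) * (3 * ?a) \<le> (real k + 1) * ?b"
    using ab by (intro mult_left_mono) auto
  moreover have "0 \<le> real k * ?b" using ab by auto
  ultimately have "(real k + 4) * ?c \<ge> (real k + 4) * (3 * ?b)"
    using rec ab unfolding ring_distribs by linarith
  then have "?c \<ge> 3 * ?b" by simp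
  moreover have "Suc k + 2 = k + 3" "Suc k + 3 = k + 4" by simp_all
  ultimately show ?case using ab by (simp only:) simp
qed

lemma schroeder_pos:
  assumes "k \<ge> 1"
  shows "schroeder $ k > 0"
proof (cases "k = 1")
  case False
  then obtain j where "k = j + 2" using assms by (metis One_nat_def add_2_eq_Suc' le_antisym
    not_less_eq_eq le_add_diff_inverse2 numeral_2_eq_2)
  then show ?thesis using schroeder_growth[of j] by simp
qed simp

lemma schroeder_nonneg [simp]: "schroeder $ k \<ge> 0"
  using schroeder_pos[of k] by (cases k) auto

text \<open>Up to an error of at most \<open>9 / (k + 4)\<close>, consecutive ratios follow
  \<open>r\<close> to \<open>6 - 1 / r\<close>, whose fixed point is \<open>3 + 2 * sqrt 2\<close>.
  Ratios above 3 make this map contract by \<open>1 / 9\<close>, and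
  \<open>12 / 9 / (k + 3) \<le> 3 / (k + 4)\<close> closes the induction with constant 12.\<close>

lemma schroeder_ratio_bound:
  "\<bar>schroeder $ (k + 3) / schroeder $ (k + 2) - (3 + 2 * sqrt 2)\<bar> \<le> 12 / (real k + 3)"
proof (induction k)
  case 0
  have "schroeder $ 3 = 3" using schroeder_rec[of 0] by (simp add: numeral_2_eq_2)
  moreover have "sqrt 2 \<le> 2" by (rule real_le_lsqrt) auto
  ultimately show ?case by (simp add: numeral_2_eq_2)
next
  case (Suc k)
  let ?a = "schroeder $ (k + 2)" and ?b = "schroeder $ (k + 3)" and ?c = "schroeder $ (k + 4)"
  let ?R = "3 + 2 * sqrt 2 :: real"
  define r where "r = ?b / ?a"
  have ab: "?a > 0" "?b \<ge> 3 * ?a" using schroeder_growth[of k] by auto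
  have r3: "r \<ge> 3" using ab by (simp add: r_def field_simps)
  have R3: "?R \<ge> 3" by simp
  have RR: "?R = 6 - 1 / ?R"
  proof -
    have "(3 - 2 * sqrt 2) * ?R = 1" by (simp add: algebra_simps)
    then have "1 / ?R = 3 - 2 * sqrt 2" using R3 by (metis nonzero_eq_divide_eq not_numeral_le_zero)
    then show ?thesis by simp
  qed
  have rec: "(real k + 4) * ?c = (6 * real k + 15) * ?b - (real k + 1) * ?a"
    using schroeder_rec[of "Suc k"] by (simp add: algebra_simps eval_nat_numeral)
  have "?c / ?b = (6 * real k + 15) / (real k + 4) - (real k + 1) / (real k + 4) / r"
  proof -
    have "c / b = x / p - y / p / (b / a)"
      if "p * c = x * b - y * a" "p > 0" "a > 0" "b > 0" for a b c x y p :: real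
    proof -
      have "c = (x * b - y * a) / p" using that by (simp add: field_simps)
      then show ?thesis using that by (simp add: diff_divide_distrib)
    qed
    from this[OF rec] ab show ?thesis by (simp add: r_def)
  qed
  also have "\<dots> = 6 - 9 / (real k + 4) - 1 / r + 3 / (real k + 4) / r"
  proof -
    have e: "(6 * real k + 15) / (real k + 4) = 6 - 9 / (real k + 4)"
      "(real k + 1) / (real k + 4) = 1 - 3 / (real k + 4)"
      by (simp_all add: field_simps)
    show ?thesis unfolding e by (simp add: diff_divide_distrib)
  qed
  finally have "?c / ?b - ?R = (1 / ?R - 1 / r) - (9 / (real k + 4) - 3 / (real k + 4) / r)"
    using RR by linarith
  moreover have "\<bar>1 / ?R - 1 / r\<bar> \<le> \<bar>r - ?R\<bar> / 9"
  proof -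
    have R0: "?R > 0" using R3 by linarith
    then have "?R \<noteq> 0" "r \<noteq> 0" using r3 by linarith+
    then have "1 / ?R - 1 / r = (r - ?R) / (?R * r)"
      by (subst diff_frac_eq) (auto simp only: mult_1 mult_1_right)
    then have "\<bar>1 / ?R - 1 / r\<bar> = \<bar>r - ?R\<bar> / (?R * r)"
      using r3 R3 by (simp add: abs_mult)
    also have "\<dots> \<le> \<bar>r - ?R\<bar> / (3 * 3)"
      using r3 R3 R0 by (intro divide_left_mono mult_mono mult_pos_pos) auto
    finally show ?thesis by simp
  qed
  moreover have "\<bar>9 / (real k + 4) - 3 / (real k + 4) / r\<bar> \<le> 9 / (real k + 4)"
  proof -
    have "3 / (real k + 4) / r \<ge> 0" using r3 by simp
    moreover have "3 / (real k + 4) / r \<le> 3 / (real k + 4) / 1"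
      using r3 by (intro divide_left_mono) auto
    moreover have "3 / (real k + 4) \<le> 9 / (real k + 4)"
      by (intro divide_right_mono) auto
    ultimately show ?thesis by simp
  qed
  ultimately have "\<bar>?c / ?b - ?R\<bar> \<le> \<bar>r - ?R\<bar> / 9 + 9 / (real k + 4)"
    by linarith
  also have "\<dots> \<le> 12 / (real k + 3) / 9 + 9 / (real k + 4)"
    using Suc unfolding r_def by (intro add_right_mono divide_right_mono) auto
  also have "12 / (real k + 3) / 9 \<le> 3 / (real k + 4)"
    by (simp add: field_simps)
  also have "3 / (real k + 4) + 9 / (real k + 4) = 12 / (real k + 4)"
    by (simp flip: add_divide_distrib)
  finally show ?case by (simp add: eval_nat_numeral add.commute)
qed

lemma schroeder_ratio: "(\<lambda>k. schroeder $ Suc k / schroeder $ k) \<longlonglongrightarrow> 3 + 2 * sqrt 2"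
proof -
  have "(\<lambda>k. 12 / (real k + 3)) \<longlonglongrightarrow> 0" by real_asymp
  then have "(\<lambda>k. schroeder $ (k + 3) / schroeder $ (k + 2) - (3 + 2 * sqrt 2)) \<longlonglongrightarrow> 0"
    by (rule Lim_null_comparison[rotated]) (use schroeder_ratio_bound in \<open>auto simp: eventually_at_top_linorder\<close>)
  then have "(\<lambda>k. schroeder $ (k + 3) / schroeder $ (k + 2)) \<longlonglongrightarrow> 3 + 2 * sqrt 2"
    by (simp add: LIM_zero_iff)
  then have "(\<lambda>k. schroeder $ Suc (k + 2) / schroeder $ (k + 2)) \<longlonglongrightarrow> 3 + 2 * sqrt 2"
    by (simp add: eval_nat_numeral)
  then show ?thesis by (rule LIMSEQ_offset)
qed

section \<open>Series bounded by the tree counts\<close>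

definition rho :: real where "rho = 3 - 2 * sqrt 2"

text \<open>The reference sequence for all growth estimates. The summand 1 only changes index 0,
  where it makes the value positive, so that every coefficient may be divided by it.\<close>

definition wt :: "nat \<Rightarrow> real" where "wt m = (1 + schroeder) $ m"

lemma rho_pos: "rho > 0"
proof -
  have "2 * sqrt 2 < 3" by (rule power2_less_imp_less) (auto simp: power_mult_distrib)
  then show ?thesis by (simp add: rho_def)
qed

lemma rho_inverse: "rho = 1 / (3 + 2 * sqrt 2)"
proof -
  have "rho * (3 + 2 * sqrt 2) = 1" by (simp add: rho_def algebra_simps)
  moreover have "3 + 2 * sqrt 2 > (0 :: real)" by (simp add: add_pos_pos)
  ultimately show ?thesis by (simp add: field_simps)
qed

lemma wt_0 [simp]: "wt 0 = 1" by (simp add: wt_def)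

lemma wt_eq: "m \<ge> 1 \<Longrightarrow> wt m = schroeder $ m" by (simp add: wt_def)

lemma wt_pos [simp]: "wt m > 0"
  using schroeder_pos[of m] by (cases "m = 0") (auto simp: wt_eq)

lemma wt_nonneg [simp]: "wt m \<ge> 0"
  using wt_pos[of m] by linarith

lemma wt_neq_0 [simp]: "wt m \<noteq> 0"
  using wt_pos[of m] by linarith

lemma wt_Suc_ratio: "(\<lambda>m. wt m / wt (Suc m)) \<longlonglongrightarrow> rho"
proof -
  have "(\<lambda>m. inverse (schroeder $ Suc m / schroeder $ m)) \<longlonglongrightarrow> inverse (3 + 2 * sqrt 2)"
    by (intro tendsto_inverse schroeder_ratio) (simp add: add_pos_pos less_imp_neq[symmetric])
  then have "(\<lambda>m. schroeder $ m / schroeder $ Suc m) \<longlonglongrightarrow> rho"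
    by (simp add: rho_inverse inverse_eq_divide)
  moreover have "\<forall>\<^sub>F m in sequentially. schroeder $ m / schroeder $ Suc m = wt m / wt (Suc m)"
    using eventually_ge_at_top[of 1] by eventually_elim (simp add: wt_eq)
  ultimately show ?thesis by (rule Lim_transform_eventually)
qed

lemma wt_ratio: "(\<lambda>m. wt (m - j) / wt m) \<longlonglongrightarrow> rho ^ j"
proof -
  have "(\<lambda>m. wt m / wt (m + j)) \<longlonglongrightarrow> rho ^ j"
  proof (induction j)
    case 0
    then show ?case by simp
  next
    case (Suc j)
    have "(\<lambda>m. wt (m + j) / wt (Suc (m + j))) \<longlonglongrightarrow> rho"
      using LIMSEQ_ignore_initial_segment[OF wt_Suc_ratio] by simp
    from tendsto_mult[OF this Suc] show ?case by simp
  qed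
  then have "(\<lambda>m. wt (m + j - j) / wt (m + j)) \<longlonglongrightarrow> rho ^ j" by simp
  then show ?thesis by (rule LIMSEQ_offset)
qed

section \<open>Convergence at the singularity\<close>

lemma convolution_sum_le:
  fixes f :: "nat \<Rightarrow> nat \<Rightarrow> real"
  assumes "\<And>i j. f i j \<ge> 0" and "finite A" and "finite B"
    and "\<And>i j. i + j \<le> N \<Longrightarrow> f i j \<noteq> 0 \<Longrightarrow> i \<in> A \<and> j \<in> B"
  shows "(\<Sum>m\<le>N. \<Sum>i=0..m. f i (m - i)) \<le> (\<Sum>i\<in>A. \<Sum>j\<in>B. f i j)"
proof -
  have "(\<Sum>m\<le>N. \<Sum>i=0..m. f i (m - i)) = (\<Sum>(i,j)\<in>{(i,j). i + j \<le> N}. f i j)"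
    by (simp add: sum.triangle_reindex_eq atMost_atLeast0)
  also have "\<dots> = (\<Sum>(i,j)\<in>{(i,j). i + j \<le> N \<and> f i j \<noteq> 0}. f i j)"
  proof (rule sum.mono_neutral_right)
    have "{(i,j). i + j \<le> N} \<subseteq> {..N} \<times> {..N}" by auto
    then show "finite {(i,j). i + j \<le> N}" by (rule finite_subset) auto
  qed auto
  also have "\<dots> \<le> (\<Sum>(i,j)\<in>A \<times> B. f i j)"
    by (rule sum_mono2) (use assms in auto)
  also have "\<dots> = (\<Sum>i\<in>A. \<Sum>j\<in>B. f i j)" by (simp add: sum.cartesian_product)
  finally show ?thesis .
qed

lemma fps_mult_nth_power:
  fixes a b :: "real fps"
  shows "(a * b) $ m * x ^ m = (\<Sum>i=0..m. (a $ i * x ^ i) * (b $ (m - i) * x ^ (m - i)))"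
  unfolding fps_mult_nth sum_distrib_right
proof (rule sum.cong)
  fix i assume "i \<in> {0..m}"
  then have "x ^ m = x ^ i * x ^ (m - i)" by (simp flip: power_add)
  then show "a $ i * b $ (m - i) * x ^ m = (a $ i * x ^ i) * (b $ (m - i) * x ^ (m - i))"
    by simp
qed simp

lemma partial_sum_mult_le:
  fixes a b :: "real fps"
  assumes "\<And>m. a $ m \<ge> 0" and "\<And>m. b $ m \<ge> 0" and "x \<ge> 0"
  shows "(\<Sum>m\<le>N. (a * b) $ m * x ^ m) \<le> (\<Sum>m\<le>N. a $ m * x ^ m) * (\<Sum>m\<le>N. b $ m * x ^ m)"
proof -
  have "(\<Sum>m\<le>N. (a * b) $ m * x ^ m)
      = (\<Sum>m\<le>N. \<Sum>i=0..m. (a $ i * x ^ i) * (b $ (m - i) * x ^ (m - i)))"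
    by (simp only: fps_mult_nth_power)
  also have "\<dots> \<le> (\<Sum>i\<le>N. \<Sum>j\<le>N. (a $ i * x ^ i) * (b $ j * x ^ j))"
    by (rule convolution_sum_le) (use assms in auto)
  finally show ?thesis by (simp add: sum_product)
qed

text \<open>With zero constant coefficients, two contributing indices of sum at most
  \<open>N + 1\<close> are both at most \<open>N\<close>. This gain of one index drives the
  induction for the partial sums of \<open>schroeder\<close>.\<close>

lemma partial_sum_mult_Suc_le:
  fixes a b :: "real fps"
  assumes "\<And>m. a $ m \<ge> 0" and "\<And>m. b $ m \<ge> 0" and "x \<ge> 0" and "a $ 0 = 0" and "b $ 0 = 0"
  shows "(\<Sum>m\<le>Suc N. (a * b) $ m * x ^ m)
    \<le> (\<Sum>m\<le>N. a $ m * x ^ m) * (\<Sum>m\<le>N. b $ m * x ^ m)"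
proof -
  have "(\<Sum>m\<le>Suc N. (a * b) $ m * x ^ m)
      = (\<Sum>m\<le>Suc N. \<Sum>i=0..m. (a $ i * x ^ i) * (b $ (m - i) * x ^ (m - i)))"
    by (simp only: fps_mult_nth_power)
  also have "\<dots> \<le> (\<Sum>i\<le>N. \<Sum>j\<le>N. (a $ i * x ^ i) * (b $ j * x ^ j))"
  proof (rule convolution_sum_le)
    fix i j assume ij: "i + j \<le> Suc N" "(a $ i * x ^ i) * (b $ j * x ^ j) \<noteq> 0"
    then have "a $ i \<noteq> 0" "b $ j \<noteq> 0" by auto
    then have "i \<noteq> 0" "j \<noteq> 0" using assms(4,5) by metis+
    then show "i \<in> {..N} \<and> j \<in> {..N}" using ij(1) by auto
  qed (use assms in auto)
  finally show ?thesis by (simp add: sum_product)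
qed

text \<open>Fixed-point form of the quadratic: a tree is a leaf or a first child with a nonempty
  list of further children.\<close>

lemma schroeder_mult_inv: "schroeder * (schroeder_inv - 1) = schroeder - fps_X"
proof -
  have "schroeder * (schroeder_inv - 1) - (schroeder - fps_X)
      = 2 * schroeder ^ 2 - (1 + fps_X) * schroeder + fps_X"
    unfolding schroeder_inv_def by (simp add: algebra_simps power2_eq_square)
  then show ?thesis by (simp add: schroeder_quadratic)
qed

lemma schroeder_inv_nth:
  "(schroeder_inv - 1) $ m = (if m = 1 then 1 else 2 * schroeder $ m)"
  by (simp add: schroeder_inv_def numeral_fps_const)

text \<open>The bound is the double root of the quadratic equation at \<open>rho\<close>.\<close>

lemma schroeder_partial_sum_le:
  "N \<ge> 1 \<Longrightarrow> (\<Sum>m\<le>N. schroeder $ m * rho ^ m) \<le> 1 - sqrt 2 / 2"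
proof (induction N rule: dec_induct)
  case base
  have "3 * sqrt 2 \<ge> (4::real)" by (rule power2_le_imp_le) (auto simp: power_mult_distrib)
  then show ?case by (simp add: rho_def)
next
  case (step N)
  let ?a = "\<Sum>m\<le>N. schroeder $ m * rho ^ m"
  have "(\<Sum>m\<le>Suc N. schroeder $ m * rho ^ m)
      = (\<Sum>m\<le>Suc N. (schroeder * (schroeder_inv - 1)) $ m * rho ^ m) + rho"
  proof -
    have "(\<Sum>m\<le>Suc N. (schroeder * (schroeder_inv - 1)) $ m * rho ^ m)
        = (\<Sum>m\<le>Suc N. schroeder $ m * rho ^ m - (if m = 1 then rho else 0))"
      unfolding schroeder_mult_inv by (intro sum.cong) (auto simp: algebra_simps)
    also have "\<dots> = (\<Sum>m\<le>Suc N. schroeder $ m * rho ^ m) - (\<Sum>m\<le>Suc N. if m = 1 then rho else 0)"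
      by (simp only: sum_subtractf)
    finally show ?thesis by (simp del: sum.atMost_Suc)
  qed
  also have "(\<Sum>m\<le>Suc N. (schroeder * (schroeder_inv - 1)) $ m * rho ^ m)
      \<le> ?a * (\<Sum>m\<le>N. (schroeder_inv - 1) $ m * rho ^ m)"
    by (rule partial_sum_mult_Suc_le)
      (use rho_pos in \<open>auto simp: schroeder_inv_nth simp del: fps_sub_nth\<close>)
  also have "(\<Sum>m\<le>N. (schroeder_inv - 1) $ m * rho ^ m) = 2 * ?a - rho"
  proof -
    have "(\<Sum>m\<le>N. (schroeder_inv - 1) $ m * rho ^ m)
        = (\<Sum>m\<le>N. 2 * (schroeder $ m * rho ^ m) - (if m = 1 then rho else 0))"
      by (intro sum.cong) (auto simp: schroeder_inv_nth simp del: fps_sub_nth)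
    also have "\<dots> = 2 * ?a - (\<Sum>m\<le>N. if m = 1 then rho else 0)"
      by (simp only: sum_subtractf sum_distrib_left)
    finally show ?thesis using step.hyps by simp
  qed
  \<comment> \<open>The claimed bound is a fixed point of the map sending \<open>s\<close> to
    \<open>s * (2 * s - rho) + rho\<close>, which is increasing for
    \<open>s \<ge> rho\<close>.\<close>
  also have "?a * (2 * ?a - rho) \<le> (1 - sqrt 2 / 2) * (2 * (1 - sqrt 2 / 2) - rho)"
  proof (rule mult_mono)
    show "2 * ?a - rho \<le> 2 * (1 - sqrt 2 / 2) - rho" using step.IH by simp
    have "schroeder $ 1 * rho ^ 1 \<le> ?a"
      by (rule member_le_sum) (use step.hyps rho_pos in auto)
    then show "0 \<le> 2 * ?a - rho" using rho_pos by simp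
    show "0 \<le> 1 - sqrt 2 / 2" using sqrt2_less_2 by simp
  qed (use step.IH in auto)
  also have "(1 - sqrt 2 / 2) * (2 * (1 - sqrt 2 / 2) - rho) + rho = 1 - sqrt 2 / 2"
    by (simp add: rho_def field_simps)
  finally show ?case by simp
qed

lemma summable_schroeder: "summable (\<lambda>m. schroeder $ m * rho ^ m)"
proof (rule summableI_nonneg_bounded)
  fix N
  show "(\<Sum>m<N. schroeder $ m * rho ^ m) \<le> 1 - sqrt 2 / 2"
  proof -
    have "(\<Sum>m<N. schroeder $ m * rho ^ m) \<le> (\<Sum>m\<le>Suc N. schroeder $ m * rho ^ m)"
      by (rule sum_mono2) (use rho_pos in auto)
    also have "\<dots> \<le> 1 - sqrt 2 / 2" by (rule schroeder_partial_sum_le) simp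
    finally show ?thesis .
  qed
qed (use rho_pos in auto)

lemma summable_wt: "summable (\<lambda>m. wt m * rho ^ m)"
proof -
  have "summable (\<lambda>m. schroeder $ Suc m * rho ^ Suc m)"
    using summable_schroeder by (subst summable_Suc_iff)
  then have "summable (\<lambda>m. wt (Suc m) * rho ^ Suc m)"
    by (simp add: wt_eq)
  then show ?thesis by (subst (asm) summable_Suc_iff)
qed

section \<open>Coefficients of the order of the tree counts, and evaluation at
  \<open>rho\<close>\<close>

definition wt_bounded :: "real fps \<Rightarrow> bool" where
  "wt_bounded a \<longleftrightarrow> (\<exists>C. \<forall>m. \<bar>a $ m\<bar> \<le> C * wt m)"

definition fps_at_rho :: "real fps \<Rightarrow> real" where
  "fps_at_rho a = (\<Sum>m. a $ m * rho ^ m)"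

lemma wt_boundedE:
  assumes "wt_bounded a"
  obtains C where "C > 0" and "\<And>m. \<bar>a $ m\<bar> \<le> C * wt m"
proof -
  obtain C where C: "\<And>m. \<bar>a $ m\<bar> \<le> C * wt m" using assms by (auto simp: wt_bounded_def)
  have "\<bar>a $ m\<bar> \<le> (\<bar>C\<bar> + 1) * wt m" for m
    using C[of m] by (rule order_trans) (intro mult_right_mono, auto)
  with that[of "\<bar>C\<bar> + 1"] show ?thesis by auto
qed

lemma wt_bounded_summable_norm:
  assumes "wt_bounded a"
  shows "summable (\<lambda>m. norm (a $ m * rho ^ m))"
proof -
  obtain C where C: "\<And>m. \<bar>a $ m\<bar> \<le> C * wt m" using assms wt_boundedE by metis
  show ?thesis
  proof (rule summable_comparison_test')
    show "summable (\<lambda>m. C * (wt m * rho ^ m))" by (intro summable_mult summable_wt)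
    show "norm (norm (a $ m * rho ^ m)) \<le> C * (wt m * rho ^ m)" for m
      using C[of m] rho_pos by (simp add: abs_mult mult.assoc[symmetric] mult_right_mono)
  qed
qed

lemma wt_bounded_summable: "wt_bounded a \<Longrightarrow> summable (\<lambda>m. a $ m * rho ^ m)"
  by (rule summable_norm_cancel[OF wt_bounded_summable_norm])

lemma wt_bounded_add [intro]: "wt_bounded a \<Longrightarrow> wt_bounded b \<Longrightarrow> wt_bounded (a + b)"
proof (elim wt_boundedE)
  fix C D assume "\<And>m. \<bar>a $ m\<bar> \<le> C * wt m" "\<And>m. \<bar>b $ m\<bar> \<le> D * wt m"
  then have "\<bar>(a + b) $ m\<bar> \<le> (C + D) * wt m" for m
    using abs_triangle_ineq[of "a $ m" "b $ m"] by (simp add: algebra_simps) (smt (verit))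
  then show ?thesis unfolding wt_bounded_def by blast
qed

lemma wt_bounded_minus [intro]: "wt_bounded a \<Longrightarrow> wt_bounded (- a)"
  by (simp add: wt_bounded_def)

lemma wt_bounded_diff [intro]: "wt_bounded a \<Longrightarrow> wt_bounded b \<Longrightarrow> wt_bounded (a - b)"
  using wt_bounded_add[of a "- b"] wt_bounded_minus[of b] by simp

lemma wt_bounded_0 [simp, intro]: "wt_bounded 0"
  by (auto simp: wt_bounded_def intro!: exI[of _ 0])

lemma wt_bounded_const [simp, intro]: "wt_bounded (fps_const c)"
  by (auto simp: wt_bounded_def intro!: exI[of _ "\<bar>c\<bar>"] mult_nonneg_nonneg)

lemma wt_bounded_1 [simp, intro]: "wt_bounded 1"
  using wt_bounded_const[of 1] by simp

lemma wt_bounded_numeral [simp, intro]: "wt_bounded (numeral k)"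
  by (simp add: numeral_fps_const)

lemma wt_bounded_X [simp, intro]: "wt_bounded fps_X"
  by (auto simp: wt_bounded_def wt_eq intro!: exI[of _ 1])

lemma wt_bounded_schroeder [simp, intro]: "wt_bounded schroeder"
proof -
  have "\<bar>schroeder $ m\<bar> \<le> 1 * wt m" for m by (cases m) (auto simp: wt_eq)
  then show ?thesis unfolding wt_bounded_def by blast
qed

lemma wt_bounded_sum [intro]:
  "(\<And>i. i \<in> I \<Longrightarrow> wt_bounded (f i)) \<Longrightarrow> wt_bounded (\<Sum>i\<in>I. f i)"
  by (induction I rule: infinite_finite_induct) auto

lemma wt_bounded_mono:
  assumes "wt_bounded b" and "\<And>m. \<bar>a $ m\<bar> \<le> b $ m"
  shows "wt_bounded a"
proof -
  obtain C where C: "\<And>m. \<bar>b $ m\<bar> \<le> C * wt m" using assms(1) wt_boundedE by metis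
  have "\<bar>a $ m\<bar> \<le> C * wt m" for m
    using C[of m] assms(2)[of m] by linarith
  then show ?thesis unfolding wt_bounded_def by blast
qed

lemma wt_convolution: "(\<Sum>i=0..m. wt i * wt (m - i)) = (1 + schroeder) ^ 2 $ m"
  by (simp add: wt_def power2_eq_square fps_mult_nth)

text \<open>The quadratic equation turns \<open>2 * (1 + T) ^ 2\<close> into
  \<open>2 + 5 * T + X * T - X\<close>; the polynomial terms vanish from index 2 on.\<close>

lemma wt_convolution_eq:
  assumes "m \<ge> 2"
  shows "(\<Sum>i=0..m. wt i * wt (m - i)) = 5 / 2 * wt m + wt (m - 1) / 2"
proof -
  have "2 * (1 + schroeder) ^ 2 = 2 + 5 * schroeder + fps_X * schroeder - fps_X
      + (2 * schroeder ^ 2 - (1 + fps_X) * schroeder + fps_X)"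
    by (simp add: algebra_simps power2_eq_square)
  then have "2 * (1 + schroeder) ^ 2 = 2 + 5 * schroeder + fps_X * schroeder - fps_X"
    by (simp only: schroeder_quadratic add_0_right)
  then have "(2 * (1 + schroeder) ^ 2) $ m = (2 + 5 * schroeder + fps_X * schroeder - fps_X) $ m"
    by simp
  then show ?thesis
    unfolding wt_convolution using assms by (simp add: wt_eq numeral_fps_const)
qed

text \<open>The limit equals twice the value \<open>2 - sqrt 2 / 2\<close> of
  \<open>1 + schroeder\<close> at \<open>rho\<close>. This is the subexponential property: the two
  ends of the convolution account for all of it.\<close>

lemma wt_convolution_limit:
  "(\<lambda>m. (\<Sum>i=0..m. wt i * wt (m - i)) / wt m) \<longlonglongrightarrow> 5 / 2 + rho / 2"
proof -
  have "(\<lambda>m. 5 / 2 + wt (m - 1) / wt m / 2) \<longlonglongrightarrow> 5 / 2 + rho / 2"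
    using wt_ratio[of 1] by (intro tendsto_intros) auto
  moreover have "\<forall>\<^sub>F m in sequentially.
      5 / 2 + wt (m - 1) / wt m / 2 = (\<Sum>i=0..m. wt i * wt (m - i)) / wt m"
    using eventually_ge_at_top[of 2]
  proof eventually_elim
    case (elim m)
    show ?case unfolding wt_convolution_eq[OF elim] by (simp add: add_divide_distrib)
  qed
  ultimately show ?thesis by (rule Lim_transform_eventually)
qed

text \<open>The convolution square of \<open>wt\<close> is itself at most a constant times
  \<open>wt\<close>, since the quotients converge.\<close>

lemma wt_bounded_mult [intro]:
  assumes "wt_bounded a" and "wt_bounded b"
  shows "wt_bounded (a * b)"
proof -
  obtain C where C: "C > 0" "\<And>m. \<bar>a $ m\<bar> \<le> C * wt m" using assms(1) wt_boundedE by metis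
  obtain D where D: "D > 0" "\<And>m. \<bar>b $ m\<bar> \<le> D * wt m" using assms(2) wt_boundedE by metis
  have "Bseq (\<lambda>m. (\<Sum>i=0..m. wt i * wt (m - i)) / wt m)"
    using wt_convolution_limit convergent_imp_Bseq convergentI by blast
  then obtain K where K: "\<And>m. norm ((\<Sum>i=0..m. wt i * wt (m - i)) / wt m) \<le> K"
    by (auto simp: Bseq_def)
  have "\<bar>(a * b) $ m\<bar> \<le> (C * D * K) * wt m" for m
  proof -
    have "\<bar>(a * b) $ m\<bar> \<le> (\<Sum>i=0..m. \<bar>a $ i\<bar> * \<bar>b $ (m - i)\<bar>)"
      unfolding fps_mult_nth using sum_abs by (rule order_trans) (simp add: abs_mult)
    also have "\<dots> \<le> (\<Sum>i=0..m. (C * wt i) * (D * wt (m - i)))"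
      by (intro sum_mono mult_mono C D) (use C D in auto)
    also have "\<dots> = C * D * (\<Sum>i=0..m. wt i * wt (m - i))"
      by (simp add: sum_distrib_left mult.assoc mult.left_commute)
    also have "(\<Sum>i=0..m. wt i * wt (m - i)) \<le> K * wt m"
      using K[of m] by (simp add: abs_divide sum_nonneg divide_le_eq)
    finally show ?thesis using C(1) D(1) by (simp add: mult.assoc)
  qed
  then show ?thesis unfolding wt_bounded_def by blast
qed

lemma wt_bounded_schroeder_inv [simp, intro]: "wt_bounded schroeder_inv"
  unfolding schroeder_inv_def by auto

lemma fps_at_rho_add: "wt_bounded a \<Longrightarrow> wt_bounded b \<Longrightarrow> fps_at_rho (a + b) = fps_at_rho a + fps_at_rho b"
  unfolding fps_at_rho_def
  by (simp add: suminf_add[OF wt_bounded_summable wt_bounded_summable] distrib_right)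

lemma fps_at_rho_diff: "wt_bounded a \<Longrightarrow> wt_bounded b \<Longrightarrow> fps_at_rho (a - b) = fps_at_rho a - fps_at_rho b"
  unfolding fps_at_rho_def
  by (simp add: suminf_diff[OF wt_bounded_summable wt_bounded_summable] left_diff_distrib)

lemma fps_at_rho_mult:
  assumes "wt_bounded a" and "wt_bounded b"
  shows "fps_at_rho (a * b) = fps_at_rho a * fps_at_rho b"
proof -
  have "(a * b) $ m * rho ^ m = (\<Sum>i\<le>m. (a $ i * rho ^ i) * (b $ (m - i) * rho ^ (m - i)))" for m
    by (simp only: fps_mult_nth_power atMost_atLeast0)
  then show ?thesis
    unfolding fps_at_rho_def
    using Cauchy_product[OF wt_bounded_summable_norm wt_bounded_summable_norm, OF assms] by simp
qed

lemma fps_at_rho_const [simp]: "fps_at_rho (fps_const c) = c"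
proof -
  have "(\<lambda>m. fps_const c $ m * rho ^ m) sums (\<Sum>m\<in>{0}. fps_const c $ m * rho ^ m)"
    by (rule sums_finite) auto
  then show ?thesis by (simp add: fps_at_rho_def sums_iff)
qed

lemma fps_at_rho_1 [simp]: "fps_at_rho 1 = 1"
  using fps_at_rho_const[of 1] by simp

lemma fps_at_rho_0 [simp]: "fps_at_rho 0 = 0"
  using fps_at_rho_const[of 0] by simp

lemma fps_at_rho_numeral [simp]: "fps_at_rho (numeral k) = numeral k"
  by (simp add: numeral_fps_const)

lemma fps_at_rho_X [simp]: "fps_at_rho fps_X = rho"
proof -
  have "(\<lambda>m. fps_X $ m * rho ^ m) sums (\<Sum>m\<in>{1}. fps_X $ m * rho ^ m)"
    by (rule sums_finite) auto
  then show ?thesis by (simp add: fps_at_rho_def sums_iff)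
qed

lemma fps_at_rho_sum:
  "(\<And>i. i \<in> I \<Longrightarrow> wt_bounded (f i)) \<Longrightarrow> fps_at_rho (\<Sum>i\<in>I. f i) = (\<Sum>i\<in>I. fps_at_rho (f i))"
proof (induction I rule: infinite_finite_induct)
  case (insert x F)
  then show ?case by (simp add: fps_at_rho_add wt_bounded_sum)
qed auto

lemma fps_at_rho_nonneg: "wt_bounded a \<Longrightarrow> (\<And>m. a $ m \<ge> 0) \<Longrightarrow> fps_at_rho a \<ge> 0"
  unfolding fps_at_rho_def using rho_pos by (intro suminf_nonneg wt_bounded_summable) auto

lemma partial_sum_le_fps_at_rho:
  assumes "wt_bounded a" and "\<And>m. a $ m \<ge> 0" and "finite I"
  shows "(\<Sum>m\<in>I. a $ m * rho ^ m) \<le> fps_at_rho a"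
  unfolding fps_at_rho_def
  by (rule sum_le_suminf) (use assms rho_pos wt_bounded_summable in auto)

text \<open>Evaluating the quadratic equation at \<open>rho\<close> leaves no choice of branch,
  because its two roots coincide there.\<close>

lemma fps_at_rho_schroeder: "fps_at_rho schroeder = 1 - sqrt 2 / 2"
proof -
  let ?t = "fps_at_rho schroeder"
  have "fps_at_rho (2 * schroeder ^ 2 - (1 + fps_X) * schroeder + fps_X) = 0"
    by (simp add: schroeder_quadratic)
  then have "2 * ?t ^ 2 - (1 + rho) * ?t + rho = 0"
    by (simp add: fps_at_rho_add fps_at_rho_diff fps_at_rho_mult power2_eq_square
        wt_bounded_add wt_bounded_diff wt_bounded_mult)
  moreover have "2 * ?t ^ 2 - (1 + rho) * ?t + rho = 2 * (?t - (1 - sqrt 2 / 2)) ^ 2"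
    by (simp add: rho_def algebra_simps power2_eq_square)
  ultimately show ?thesis by simp
qed

lemma fps_at_rho_schroeder_inv: "fps_at_rho schroeder_inv = sqrt 2"
  unfolding schroeder_inv_def
  by (simp add: fps_at_rho_add fps_at_rho_diff fps_at_rho_mult wt_bounded_diff wt_bounded_mult
      fps_at_rho_schroeder rho_def)

section \<open>Subexponential convolution\<close>

text \<open>The last sum is indexed from the far end, so that both outer sums have a bounded index
  \<open>j\<close> and a factor at \<open>m - j\<close>.\<close>

lemma fps_mult_nth_split:
  fixes a b :: "real fps"
  assumes "m \<ge> 2 * J"
  shows "(a * b) $ m = (\<Sum>j<J. a $ j * b $ (m - j)) + (\<Sum>j\<in>{J..m-J}. a $ j * b $ (m - j))
    + (\<Sum>j<J. b $ j * a $ (m - j))"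
proof -
  have "{0..m} = ({..<J} \<union> {J..m-J}) \<union> (\<lambda>j. m - j) ` {..<J}"
  proof (intro subset_antisym subsetI)
    fix i assume i: "i \<in> {0..m}"
    show "i \<in> ({..<J} \<union> {J..m-J}) \<union> (\<lambda>j. m - j) ` {..<J}"
    proof (cases "i \<le> m - J")
      case False
      then have "i = m - (m - i)" "m - i < J" using i assms by auto
      then show ?thesis by blast
    qed auto
  qed (use assms in auto)
  then have "(a * b) $ m
      = (\<Sum>i\<in>({..<J} \<union> {J..m-J}) \<union> (\<lambda>j. m - j) ` {..<J}. a $ i * b $ (m - i))"
    by (simp add: fps_mult_nth)
  also have "\<dots> = (\<Sum>i\<in>{..<J} \<union> {J..m-J}. a $ i * b $ (m - i))
      + (\<Sum>i\<in>(\<lambda>j. m - j) ` {..<J}. a $ i * b $ (m - i))"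
    by (rule sum.union_disjoint) (use assms in auto)
  also have "(\<Sum>i\<in>{..<J} \<union> {J..m-J}. a $ i * b $ (m - i))
      = (\<Sum>j<J. a $ j * b $ (m - j)) + (\<Sum>j\<in>{J..m-J}. a $ j * b $ (m - j))"
    by (rule sum.union_disjoint) auto
  also have "(\<Sum>i\<in>(\<lambda>j. m - j) ` {..<J}. a $ i * b $ (m - i))
      = (\<Sum>j<J. b $ j * a $ (m - j))"
  proof (subst sum.reindex)
    show "inj_on (\<lambda>j. m - j) {..<J}" using assms by (auto simp: inj_on_def)
    have "m - (m - j) = j" if "j < J" for j using that assms by simp
    then show "sum ((\<lambda>i. a $ i * b $ (m - i)) \<circ> (\<lambda>j. m - j)) {..<J} = (\<Sum>j<J. b $ j * a $ (m - j))"
      by (intro sum.cong) (auto simp: mult.commute)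
  qed
  finally show ?thesis .
qed

text \<open>The whole convolution is asymptotically \<open>2 * ?v * wt m\<close>, and each of the
  two ends is asymptotically \<open>wt m\<close> times a partial sum of the series with value
  \<open>?v\<close>. For large \<open>J\<close> these nearly exhaust the total, and the middle is
  what remains.\<close>

lemma wt_middle_small:
  assumes "\<epsilon> > 0"
  obtains J where "\<forall>\<^sub>F m in sequentially. (\<Sum>j\<in>{J..m-J}. wt j * wt (m - j)) \<le> \<epsilon> * wt m"
proof -
  let ?v = "fps_at_rho (1 + schroeder)"
  have v: "?v = 2 - sqrt 2 / 2" by (simp add: fps_at_rho_add fps_at_rho_schroeder)
  have "(\<lambda>J. \<Sum>j<J. wt j * rho ^ j) \<longlonglongrightarrow> ?v"
    using summable_LIMSEQ[OF summable_wt] by (simp add: fps_at_rho_def wt_def)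
  then have "\<forall>\<^sub>F J in sequentially. (\<Sum>j<J. wt j * rho ^ j) > ?v - \<epsilon> / 2"
    using assms by (intro order_tendstoD) auto
  then obtain J where J: "(\<Sum>j<J. wt j * rho ^ j) > ?v - \<epsilon> / 2"
    by (auto simp: eventually_at_top_linorder)
  have "(\<lambda>m. (\<Sum>i=0..m. wt i * wt (m - i)) / wt m - 2 * (\<Sum>j<J. wt j * (wt (m - j) / wt m)))
      \<longlonglongrightarrow> (5 / 2 + rho / 2) - 2 * (\<Sum>j<J. wt j * rho ^ j)"
    by (intro tendsto_intros wt_convolution_limit wt_ratio)
  moreover have "(5 / 2 + rho / 2) - 2 * (\<Sum>j<J. wt j * rho ^ j) < \<epsilon>"
    using J unfolding v rho_def by (simp add: field_simps)
  ultimately have "\<forall>\<^sub>F m in sequentially. (\<Sum>i=0..m. wt i * wt (m - i)) / wt m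
      - 2 * (\<Sum>j<J. wt j * (wt (m - j) / wt m)) < \<epsilon>"
    by (rule order_tendstoD)
  then have "\<forall>\<^sub>F m in sequentially. (\<Sum>j\<in>{J..m-J}. wt j * wt (m - j)) \<le> \<epsilon> * wt m"
    using eventually_ge_at_top[of "2 * J"]
  proof eventually_elim
    case (elim m)
    have "(\<Sum>i=0..m. wt i * wt (m - i))
        = 2 * (\<Sum>j<J. wt j * wt (m - j)) + (\<Sum>j\<in>{J..m-J}. wt j * wt (m - j))"
      using fps_mult_nth_split[OF elim(2), of "1 + schroeder" "1 + schroeder"]
      unfolding wt_def fps_mult_nth by linarith
    moreover have "(\<Sum>j<J. wt j * (wt (m - j) / wt m)) = (\<Sum>j<J. wt j * wt (m - j)) / wt m"
      by (simp add: sum_divide_distrib)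
    ultimately have "(\<Sum>j\<in>{J..m-J}. wt j * wt (m - j)) / wt m < \<epsilon>"
      using elim(1) by (simp add: add_divide_distrib)
    then show ?case by (simp add: divide_less_eq)
  qed
  then show ?thesis by (rule that)
qed

text \<open>A renewal equation whose kernel has total mass below one at the singularity preserves the
  order of growth of \<open>wt\<close>: in the convolution \<open>R * G\<close> at most one index can be large.\<close>

lemma wt_bounded_renewal:
  fixes G H R :: "real fps"
  assumes R: "wt_bounded R" and H: "wt_bounded H"
    and nonneg: "\<And>m. R $ m \<ge> 0" "\<And>m. H $ m \<ge> 0" "\<And>m. G $ m \<ge> 0"
    and R0: "R $ 0 = 0" and R1: "fps_at_rho R < 1"
    and G: "G = H + R * G"
  shows "wt_bounded G"
proof -
  define \<theta> where "\<theta> = fps_at_rho R"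
  define \<Gamma> where "\<Gamma> = fps_at_rho H / (1 - \<theta>)"
  \<comment> \<open>Of the gap \<open>1 - \<theta> = 4 * \<delta>\<close>, one part each goes to the
    head and the middle of the convolution; the other two absorb \<open>H\<close> and the terms
    where \<open>R\<close> has the large index.\<close>
  define \<delta> where "\<delta> = (1 - \<theta>) / 4"
  have \<delta>: "\<delta> > 0" using R1 by (simp add: \<delta>_def \<theta>_def)
  have G_nth: "G $ m = H $ m + (R * G) $ m" for m
    using arg_cong[OF G, of "\<lambda>x. x $ m"] by simp
  \<comment> \<open>A partial sum \<open>?P\<close> satisfies
    \<open>?P \<le> fps_at_rho H + \<theta> * ?P\<close>, which can be solved for \<open>?P\<close>.
    This bounds \<open>G\<close> at \<open>rho\<close> before any growth of its coefficients is
    known.\<close>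
  have partial: "(\<Sum>m\<in>I. G $ m * rho ^ m) \<le> \<Gamma>" if fin: "finite I" for I
  proof -
    obtain N where N: "I \<subseteq> {..N}" using fin unfolding finite_nat_iff_bounded_le by auto
    let ?P = "\<Sum>m\<le>N. G $ m * rho ^ m"
    have P: "?P \<ge> 0" using nonneg rho_pos by (intro sum_nonneg) auto
    have "?P = (\<Sum>m\<le>N. H $ m * rho ^ m) + (\<Sum>m\<le>N. (R * G) $ m * rho ^ m)"
      unfolding sum.distrib[symmetric] distrib_right[symmetric] G_nth[symmetric] ..
    also have "(\<Sum>m\<le>N. H $ m * rho ^ m) \<le> fps_at_rho H"
      by (rule partial_sum_le_fps_at_rho) (use H nonneg in auto)
    also have "(\<Sum>m\<le>N. (R * G) $ m * rho ^ m) \<le> (\<Sum>m\<le>N. R $ m * rho ^ m) * ?P"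
      by (rule partial_sum_mult_le) (use nonneg rho_pos in auto)
    also have "(\<Sum>m\<le>N. R $ m * rho ^ m) \<le> \<theta>"
      unfolding \<theta>_def by (rule partial_sum_le_fps_at_rho) (use R nonneg in auto)
    finally have "?P \<le> fps_at_rho H + \<theta> * ?P"
      using P by (simp add: mult_right_mono)
    then have "?P \<le> \<Gamma>" using R1 by (simp add: \<Gamma>_def \<theta>_def field_simps)
    moreover have "(\<Sum>m\<in>I. G $ m * rho ^ m) \<le> ?P"
      by (rule sum_mono2) (use N nonneg rho_pos in auto)
    ultimately show ?thesis by linarith
  qed
  obtain C where C: "C > 0" "\<And>m. R $ m \<le> C * wt m" "\<And>m. H $ m \<le> C * wt m"
  proof -
    obtain C1 where C1: "C1 > 0" "\<And>m. \<bar>R $ m\<bar> \<le> C1 * wt m" using wt_boundedE[OF R] by metis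
    obtain C2 where C2: "C2 > 0" "\<And>m. \<bar>H $ m\<bar> \<le> C2 * wt m" using wt_boundedE[OF H] by metis
    have "C1 * wt m \<le> max C1 C2 * wt m" "C2 * wt m \<le> max C1 C2 * wt m" for m
      by (intro mult_right_mono; simp)+
    then have "R $ m \<le> max C1 C2 * wt m" "H $ m \<le> max C1 C2 * wt m" for m
      using C1(2)[of m] C2(2)[of m] by (meson abs_ge_self order_trans)+
    then show ?thesis using that[of "max C1 C2"] C1(1) by auto
  qed
  have ratio_sum: "(\<lambda>m. \<Sum>j<J. a $ j * (wt (m - j) / wt m)) \<longlonglongrightarrow> (\<Sum>j<J. a $ j * rho ^ j)"
    for a :: "real fps" and J
    by (intro tendsto_intros wt_ratio)
  have "\<delta> / C > 0" using \<delta> C by simp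
  then obtain J where mid:
    "\<forall>\<^sub>F m in sequentially. (\<Sum>j\<in>{J..m-J}. wt j * wt (m - j)) \<le> \<delta> / C * wt m"
    using wt_middle_small by blast
  have "(\<Sum>j<J. R $ j * rho ^ j) \<le> \<theta>"
    unfolding \<theta>_def by (rule partial_sum_le_fps_at_rho) (use R nonneg in auto)
  then have "(\<Sum>j<J. R $ j * rho ^ j) < \<theta> + \<delta>" using \<delta> by simp
  then have first: "\<forall>\<^sub>F m in sequentially. (\<Sum>j<J. R $ j * (wt (m - j) / wt m)) < \<theta> + \<delta>"
    by (rule order_tendstoD(2)[OF ratio_sum])
  have "(\<Sum>j<J. G $ j * rho ^ j) < \<Gamma> + 1" using partial[of "{..<J}"] by simp
  then have last: "\<forall>\<^sub>F m in sequentially. (\<Sum>j<J. G $ j * (wt (m - j) / wt m)) < \<Gamma> + 1"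
    by (rule order_tendstoD(2)[OF ratio_sum])
  have "\<forall>\<^sub>F m in sequentially. m \<ge> 1 \<and> m \<ge> 2 * J
      \<and> (\<Sum>j\<in>{J..m-J}. wt j * wt (m - j)) \<le> \<delta> / C * wt m
      \<and> (\<Sum>j<J. R $ j * (wt (m - j) / wt m)) < \<theta> + \<delta>
      \<and> (\<Sum>j<J. G $ j * (wt (m - j) / wt m)) < \<Gamma> + 1"
    by (intro eventually_conj eventually_ge_at_top mid first last)
  then obtain M where M: "\<forall>m\<ge>M. m \<ge> 1 \<and> m \<ge> 2 * J
      \<and> (\<Sum>j\<in>{J..m-J}. wt j * wt (m - j)) \<le> \<delta> / C * wt m
      \<and> (\<Sum>j<J. R $ j * (wt (m - j) / wt m)) < \<theta> + \<delta>
      \<and> (\<Sum>j<J. G $ j * (wt (m - j) / wt m)) < \<Gamma> + 1"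
    unfolding eventually_sequentially ..
  \<comment> \<open>The sum covers the indices below \<open>M\<close>; the second term makes
    \<open>2 * \<delta> * K\<close> exceed the contributions that do not come from the induction
    hypothesis.\<close>
  define K where "K = (\<Sum>m<M. G $ m / wt m) + (C + C * (\<Gamma> + 1)) / (2 * \<delta>)"
  have \<Gamma>: "\<Gamma> \<ge> 0" using partial[of "{}"] by simp
  have K0: "K \<ge> 0" unfolding K_def using \<Gamma> C \<delta> nonneg by (intro add_nonneg_nonneg sum_nonneg) auto
  have KC: "C + C * (\<Gamma> + 1) \<le> 2 * \<delta> * K"
  proof -
    have "(\<Sum>m<M. G $ m / wt m) \<ge> 0" using nonneg by (intro sum_nonneg) auto
    then have "(C + C * (\<Gamma> + 1)) / (2 * \<delta>) \<le> K" by (simp add: K_def)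
    then show ?thesis using \<delta> by (simp add: field_simps)
  qed
  have "G $ m \<le> K * wt m" for m
  proof (induction m rule: less_induct)
    case (less m)
    show ?case
    proof (cases "m < M")
      case True
      then have "G $ m / wt m \<le> (\<Sum>m<M. G $ m / wt m)"
        by (intro member_le_sum) (use nonneg in auto)
      also have "\<dots> \<le> K" using C \<Gamma> \<delta> by (simp add: K_def)
      finally show ?thesis by (simp add: divide_le_eq)
    next
      case False
      then have m: "m \<ge> 1" "m \<ge> 2 * J"
        "(\<Sum>j\<in>{J..m-J}. wt j * wt (m - j)) \<le> \<delta> / C * wt m"
        "(\<Sum>j<J. R $ j * (wt (m - j) / wt m)) < \<theta> + \<delta>"
        "(\<Sum>j<J. G $ j * (wt (m - j) / wt m)) < \<Gamma> + 1"
        using M by (auto simp only: not_less)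
      \<comment> \<open>The term \<open>j = 0\<close>, which would refer to \<open>G $ m\<close>
        itself, disappears because of \<open>R0\<close>.\<close>
      have IH: "R $ j * G $ (m - j) \<le> R $ j * (K * wt (m - j))" for j
      proof (cases "j = 0")
        case False
        then show ?thesis using less[of "m - j"] m(1) nonneg by (intro mult_left_mono) auto
      qed (simp add: R0)
      have "(\<Sum>j<J. R $ j * G $ (m - j)) \<le> (\<Sum>j<J. R $ j * (K * wt (m - j)))"
        by (intro sum_mono IH)
      also have "\<dots> = K * wt m * (\<Sum>j<J. R $ j * (wt (m - j) / wt m))"
        by (simp add: sum_distrib_left field_simps)
      also have "\<dots> \<le> K * wt m * (\<theta> + \<delta>)"
        using m(4) K0 by (intro mult_left_mono) auto
      finally have s1: "(\<Sum>j<J. R $ j * G $ (m - j)) \<le> K * wt m * (\<theta> + \<delta>)" .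
      have "(\<Sum>j\<in>{J..m-J}. R $ j * G $ (m - j)) \<le> (\<Sum>j\<in>{J..m-J}. C * wt j * (K * wt (m - j)))"
        using K0 by (intro sum_mono order_trans[OF IH] mult_right_mono C) auto
      also have "\<dots> = C * K * (\<Sum>j\<in>{J..m-J}. wt j * wt (m - j))"
        by (simp add: sum_distrib_left mult_ac)
      also have "\<dots> \<le> C * K * (\<delta> / C * wt m)"
        using m(3) K0 C by (intro mult_left_mono) auto
      finally have s2: "(\<Sum>j\<in>{J..m-J}. R $ j * G $ (m - j)) \<le> K * wt m * \<delta>"
        using C(1) by (simp add: mult_ac)
      have "(\<Sum>j<J. G $ j * R $ (m - j)) \<le> (\<Sum>j<J. G $ j * (C * wt (m - j)))"
        using nonneg by (intro sum_mono mult_left_mono C) auto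
      also have "\<dots> = C * wt m * (\<Sum>j<J. G $ j * (wt (m - j) / wt m))"
        by (simp add: sum_distrib_left field_simps)
      also have "\<dots> \<le> C * wt m * (\<Gamma> + 1)"
        using m(5) C by (intro mult_left_mono) auto
      finally have s3: "(\<Sum>j<J. G $ j * R $ (m - j)) \<le> C * wt m * (\<Gamma> + 1)" .
      have "G $ m = H $ m + (R * G) $ m" by (rule G_nth)
      also have "\<dots> \<le> C * wt m + (K * wt m * (\<theta> + \<delta>) + K * wt m * \<delta> + C * wt m * (\<Gamma> + 1))"
        unfolding fps_mult_nth_split[OF m(2)] using s1 s2 s3 C(3)[of m] by linarith
      also have "\<dots> = ((C + C * (\<Gamma> + 1)) + K * (\<theta> + 2 * \<delta>)) * wt m"
        by (simp add: algebra_simps)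
      also have "\<dots> \<le> (2 * \<delta> * K + K * (\<theta> + 2 * \<delta>)) * wt m"
        using KC by (intro mult_right_mono add_right_mono) auto
      also have "2 * \<delta> * K + K * (\<theta> + 2 * \<delta>) = K"
        by (simp add: \<delta>_def field_simps)
      finally show ?thesis .
    qed
  qed
  then have "\<bar>G $ m\<bar> \<le> K * wt m" for m using nonneg by simp
  then show ?thesis unfolding wt_bounded_def by blast
qed

section \<open>Oscillation relative to the tree counts\<close>

definition osc_le :: "real fps \<Rightarrow> real \<Rightarrow> bool" where
  "osc_le a d \<longleftrightarrow> (\<forall>\<epsilon>>0. \<exists>M. \<forall>m\<ge>M. \<forall>m'\<ge>M. \<bar>a $ m / wt m - a $ m' / wt m'\<bar> \<le> d + \<epsilon>)"

text \<open>Encoded through differences on tails, with a slack in \<open>osc_le\<close>: sums then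
  need only the triangle inequality, and oscillation zero is the Cauchy property. Requiring
  \<open>d \<ge> 0\<close> bounds the set below.\<close>

definition osc :: "real fps \<Rightarrow> real" where
  "osc a = Inf {d. d \<ge> 0 \<and> osc_le a d}"

lemma osc_leI: "d \<ge> 0 \<Longrightarrow> osc_le a d \<Longrightarrow> osc a \<le> d"
  unfolding osc_def by (rule cInf_lower) (auto intro: bdd_belowI[of _ 0])

lemma osc_nonempty:
  assumes "wt_bounded a"
  shows "{d. d \<ge> 0 \<and> osc_le a d} \<noteq> {}"
proof -
  obtain C where C: "C > 0" "\<And>m. \<bar>a $ m\<bar> \<le> C * wt m" using assms wt_boundedE by metis
  have "\<bar>a $ m / wt m\<bar> \<le> C" for m using C(2)[of m] by (simp add: abs_divide divide_le_eq)
  then have "\<bar>a $ m / wt m - a $ m' / wt m'\<bar> \<le> 2 * C" for m m'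
    using abs_triangle_ineq4[of "a $ m / wt m" "a $ m' / wt m'"] add_mono[of _ C _ C]
    by (metis mult_2 order_trans)
  then have "osc_le a (2 * C)" unfolding osc_le_def
    by (intro allI impI exI[of _ 0]) (simp add: add_increasing2)
  then show ?thesis using C(1) by force
qed

lemma osc_nonneg: "wt_bounded a \<Longrightarrow> osc a \<ge> 0"
  unfolding osc_def using osc_nonempty by (intro cInf_greatest) auto

lemma osc_le_osc:
  assumes "wt_bounded a"
  shows "osc_le a (osc a)"
  unfolding osc_le_def
proof (intro allI impI)
  fix \<epsilon> :: real assume \<epsilon>: "\<epsilon> > 0"
  then have "Inf {d. d \<ge> 0 \<and> osc_le a d} < osc a + \<epsilon> / 2" by (simp add: osc_def)
  then obtain d where d: "osc_le a d" "d < osc a + \<epsilon> / 2"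
    using cInf_lessD[OF osc_nonempty[OF assms]] by auto
  then obtain M where "\<forall>m\<ge>M. \<forall>m'\<ge>M. \<bar>a $ m / wt m - a $ m' / wt m'\<bar> \<le> d + \<epsilon> / 2"
    using \<epsilon> by (meson half_gt_zero osc_le_def)
  then have "\<forall>m\<ge>M. \<forall>m'\<ge>M. \<bar>a $ m / wt m - a $ m' / wt m'\<bar> \<le> osc a + \<epsilon>"
    using d(2) by fastforce
  then show "\<exists>M. \<forall>m\<ge>M. \<forall>m'\<ge>M. \<bar>a $ m / wt m - a $ m' / wt m'\<bar> \<le> osc a + \<epsilon>" ..
qed

lemma osc_zero_convergent:
  assumes "wt_bounded a" and "osc a = 0"
  shows "convergent (\<lambda>m. a $ m / wt m)"
proof (rule Cauchy_convergent, rule CauchyI)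
  fix e :: real assume "e > 0"
  then obtain M where "\<forall>m\<ge>M. \<forall>m'\<ge>M. \<bar>a $ m / wt m - a $ m' / wt m'\<bar> \<le> 0 + e / 2"
    using osc_le_osc[OF assms(1)] unfolding assms(2) osc_le_def by (meson half_gt_zero)
  then show "\<exists>M. \<forall>m\<ge>M. \<forall>n\<ge>M. norm (a $ m / wt m - a $ n / wt n) < e"
    using \<open>e > 0\<close> by (intro exI[of _ M]) (fastforce simp: real_norm_def)
qed

lemma osc_eventually_proportional:
  assumes "wt_bounded a" and "\<forall>\<^sub>F m in sequentially. a $ m = c * wt m"
  shows "osc a = 0"
proof (rule antisym)
  obtain M where "\<forall>m\<ge>M. a $ m = c * wt m" using assms(2) by (auto simp: eventually_at_top_linorder)
  then have "osc_le a 0" unfolding osc_le_def by (intro allI impI exI[of _ M]) auto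
  then show "osc a \<le> 0" by (intro osc_leI) auto
qed (use osc_nonneg assms in auto)

lemma osc_schroeder: "osc schroeder = 0"
proof (rule osc_eventually_proportional[where c = 1])
  show "\<forall>\<^sub>F m in sequentially. schroeder $ m = 1 * wt m"
    using eventually_ge_at_top[of 1] by eventually_elim (simp add: wt_eq)
qed simp

lemma osc_add:
  assumes "wt_bounded a" and "wt_bounded b"
  shows "osc (a + b) \<le> osc a + osc b"
proof (rule osc_leI)
  show "osc_le (a + b) (osc a + osc b)"
    unfolding osc_le_def
  proof (intro allI impI)
    fix \<epsilon> :: real assume "\<epsilon> > 0"
    then have e: "\<epsilon> / 2 > 0" by simp
    obtain M where M: "\<forall>m\<ge>M. \<forall>m'\<ge>M. \<bar>a $ m / wt m - a $ m' / wt m'\<bar> \<le> osc a + \<epsilon> / 2"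
      using osc_le_osc[OF assms(1)] e unfolding osc_le_def by meson
    obtain N where N: "\<forall>m\<ge>N. \<forall>m'\<ge>N. \<bar>b $ m / wt m - b $ m' / wt m'\<bar> \<le> osc b + \<epsilon> / 2"
      using osc_le_osc[OF assms(2)] e unfolding osc_le_def by meson
    have "\<bar>(a + b) $ m / wt m - (a + b) $ m' / wt m'\<bar> \<le> osc a + osc b + \<epsilon>"
      if "m \<ge> max M N" "m' \<ge> max M N" for m m'
    proof -
      have "\<bar>a $ m / wt m - a $ m' / wt m'\<bar> \<le> osc a + \<epsilon> / 2"
        "\<bar>b $ m / wt m - b $ m' / wt m'\<bar> \<le> osc b + \<epsilon> / 2"
        using M N that by auto
      then show ?thesis by (simp add: add_divide_distrib)
    qed
    then show "\<exists>M. \<forall>m\<ge>M. \<forall>m'\<ge>M.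
        \<bar>(a + b) $ m / wt m - (a + b) $ m' / wt m'\<bar> \<le> osc a + osc b + \<epsilon>" by blast
  qed
qed (use osc_nonneg assms in auto)

lemma osc_0 [simp]: "osc 0 = 0"
  by (rule osc_eventually_proportional[where c = 0]) auto

lemma osc_sum:
  assumes "\<And>i. i \<in> I \<Longrightarrow> wt_bounded (f i)"
  shows "osc (\<Sum>i\<in>I. f i) \<le> (\<Sum>i\<in>I. osc (f i))"
  using assms
proof (induction I rule: infinite_finite_induct)
  case (insert x F)
  then have "osc (f x + (\<Sum>i\<in>F. f i)) \<le> osc (f x) + osc (\<Sum>i\<in>F. f i)"
    by (intro osc_add) auto
  with insert show ?case by force
qed auto

text \<open>For bounded \<open>j\<close> the factor \<open>wt (m - j) / wt m\<close> tends to
  \<open>rho ^ j\<close>. So the head is, up to a vanishing error, a combination of the quotients of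
  \<open>b\<close> with nonnegative weights of total at most \<open>fps_at_rho a\<close>.\<close>

lemma osc_head:
  assumes a: "wt_bounded a" "\<And>m. a $ m \<ge> 0" and b: "wt_bounded b" and "\<epsilon> > 0"
  obtains M where "\<And>m m'. m \<ge> M \<Longrightarrow> m' \<ge> M \<Longrightarrow>
    \<bar>(\<Sum>j<J. a $ j * b $ (m - j)) / wt m - (\<Sum>j<J. a $ j * b $ (m' - j)) / wt m'\<bar>
      \<le> fps_at_rho a * osc b + \<epsilon>"
proof -
  define r where "r m = b $ m / wt m" for m
  obtain D where D: "D > 0" "\<And>m. \<bar>b $ m\<bar> \<le> D * wt m" using b wt_boundedE by metis
  have rD: "\<bar>r m\<bar> \<le> D" for m using D(2)[of m] by (simp add: r_def abs_divide divide_le_eq)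
  define e where "e m = (\<Sum>j<J. a $ j * r (m - j) * (wt (m - j) / wt m - rho ^ j))" for m
  have split: "(\<Sum>j<J. a $ j * b $ (m - j)) / wt m = (\<Sum>j<J. a $ j * rho ^ j * r (m - j)) + e m" for m
  proof -
    have "a $ j * b $ (m - j) / wt m
        = a $ j * rho ^ j * r (m - j) + a $ j * r (m - j) * (wt (m - j) / wt m - rho ^ j)" for j
    proof -
      have "b $ (m - j) = r (m - j) * wt (m - j)" by (simp add: r_def)
      then show ?thesis by (simp add: algebra_simps)
    qed
    then show ?thesis by (simp add: e_def sum_divide_distrib sum.distrib)
  qed
  have "e \<longlonglongrightarrow> 0"
  proof -
    have "(\<lambda>m. a $ j * r (m - j) * (wt (m - j) / wt m - rho ^ j)) \<longlonglongrightarrow> 0" for j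
    proof (rule Lim_null_comparison)
      have "(\<lambda>m. a $ j * D * \<bar>wt (m - j) / wt m - rho ^ j\<bar>) \<longlonglongrightarrow> a $ j * D * \<bar>rho ^ j - rho ^ j\<bar>"
        by (intro tendsto_intros wt_ratio)
      then show "(\<lambda>m. a $ j * D * \<bar>wt (m - j) / wt m - rho ^ j\<bar>) \<longlonglongrightarrow> 0" by simp
      show "\<forall>\<^sub>F m in sequentially. norm (a $ j * r (m - j) * (wt (m - j) / wt m - rho ^ j))
          \<le> a $ j * D * \<bar>wt (m - j) / wt m - rho ^ j\<bar>"
        using a(2)[of j] rD by (intro always_eventually allI)
          (simp add: abs_mult mult_left_mono mult_right_mono)
    qed
    then have "(\<lambda>m. \<Sum>j<J. a $ j * r (m - j) * (wt (m - j) / wt m - rho ^ j)) \<longlonglongrightarrow> (\<Sum>j<J. 0)"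
      by (intro tendsto_sum)
    then show ?thesis by (simp add: e_def[abs_def])
  qed
  then have "\<forall>\<^sub>F m in sequentially. \<bar>e m\<bar> < \<epsilon> / 4"
    using tendstoD[of e 0 sequentially "\<epsilon> / 4"] \<open>\<epsilon> > 0\<close> by (simp add: dist_real_def)
  then obtain M where M: "\<And>m. m \<ge> M \<Longrightarrow> \<bar>e m\<bar> < \<epsilon> / 4" by (auto simp: eventually_at_top_linorder)
  define \<eta> where "\<eta> = \<epsilon> / (2 * (fps_at_rho a + 1))"
  have a0: "fps_at_rho a \<ge> 0" using a by (rule fps_at_rho_nonneg)
  have \<eta>: "\<eta> > 0" using \<open>\<epsilon> > 0\<close> a0 by (simp add: \<eta>_def)
  then obtain N where N: "\<And>m m'. m \<ge> N \<Longrightarrow> m' \<ge> N \<Longrightarrow> \<bar>r m - r m'\<bar> \<le> osc b + \<eta>"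
    using osc_le_osc[OF b] unfolding osc_le_def r_def by meson
  show ?thesis
  proof (rule that[of "max M (N + J)"])
    fix m m' assume m: "m \<ge> max M (N + J)" "m' \<ge> max M (N + J)"
    have "\<bar>(\<Sum>j<J. a $ j * rho ^ j * r (m - j)) - (\<Sum>j<J. a $ j * rho ^ j * r (m' - j))\<bar>
        \<le> (\<Sum>j<J. \<bar>a $ j * rho ^ j * (r (m - j) - r (m' - j))\<bar>)"
      unfolding sum_subtractf[symmetric] right_diff_distrib[symmetric] by (rule sum_abs)
    also have "\<dots> \<le> (\<Sum>j<J. a $ j * rho ^ j * (osc b + \<eta>))"
      using a(2) rho_pos m by (intro sum_mono) (auto simp: abs_mult intro!: mult_left_mono N)
    also have "\<dots> = (\<Sum>j<J. a $ j * rho ^ j) * (osc b + \<eta>)" by (simp add: sum_distrib_right)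
    also have "\<dots> \<le> fps_at_rho a * (osc b + \<eta>)"
      using osc_nonneg[OF b] \<eta> by (intro mult_right_mono partial_sum_le_fps_at_rho a) auto
    also have "fps_at_rho a * \<eta> \<le> \<epsilon> / 2"
      using a0 \<open>\<epsilon> > 0\<close> by (simp add: \<eta>_def field_simps)
    then have "fps_at_rho a * (osc b + \<eta>) \<le> fps_at_rho a * osc b + \<epsilon> / 2"
      by (simp add: distrib_left)
    finally show "\<bar>(\<Sum>j<J. a $ j * b $ (m - j)) / wt m - (\<Sum>j<J. a $ j * b $ (m' - j)) / wt m'\<bar>
        \<le> fps_at_rho a * osc b + \<epsilon>"
      unfolding split using M[of m] M[of m'] m by auto
  qed
qed

text \<open>A product rule: the middle of the convolution is negligible, and at each end one factor
  is summed up at \<open>rho\<close> while the other one carries the large index and its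
  oscillation.\<close>

lemma osc_mult:
  assumes a: "wt_bounded a" "\<And>m. a $ m \<ge> 0" and b: "wt_bounded b" "\<And>m. b $ m \<ge> 0"
  shows "osc (a * b) \<le> fps_at_rho a * osc b + fps_at_rho b * osc a"
proof (rule osc_leI)
  show "0 \<le> fps_at_rho a * osc b + fps_at_rho b * osc a"
    using a b by (intro add_nonneg_nonneg mult_nonneg_nonneg osc_nonneg fps_at_rho_nonneg)
  show "osc_le (a * b) (fps_at_rho a * osc b + fps_at_rho b * osc a)"
    unfolding osc_le_def
  proof (intro allI impI)
    fix \<epsilon> :: real assume "\<epsilon> > 0"
    obtain C where C: "C > 0" "\<And>m. \<bar>a $ m\<bar> \<le> C * wt m" using a(1) wt_boundedE by metis
    obtain D where D: "D > 0" "\<And>m. \<bar>b $ m\<bar> \<le> D * wt m" using b(1) wt_boundedE by metis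
    have "\<epsilon> / (4 * C * D) > 0" using C D \<open>\<epsilon> > 0\<close> by simp
    then obtain J where "\<forall>\<^sub>F m in sequentially.
        (\<Sum>j\<in>{J..m-J}. wt j * wt (m - j)) \<le> \<epsilon> / (4 * C * D) * wt m"
      using wt_middle_small by blast
    then obtain L where L: "\<And>m. m \<ge> L \<Longrightarrow>
        (\<Sum>j\<in>{J..m-J}. wt j * wt (m - j)) \<le> \<epsilon> / (4 * C * D) * wt m"
      by (auto simp: eventually_at_top_linorder)
    have e: "\<epsilon> / 4 > 0" using \<open>\<epsilon> > 0\<close> by simp
    obtain M where M: "\<And>m m'. m \<ge> M \<Longrightarrow> m' \<ge> M \<Longrightarrow>
        \<bar>(\<Sum>j<J. a $ j * b $ (m - j)) / wt m - (\<Sum>j<J. a $ j * b $ (m' - j)) / wt m'\<bar>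
          \<le> fps_at_rho a * osc b + \<epsilon> / 4"
      using osc_head[OF a b(1) e, of J] by blast
    obtain N where N: "\<And>m m'. m \<ge> N \<Longrightarrow> m' \<ge> N \<Longrightarrow>
        \<bar>(\<Sum>j<J. b $ j * a $ (m - j)) / wt m - (\<Sum>j<J. b $ j * a $ (m' - j)) / wt m'\<bar>
          \<le> fps_at_rho b * osc a + \<epsilon> / 4"
      using osc_head[OF b a(1) e, of J] by blast
    define mid where "mid m = (\<Sum>j\<in>{J..m-J}. a $ j * b $ (m - j)) / wt m" for m
    have mid: "mid m \<ge> 0 \<and> mid m \<le> \<epsilon> / 4" if "m \<ge> L" for m
    proof
      show "mid m \<ge> 0" unfolding mid_def using a b by (intro divide_nonneg_nonneg sum_nonneg) auto
      have "(\<Sum>j\<in>{J..m-J}. a $ j * b $ (m - j)) \<le> (\<Sum>j\<in>{J..m-J}. (C * wt j) * (D * wt (m - j)))"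
        using C D a(2) b(2) by (intro sum_mono mult_mono) (auto intro: order_trans[OF abs_ge_self])
      also have "\<dots> = C * D * (\<Sum>j\<in>{J..m-J}. wt j * wt (m - j))"
        by (simp add: sum_distrib_left mult_ac)
      also have "\<dots> \<le> C * D * (\<epsilon> / (4 * C * D) * wt m)"
        using C D L[OF that] by (intro mult_left_mono) auto
      also have "\<dots> = \<epsilon> / 4 * wt m" using C(1) D(1) by simp
      finally show "mid m \<le> \<epsilon> / 4" by (simp add: mid_def divide_le_eq)
    qed
    have "\<bar>(a * b) $ m / wt m - (a * b) $ m' / wt m'\<bar>
        \<le> fps_at_rho a * osc b + fps_at_rho b * osc a + \<epsilon>"
      if m: "m \<ge> max (max L (2 * J)) (max M N)" "m' \<ge> max (max L (2 * J)) (max M N)" for m m'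
    proof -
      have split: "(a * b) $ k / wt k = (\<Sum>j<J. a $ j * b $ (k - j)) / wt k + mid k
          + (\<Sum>j<J. b $ j * a $ (k - j)) / wt k" if "k \<ge> 2 * J" for k
        unfolding fps_mult_nth_split[OF that] mid_def by (simp add: add_divide_distrib)
      have "m \<ge> 2 * J" "m' \<ge> 2 * J" "m \<ge> L" "m' \<ge> L" "m \<ge> M" "m' \<ge> M" "m \<ge> N" "m' \<ge> N"
        using m by auto
      then show ?thesis
        unfolding split[OF \<open>m \<ge> 2 * J\<close>] split[OF \<open>m' \<ge> 2 * J\<close>]
        using M[of m m'] N[of m m'] mid[of m] mid[of m'] \<open>\<epsilon> > 0\<close> by linarith
    qed
    then show "\<exists>M. \<forall>m\<ge>M. \<forall>m'\<ge>M. \<bar>(a * b) $ m / wt m - (a * b) $ m' / wt m'\<bar>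
        \<le> fps_at_rho a * osc b + fps_at_rho b * osc a + \<epsilon>" by blast
  qed
qed

section \<open>Random words of literals\<close>

primrec neg_lit :: "literal \<Rightarrow> literal" where
  "neg_lit (Pos i) = Neg i"
| "neg_lit (Neg i) = Pos i"

lemma neg_lit_neg_lit [simp]: "neg_lit (neg_lit l) = l"
  by (cases l) auto

lemma neg_lit_neq [simp]: "neg_lit l \<noteq> l" "l \<noteq> neg_lit l"
  by (cases l; simp)+

lemma lit_var_neg_lit [simp]: "lit_var (neg_lit l) = lit_var l"
  by (cases l) auto

lemma lit_eval_neg_lit [simp]: "lit_eval a (neg_lit l) \<longleftrightarrow> \<not> lit_eval a l"
  by (cases l) auto

definition lits :: "nat \<Rightarrow> literal set" where
  "lits n = {l. lit_var l \<in> {1..n}}"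

lemma lits_with_var: "{l. lit_var l \<in> V} = Pos ` V \<union> Neg ` V"
proof (intro set_eqI iffI)
  fix l assume "l \<in> {l. lit_var l \<in> V}"
  then show "l \<in> Pos ` V \<union> Neg ` V" by (cases l) auto
qed auto

lemma finite_lits [simp]: "finite (lits n)"
  unfolding lits_def lits_with_var by simp

lemma card_lits_with_var: "finite V \<Longrightarrow> card {l. lit_var l \<in> V} = 2 * card V"
  unfolding lits_with_var by (subst card_Un_disjoint) (auto simp: card_image inj_on_def)

lemma card_lits: "card (lits n) = 2 * n"
  unfolding lits_def by (subst card_lits_with_var) auto

lemma neg_lit_in_lits [simp]: "neg_lit l \<in> lits n \<longleftrightarrow> l \<in> lits n"
  by (simp add: lits_def)

text \<open>Repetitions of variables, regardless of sign. A variable occurring \<open>k\<close>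
  times counts \<open>k - 1\<close> times, so each unit costs a factor of order \<open>1 / n\<close>
  in probability.\<close>

definition excess :: "literal list \<Rightarrow> nat" where
  "excess w = length w - card (lit_var ` set w)"

definition complementary :: "literal list \<Rightarrow> bool" where
  "complementary w \<longleftrightarrow> (\<exists>l\<in>set w. neg_lit l \<in> set w)"

lemma card_vars_le: "card (lit_var ` set w) \<le> length w"
  by (rule order_trans[OF card_image_le card_length]) simp

lemma excess_Nil [simp]: "excess [] = 0"
  by (simp add: excess_def)

lemma complementary_Nil [simp]: "\<not> complementary []"
  by (simp add: complementary_def)

lemma excess_Cons: "excess (l # w) = excess w + of_bool (lit_var l \<in> lit_var ` set w)"
  using card_vars_le[of w] by (auto simp: excess_def card_insert_if)

lemma complementary_Cons: "complementary (l # w) \<longleftrightarrow> complementary w \<or> neg_lit l \<in> set w"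
  by (auto simp: complementary_def)

lemma excess_append:
  "excess (v @ w) = excess v + excess w + card (lit_var ` set v \<inter> lit_var ` set w)"
proof -
  have "card (lit_var ` set v) + card (lit_var ` set w)
      = card (lit_var ` set v \<union> lit_var ` set w) + card (lit_var ` set v \<inter> lit_var ` set w)"
    by (rule card_Un_Int) auto
  moreover have "card (lit_var ` set v \<union> lit_var ` set w) \<le> length v + length w"
    using card_vars_le[of "v @ w"] by (simp add: image_Un)
  ultimately show ?thesis
    using card_vars_le[of v] card_vars_le[of w] by (simp add: excess_def image_Un)
qed

lemma excess_append_shared:
  assumes "lit_var ` set v \<inter> lit_var ` set w \<noteq> {}"
  shows "excess (v @ w) \<ge> excess v + excess w + 1"
proof -
  have "card (lit_var ` set v \<inter> lit_var ` set w) > 0" using assms by (simp add: card_gt_0_iff)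
  then show ?thesis by (simp add: excess_append)
qed

lemma excess_cong: "length v = length w \<Longrightarrow> set v = set w \<Longrightarrow> excess v = excess w"
  by (simp add: excess_def)

lemma complementary_excess: "complementary w \<Longrightarrow> excess w \<ge> 1"
proof (induction w)
  case (Cons l w)
  show ?case
  proof (cases "complementary w")
    case False
    then have "neg_lit l \<in> set w" using Cons.prems by (simp add: complementary_Cons)
    then have "lit_var l \<in> lit_var ` set w" by (metis image_eqI lit_var_neg_lit)
    then show ?thesis by (simp add: excess_Cons)
  qed (use Cons in \<open>simp add: excess_Cons\<close>)
qed simp

section \<open>Expectations over uniformly random words\<close>

primrec word_mean :: "nat \<Rightarrow> nat \<Rightarrow> (literal list \<Rightarrow> real) \<Rightarrow> real" where
  "word_mean n 0 \<Phi> = \<Phi> []"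
| "word_mean n (Suc N) \<Phi> = (\<Sum>l\<in>lits n. word_mean n N (\<lambda>w. \<Phi> (l # w))) / (2 * real n)"

lemma word_mean_append:
  "word_mean n (N + M) \<Phi> = word_mean n N (\<lambda>v. word_mean n M (\<lambda>w. \<Phi> (v @ w)))"
  by (induction N arbitrary: \<Phi>) simp_all

lemma word_mean_mono:
  assumes "\<And>w. set w \<subseteq> lits n \<Longrightarrow> length w = N \<Longrightarrow> \<Phi> w \<le> \<Psi> w"
  shows "word_mean n N \<Phi> \<le> word_mean n N \<Psi>"
  using assms
proof (induction N arbitrary: \<Phi> \<Psi>)
  case (Suc N)
  then show ?case
    by (auto intro!: divide_right_mono sum_mono Suc.IH Suc.prems)
qed simp

lemma word_mean_add:
  "word_mean n N (\<lambda>w. \<Phi> w + \<Psi> w) = word_mean n N \<Phi> + word_mean n N \<Psi>"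
  by (induction N arbitrary: \<Phi> \<Psi>) (simp_all add: sum.distrib add_divide_distrib)

lemma word_mean_cmult: "word_mean n N (\<lambda>w. c * \<Phi> w) = c * word_mean n N \<Phi>"
  by (induction N arbitrary: \<Phi>) (simp_all add: sum_distrib_left[symmetric])

lemma word_mean_const: "n \<ge> 1 \<Longrightarrow> word_mean n N (\<lambda>w. c) = c"
  by (induction N) (simp_all add: card_lits)

lemma word_mean_0 [simp]: "word_mean n N (\<lambda>w. 0) = 0"
  by (induction N) simp_all

lemma word_mean_sum:
  "word_mean n N (\<lambda>w. \<Sum>x\<in>X. \<Phi> x w) = (\<Sum>x\<in>X. word_mean n N (\<Phi> x))"
  by (induction X rule: infinite_finite_induct) (simp_all add: word_mean_add)

lemma word_mean_Suc:
  "word_mean n (Suc N) \<Phi> = word_mean n N (\<lambda>w. (\<Sum>l\<in>lits n. \<Phi> (l # w)) / (2 * real n))"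
  using word_mean_cmult[of n N "1 / (2 * real n)" "\<lambda>w. \<Sum>l\<in>lits n. \<Phi> (l # w)"]
  by (simp add: word_mean_sum)

lemma sum_lits_repeated_var:
  "(\<Sum>l\<in>lits n. of_bool (lit_var l \<in> lit_var ` set w)) \<le> 2 * real (length w)"
proof -
  have "card (lits n \<inter> {l. lit_var l \<in> lit_var ` set w}) \<le> card {l. lit_var l \<in> lit_var ` set w}"
    by (rule card_mono) (simp_all add: lits_with_var)
  also have "\<dots> \<le> 2 * length w"
    using card_vars_le[of w] by (simp add: card_lits_with_var)
  finally have "card (lits n \<inter> {l. lit_var l \<in> lit_var ` set w}) \<le> 2 * length w" .
  then have "real (card (lits n \<inter> {l. lit_var l \<in> lit_var ` set w})) \<le> 2 * real (length w)"
    by linarith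
  then show ?thesis by (simp add: sum_of_bool_eq)
qed

lemma sum_lits_neg:
  assumes "set w \<subseteq> lits n"
  shows "(\<Sum>l\<in>lits n. of_bool (neg_lit l \<in> set w)) = real (card (set w))"
proof -
  have "lits n \<inter> {l. neg_lit l \<in> set w} = neg_lit ` set w"
    using assms by (force simp: image_iff intro: bexI[of _ "neg_lit _"])
  moreover have "inj_on neg_lit (set w)" by (metis inj_on_inverseI neg_lit_neg_lit)
  ultimately show ?thesis by (simp add: sum_of_bool_eq card_image)
qed

text \<open>A new letter repeats a variable only if it is one of at most \<open>2 * N\<close> among
  the \<open>2 * n\<close> literals; these probabilities are summed over the positions.\<close>

lemma mean_excess_ge_1:
  assumes "n \<ge> 1"
  shows "word_mean n N (\<lambda>w. of_bool (excess w \<ge> 1)) \<le> real N ^ 2 / real n"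
proof (induction N)
  case (Suc N)
  have "word_mean n (Suc N) (\<lambda>w. of_bool (excess w \<ge> 1))
      \<le> word_mean n N (\<lambda>w. of_bool (excess w \<ge> 1) + real N / real n)"
    unfolding word_mean_Suc
  proof (rule word_mean_mono)
    fix w :: "literal list" assume w: "length w = N"
    have "(\<Sum>l\<in>lits n. of_bool (excess (l # w) \<ge> 1))
        \<le> (\<Sum>l\<in>lits n. of_bool (excess w \<ge> 1) + of_bool (lit_var l \<in> lit_var ` set w) :: real)"
      by (intro sum_mono) (auto simp: excess_Cons)
    also have "\<dots> \<le> 2 * real n * of_bool (excess w \<ge> 1) + 2 * real N"
      using sum_lits_repeated_var[of w n] w by (simp add: sum.distrib card_lits)
    finally show "(\<Sum>l\<in>lits n. of_bool (excess (l # w) \<ge> 1)) / (2 * real n)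
        \<le> of_bool (excess w \<ge> 1) + real N / real n"
      using assms by (simp add: divide_le_eq algebra_simps)
  qed
  also have "\<dots> \<le> real N ^ 2 / real n + real N / real n"
    using Suc assms by (simp add: word_mean_add word_mean_const)
  also have "\<dots> \<le> real (Suc N) ^ 2 / real n"
    by (simp flip: add_divide_distrib) (intro divide_right_mono, auto simp: power2_eq_square algebra_simps)
  finally show ?case .
qed simp

text \<open>When the excess first reaches 2, the word read before already has a repetition and the
  new letter adds another. The two probabilities multiply.\<close>

lemma mean_excess_ge_2:
  assumes "n \<ge> 1"
  shows "word_mean n N (\<lambda>w. of_bool (excess w \<ge> 2)) \<le> real N ^ 4 / real n ^ 2"
proof (induction N)
  case (Suc N)
  have "word_mean n (Suc N) (\<lambda>w. of_bool (excess w \<ge> 2))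
      \<le> word_mean n N (\<lambda>w. of_bool (excess w \<ge> 2) + real N / real n * of_bool (excess w \<ge> 1))"
    unfolding word_mean_Suc
  proof (rule word_mean_mono)
    fix w :: "literal list" assume w: "length w = N"
    have "(\<Sum>l\<in>lits n. of_bool (excess (l # w) \<ge> 2))
        \<le> (\<Sum>l\<in>lits n. of_bool (excess w \<ge> 2)
            + of_bool (excess w \<ge> 1) * of_bool (lit_var l \<in> lit_var ` set w) :: real)"
      by (intro sum_mono) (auto simp: excess_Cons)
    also have "\<dots> \<le> 2 * real n * of_bool (excess w \<ge> 2) + 2 * real N * of_bool (excess w \<ge> 1)"
      using sum_lits_repeated_var[of w n] w
      by (simp add: sum.distrib card_lits sum_distrib_left[symmetric])
    finally show "(\<Sum>l\<in>lits n. of_bool (excess (l # w) \<ge> 2)) / (2 * real n)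
        \<le> of_bool (excess w \<ge> 2) + real N / real n * of_bool (excess w \<ge> 1)"
      using assms by (simp add: divide_le_eq algebra_simps)
  qed
  also have "\<dots> \<le> real N ^ 4 / real n ^ 2 + real N / real n * (real N ^ 2 / real n)"
    unfolding word_mean_add word_mean_cmult
    using Suc mean_excess_ge_1[OF assms, of N] by (intro add_mono mult_left_mono) auto
  also have "\<dots> = (real N ^ 4 + real N ^ 3) / real n ^ 2"
    by (simp add: add_divide_distrib power2_eq_square power3_eq_cube)
  also have "\<dots> \<le> real (Suc N) ^ 4 / real n ^ 2"
    by (intro divide_right_mono) (auto simp: power4_eq_xxxx power3_eq_cube algebra_simps)
  finally show ?case .
qed simp

lemma mean_complementary_le:
  assumes "n \<ge> 1"
  shows "word_mean n N (\<lambda>w. of_bool (complementary w)) \<le> real (N choose 2) / (2 * real n)"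
proof (induction N)
  case (Suc N)
  have "word_mean n (Suc N) (\<lambda>w. of_bool (complementary w))
      \<le> word_mean n N (\<lambda>w. of_bool (complementary w) + real N / (2 * real n))"
    unfolding word_mean_Suc
  proof (rule word_mean_mono)
    fix w assume w: "set w \<subseteq> lits n" "length w = N"
    have "(\<Sum>l\<in>lits n. of_bool (complementary (l # w)))
        \<le> (\<Sum>l\<in>lits n. of_bool (complementary w) + of_bool (neg_lit l \<in> set w) :: real)"
      by (intro sum_mono) (auto simp: complementary_Cons)
    also have "\<dots> \<le> 2 * real n * of_bool (complementary w) + real N"
      using card_length[of w] w unfolding sum.distrib sum_lits_neg[OF w(1)] by (simp add: card_lits)
    finally show "(\<Sum>l\<in>lits n. of_bool (complementary (l # w))) / (2 * real n)
        \<le> of_bool (complementary w) + real N / (2 * real n)"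
      using assms by (simp add: divide_le_eq algebra_simps)
  qed
  also have "\<dots> \<le> real (N choose 2) / (2 * real n) + real N / (2 * real n)"
    using Suc assms by (simp add: word_mean_add word_mean_const)
  also have "\<dots> = real (Suc N choose 2) / (2 * real n)"
    by (simp add: numeral_2_eq_2 add_divide_distrib)
  finally show ?case .
qed (simp add: numeral_2_eq_2)

text \<open>If the \<open>N\<close> variables are distinct, exactly \<open>N\<close> of the
  \<open>2 * n\<close> literals create a complementary pair. Otherwise only monotonicity is used;
  this has probability at most \<open>N ^ 2 / n\<close>, so a letter costs
  \<open>N ^ 3 / (2 * n ^ 2)\<close>, and these losses add up to at most
  \<open>N ^ 4 / n ^ 2\<close>.\<close>

lemma mean_complementary_ge:
  assumes "n \<ge> 1"
  shows "word_mean n N (\<lambda>w. of_bool (complementary w))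
    \<ge> real (N choose 2) / (2 * real n) - real N ^ 4 / real n ^ 2"
proof (induction N)
  case (Suc N)
  have "real (Suc N choose 2) / (2 * real n) - real (Suc N) ^ 4 / real n ^ 2
      \<le> (real (N choose 2) / (2 * real n) - real N ^ 4 / real n ^ 2)
        + real N / (2 * real n) * (1 - real N ^ 2 / real n)"
  proof -
    have "real N ^ 4 + real N ^ 3 / 2 \<le> real (Suc N) ^ 4"
      by (auto simp: power4_eq_xxxx power3_eq_cube algebra_simps)
    then have "(real N ^ 4 + real N ^ 3 / 2) / real n ^ 2 \<le> real (Suc N) ^ 4 / real n ^ 2"
      by (intro divide_right_mono) auto
    moreover have "real N / (2 * real n) * (1 - real N ^ 2 / real n)
        = real N / (2 * real n) - (real N ^ 3 / 2) / real n ^ 2"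
      by (simp add: right_diff_distrib power2_eq_square power3_eq_cube)
    moreover have "real (Suc N choose 2) / (2 * real n)
        = real (N choose 2) / (2 * real n) + real N / (2 * real n)"
      by (simp add: numeral_2_eq_2 add_divide_distrib)
    ultimately show ?thesis by (simp add: add_divide_distrib)
  qed
  also have "\<dots> \<le> word_mean n N (\<lambda>w. of_bool (complementary w))
      + real N / (2 * real n) * (1 - word_mean n N (\<lambda>w. of_bool (excess w \<ge> 1)))"
    using Suc mean_excess_ge_1[OF assms, of N] by (intro add_mono mult_left_mono) auto
  also have "\<dots> = word_mean n N (\<lambda>w. of_bool (complementary w)
      + (real N / (2 * real n) + (- (real N / (2 * real n))) * of_bool (excess w \<ge> 1)))"
    unfolding word_mean_add word_mean_cmult word_mean_const[OF assms]
    by (simp add: right_diff_distrib)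
  also have "\<dots> \<le> word_mean n (Suc N) (\<lambda>w. of_bool (complementary w))"
    unfolding word_mean_Suc
  proof (rule word_mean_mono)
    fix w assume w: "set w \<subseteq> lits n" "length w = N"
    show "of_bool (complementary w)
        + (real N / (2 * real n) + (- (real N / (2 * real n))) * of_bool (excess w \<ge> 1))
        \<le> (\<Sum>l\<in>lits n. of_bool (complementary (l # w))) / (2 * real n)"
    proof (cases "excess w \<ge> 1")
      case True
      have "(\<Sum>l\<in>lits n. of_bool (complementary w)) \<le> (\<Sum>l\<in>lits n. of_bool (complementary (l # w)) :: real)"
        by (intro sum_mono) (auto simp: complementary_Cons)
      then show ?thesis using True assms by (simp add: card_lits field_simps)
    next
      case False
      then have "\<not> complementary w" using complementary_excess by auto
      moreover have "card (set w) = N"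
      proof -
        have "card (lit_var ` set w) \<le> card (set w)" by (rule card_image_le) simp
        then show ?thesis using False w card_length[of w] by (simp add: excess_def)
      qed
      ultimately show ?thesis using False w sum_lits_neg[of w n] by (simp add: complementary_Cons)
    qed
  qed
  finally show ?case .
qed (simp add: numeral_2_eq_2)

lemma mean_complementary:
  assumes "n \<ge> 1"
  shows "\<bar>word_mean n N (\<lambda>w. of_bool (complementary w)) - real (N choose 2) / (2 * real n)\<bar>
    \<le> real N ^ 4 / real n ^ 2"
proof -
  have "real N ^ 4 / real n ^ 2 \<ge> 0" by simp
  then show ?thesis
    using mean_complementary_le[OF assms, of N] mean_complementary_ge[OF assms, of N] by linarith
qed

text \<open>Given its length, the word read off by \<open>p\<close> from a uniformly random element of \<open>X\<close> is uniformly
  random.\<close>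

definition uniform_word :: "nat \<Rightarrow> 'a set \<Rightarrow> ('a \<Rightarrow> literal list) \<Rightarrow> bool" where
  "uniform_word n X p \<longleftrightarrow>
     (\<forall>\<Phi>. (\<Sum>x\<in>X. \<Phi> (p x)) = (\<Sum>x\<in>X. word_mean n (length (p x)) \<Phi>))"

lemma uniform_wordD:
  "uniform_word n X p \<Longrightarrow> (\<Sum>x\<in>X. \<Phi> (p x)) = (\<Sum>x\<in>X. word_mean n (length (p x)) \<Phi>)"
  by (simp add: uniform_word_def)

lemma uniform_word_empty_words: "(\<And>x. x \<in> X \<Longrightarrow> p x = []) \<Longrightarrow> uniform_word n X p"
  by (simp add: uniform_word_def)

text \<open>The two words are independent given their lengths: \<open>q y\<close> is averaged first
  with \<open>x\<close> fixed, after which \<open>y\<close> enters only through the length of its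
  word.\<close>

lemma uniform_word_append:
  assumes "uniform_word n X p" and "uniform_word n Y q"
  shows "(\<Sum>x\<in>X. \<Sum>y\<in>Y. \<Phi> (p x @ q y))
    = (\<Sum>x\<in>X. \<Sum>y\<in>Y. word_mean n (length (p x @ q y)) \<Phi>)"
proof -
  have "(\<Sum>x\<in>X. \<Sum>y\<in>Y. \<Phi> (p x @ q y)) = (\<Sum>x\<in>X. \<Sum>y\<in>Y. word_mean n (length (q y)) (\<lambda>w. \<Phi> (p x @ w)))"
    using uniform_wordD[OF assms(2), of "\<lambda>w. \<Phi> (p _ @ w)"] by (simp only:)
  also have "\<dots> = (\<Sum>y\<in>Y. \<Sum>x\<in>X. word_mean n (length (q y)) (\<lambda>w. \<Phi> (p x @ w)))"
    by (rule sum.swap)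
  also have "\<dots> = (\<Sum>y\<in>Y. \<Sum>x\<in>X. word_mean n (length (p x)) (\<lambda>v. word_mean n (length (q y)) (\<lambda>w. \<Phi> (v @ w))))"
    using uniform_wordD[OF assms(1), of "\<lambda>v. word_mean n (length (q _)) (\<lambda>w. \<Phi> (v @ w))"]
    by (simp only:)
  also have "\<dots> = (\<Sum>x\<in>X. \<Sum>y\<in>Y. word_mean n (length (p x @ q y)) \<Phi>)"
    by (subst sum.swap) (simp add: word_mean_append)
  finally show ?thesis .
qed

lemma uniform_word_Un:
  assumes "uniform_word n X p" and "uniform_word n Y p" and "finite X" and "finite Y" and "X \<inter> Y = {}"
  shows "uniform_word n (X \<union> Y) p"
  using assms by (simp add: uniform_word_def sum.union_disjoint)

lemma uniform_word_single_leaf: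
  assumes "inj_on f (lits n)" and "\<And>l. l \<in> lits n \<Longrightarrow> p (f l) = [l]"
  shows "uniform_word n (f ` lits n) p"
proof (cases "n = 0")
  case True
  then show ?thesis by (simp add: uniform_word_def lits_def)
next
  case False
  then show ?thesis
    using assms by (simp add: uniform_word_def sum.reindex card_lits)
qed

section \<open>Generating functions of trees and forests\<close>

primrec dual_conn :: "connective \<Rightarrow> connective" where
  "dual_conn Conj = Disj"
| "dual_conn Disj = Conj"

lemma dual_conn_dual_conn [simp]: "dual_conn (dual_conn c) = c"
  by (cases c) auto

lemma neq_conn_iff: "d \<noteq> c \<longleftrightarrow> d = dual_conn c"
  by (cases c; cases d) auto

text \<open>\<open>kids n c m\<close>: the trees of size \<open>m\<close> that may hang below a node labelled \<open>c\<close>.\<close>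

definition kids :: "nat \<Rightarrow> connective \<Rightarrow> nat \<Rightarrow> assoc_tree set" where
  "kids n c m = {t \<in> assoc_trees m n. root_label t \<noteq> Some c}"

definition rooted :: "nat \<Rightarrow> connective \<Rightarrow> nat \<Rightarrow> assoc_tree set" where
  "rooted n c m = {t \<in> assoc_trees m n. root_label t = Some c}"

text \<open>Lists of length 1 are included although no node has a single child: they occur as tails
  when the first child is split off.\<close>

definition forests :: "nat \<Rightarrow> connective \<Rightarrow> nat \<Rightarrow> assoc_tree list set" where
  "forests n c m = {ts. ts \<noteq> [] \<and> (\<forall>t\<in>set ts. labelled_assoc n t \<and> root_label t \<noteq> Some c)
     \<and> sum_list (map leaves ts) = m}"

definition long_forests :: "nat \<Rightarrow> connective \<Rightarrow> nat \<Rightarrow> assoc_tree list set" where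
  "long_forests n c m = {ts \<in> forests n c m. length ts \<ge> 2}"

lemma rooted_eq: "rooted n c m = Node c ` long_forests n c m"
proof (intro set_eqI iffI)
  fix t assume t: "t \<in> rooted n c m"
  then obtain ts where "t = Node c ts" by (cases t) (auto simp: rooted_def)
  then show "t \<in> Node c ` long_forests n c m"
    using t by (auto simp: rooted_def assoc_trees_def long_forests_def forests_def)
qed (auto simp: rooted_def assoc_trees_def long_forests_def forests_def)

lemma forests_eq: "forests n c m = (\<lambda>t. [t]) ` kids n c m \<union> long_forests n c m"
proof (intro set_eqI iffI)
  fix ts assume ts: "ts \<in> forests n c m"
  show "ts \<in> (\<lambda>t. [t]) ` kids n c m \<union> long_forests n c m"
  proof (cases "length ts \<ge> 2")
    case False
    then obtain t where "ts = [t]" using ts by (cases ts rule: list.exhaust; cases "tl ts") (auto simp: forests_def)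
    then show ?thesis using ts by (auto simp: forests_def kids_def assoc_trees_def)
  qed (use ts in \<open>auto simp: long_forests_def\<close>)
qed (auto simp: forests_def long_forests_def kids_def assoc_trees_def)

lemma kids_eq:
  "kids n c m = (if m = 1 then Leaf ` lits n else {}) \<union> rooted n (dual_conn c) m"
proof (intro set_eqI iffI)
  fix t assume "t \<in> kids n c m"
  then show "t \<in> (if m = 1 then Leaf ` lits n else {}) \<union> rooted n (dual_conn c) m"
    by (cases t) (auto simp: kids_def rooted_def assoc_trees_def lits_def neq_conn_iff)
qed (cases c; auto simp: kids_def rooted_def assoc_trees_def lits_def split: if_splits)+

lemma finite_kids [simp]: "finite (kids n c m)"
  unfolding kids_def using finite_assoc_trees by simp

lemma finite_rooted [simp]: "finite (rooted n c m)"
  unfolding rooted_def using finite_assoc_trees by simp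

lemma finite_long_forests [simp]: "finite (long_forests n c m)"
  using finite_rooted[of n c m] unfolding rooted_eq
  by (rule finite_imageD) (auto simp: inj_on_def)

lemma finite_forests [simp]: "finite (forests n c m)"
  unfolding forests_eq by simp

lemma kids_leaves: "t \<in> kids n c m \<Longrightarrow> leaves t = m \<and> m \<ge> 1"
  using leaves_pos by (auto simp: kids_def assoc_trees_def)

lemma forests_size_pos: "ts \<in> forests n c m \<Longrightarrow> m \<ge> 1"
  using leaves_pos by (cases ts) (auto simp: forests_def Suc_le_eq)

lemma kids_0 [simp]: "kids n c 0 = {}"
  using kids_leaves by fastforce

lemma forests_0 [simp]: "forests n c 0 = {}"
  using forests_size_pos by fastforce

lemma long_forests_eq:
  "long_forests n c m = (\<lambda>(j, t, ts). t # ts) ` (SIGMA j:{0..m}. kids n c j \<times> forests n c (m - j))"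
proof (intro set_eqI iffI)
  fix us assume us: "us \<in> long_forests n c m"
  then obtain t ts where "us = t # ts" "ts \<noteq> []"
    by (cases us; cases "tl us") (auto simp: long_forests_def)
  then have "(leaves t, t, ts) \<in> (SIGMA j:{0..m}. kids n c j \<times> forests n c (m - j))"
    using us by (auto simp: long_forests_def forests_def kids_def assoc_trees_def)
  then show "us \<in> (\<lambda>(j, t, ts). t # ts) ` (SIGMA j:{0..m}. kids n c j \<times> forests n c (m - j))"
    using \<open>us = t # ts\<close> by force
next
  fix us assume "us \<in> (\<lambda>(j, t, ts). t # ts) ` (SIGMA j:{0..m}. kids n c j \<times> forests n c (m - j))"
  then obtain j t ts where "us = t # ts" "j \<le> m" "t \<in> kids n c j" "ts \<in> forests n c (m - j)"
    by auto
  then show "us \<in> long_forests n c m"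
    by (cases ts) (auto simp: long_forests_def forests_def kids_def assoc_trees_def)
qed

lemma sum_long_forests:
  "(\<Sum>ts\<in>long_forests n c m. \<psi> ts)
    = (\<Sum>j=0..m. \<Sum>t\<in>kids n c j. \<Sum>ts\<in>forests n c (m - j). \<psi> (t # ts))"
proof -
  let ?S = "SIGMA j:{0..m}. kids n c j \<times> forests n c (m - j)"
  have "inj_on (\<lambda>(j, t, ts). t # ts) ?S"
    by (auto simp: inj_on_def dest!: kids_leaves)
  then have "(\<Sum>ts\<in>long_forests n c m. \<psi> ts) = (\<Sum>(j, t, ts)\<in>?S. \<psi> (t # ts))"
    unfolding long_forests_eq by (subst sum.reindex) (auto intro!: sum.cong)
  also have "\<dots> = (\<Sum>j=0..m. \<Sum>(t, ts)\<in>kids n c j \<times> forests n c (m - j). \<psi> (t # ts))"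
    by (subst sum.Sigma) auto
  finally show ?thesis by (simp add: sum.cartesian_product)
qed

lemma sum_forests:
  "(\<Sum>ts\<in>forests n c m. \<psi> ts) = (\<Sum>t\<in>kids n c m. \<psi> [t]) + (\<Sum>ts\<in>long_forests n c m. \<psi> ts)"
proof -
  have "(\<Sum>ts\<in>forests n c m. \<psi> ts)
      = (\<Sum>ts\<in>(\<lambda>t. [t]) ` kids n c m. \<psi> ts) + (\<Sum>ts\<in>long_forests n c m. \<psi> ts)"
    unfolding forests_eq by (rule sum.union_disjoint) (auto simp: long_forests_def)
  then show ?thesis by (simp add: sum.reindex inj_on_def)
qed

lemma sum_rooted: "(\<Sum>t\<in>rooted n c m. \<phi> t) = (\<Sum>ts\<in>long_forests n c m. \<phi> (Node c ts))"
  unfolding rooted_eq by (simp add: sum.reindex inj_on_def)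

lemma sum_kids:
  "(\<Sum>t\<in>kids n c m. \<phi> t)
    = (if m = 1 then \<Sum>l\<in>lits n. \<phi> (Leaf l) else 0) + (\<Sum>t\<in>rooted n (dual_conn c) m. \<phi> t)"
proof -
  have "Leaf ` lits n \<inter> rooted n (dual_conn c) k = {}" for k by (auto simp: rooted_def)
  then show ?thesis
    unfolding kids_eq by (simp add: sum.union_disjoint sum.reindex inj_on_def)
qed

text \<open>Each leaf has weight \<open>1 / (2 * n)\<close>, so summing over its literals is
  averaging. A leaf then contributes \<open>fps_X\<close> for every \<open>n \<ge> 1\<close>, and
  total counts do not involve \<open>n\<close>.\<close>

definition gf :: "nat \<Rightarrow> (nat \<Rightarrow> 'a set) \<Rightarrow> ('a \<Rightarrow> real) \<Rightarrow> real fps" where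
  "gf n X \<phi> = Abs_fps (\<lambda>m. (\<Sum>x\<in>X m. \<phi> x) / (2 * real n) ^ m)"

lemma gf_nth: "gf n X \<phi> $ m = (\<Sum>x\<in>X m. \<phi> x) / (2 * real n) ^ m"
  by (simp add: gf_def)

lemma gf_cong: "(\<And>m x. x \<in> X m \<Longrightarrow> \<phi> x = \<psi> x) \<Longrightarrow> gf n X \<phi> = gf n X \<psi>"
  by (simp add: gf_def)

lemma gf_nonneg: "(\<And>x. \<phi> x \<ge> 0) \<Longrightarrow> gf n X \<phi> $ m \<ge> 0"
  by (simp add: gf_nth sum_nonneg)

lemma gf_abs_le: "(\<And>x. \<bar>\<phi> x\<bar> \<le> \<psi> x) \<Longrightarrow> \<bar>gf n X \<phi> $ m\<bar> \<le> gf n X \<psi> $ m"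
  unfolding gf_nth abs_divide
  by (auto intro!: divide_right_mono order_trans[OF sum_abs] sum_mono)

lemma gf_add: "gf n X (\<lambda>x. \<phi> x + \<psi> x) = gf n X \<phi> + gf n X \<psi>"
  by (rule fps_ext) (simp add: gf_nth sum.distrib add_divide_distrib)

lemma gf_cmult: "gf n X (\<lambda>x. d * \<phi> x) = fps_const d * gf n X \<phi>"
  by (rule fps_ext) (simp add: gf_nth sum_distrib_left)

lemma gf_0 [simp]: "gf n X (\<lambda>x. 0) = 0"
  by (rule fps_ext) (simp add: gf_nth)

lemma gf_sum: "gf n X (\<lambda>x. \<Sum>i\<in>I. \<phi> i x) = (\<Sum>i\<in>I. gf n X (\<phi> i))"
  by (induction I rule: infinite_finite_induct) (simp_all add: gf_add)

lemma gf_long_forests: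
  "gf n (long_forests n c) (\<lambda>ts. \<alpha> (hd ts) * \<beta> (tl ts)) = gf n (kids n c) \<alpha> * gf n (forests n c) \<beta>"
proof (rule fps_ext)
  fix m
  have "(2 * real n) ^ m = (2 * real n) ^ j * (2 * real n) ^ (m - j)" if "j \<in> {0..m}" for j
    using that by (metis atLeastAtMost_iff le_add_diff_inverse power_add)
  then show "gf n (long_forests n c) (\<lambda>ts. \<alpha> (hd ts) * \<beta> (tl ts)) $ m
      = (gf n (kids n c) \<alpha> * gf n (forests n c) \<beta>) $ m"
    unfolding fps_mult_nth gf_nth sum_long_forests sum_divide_distrib
    by (intro sum.cong) (simp_all add: sum_product sum_divide_distrib)
qed

lemma gf_forests:
  "gf n (forests n c) \<psi> = gf n (kids n c) (\<lambda>t. \<psi> [t]) + gf n (long_forests n c) \<psi>"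
  by (rule fps_ext) (simp add: gf_nth sum_forests add_divide_distrib)

lemma gf_rooted: "gf n (rooted n c) \<phi> = gf n (long_forests n c) (\<lambda>ts. \<phi> (Node c ts))"
  by (rule fps_ext) (simp add: gf_nth sum_rooted)

lemma gf_kids:
  "gf n (kids n c) \<phi>
    = fps_const ((\<Sum>l\<in>lits n. \<phi> (Leaf l)) / (2 * real n)) * fps_X + gf n (rooted n (dual_conn c)) \<phi>"
proof (rule fps_ext)
  fix m show "gf n (kids n c) \<phi> $ m = (fps_const ((\<Sum>l\<in>lits n. \<phi> (Leaf l)) / (2 * real n)) * fps_X
      + gf n (rooted n (dual_conn c)) \<phi>) $ m"
    by (cases "m = 1") (simp_all add: gf_nth sum_kids add_divide_distrib)
qed

lemma gf_kids_const_leaf: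
  assumes "n \<ge> 1" and "\<And>l. \<phi> (Leaf l) = 1"
  shows "gf n (kids n c) \<phi> = fps_X + gf n (rooted n (dual_conn c)) \<phi>"
  using assms by (simp add: gf_kids card_lits)

lemma gf_kids_0 [simp]: "gf n (kids n c) \<phi> $ 0 = 0"
  by (simp add: gf_nth)

lemma mult_one_minus_schroeder_cancel:
  fixes a b :: "real fps"
  assumes "(1 - schroeder) * a = b"
  shows "a = schroeder_inv * b"
  using arg_cong[OF assms, of "\<lambda>x. schroeder_inv * x"] schroeder_inv_mult
  by (metis mult.assoc mult.commute mult_1)

text \<open>Eliminating lists and rooted trees leaves two crossed equations between the child series
  of the two connectives, which have \<open>schroeder\<close> as their only solution without
  constant term.\<close>

lemma gf_totals:
  assumes "n \<ge> 1"
  shows "gf n (kids n c) (\<lambda>_. 1) = schroeder"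
    and "gf n (forests n c) (\<lambda>_. 1) = schroeder_inv - 1"
    and "gf n (rooted n c) (\<lambda>_. 1) = schroeder - fps_X"
proof -
  define Y where "Y c = gf n (kids n c) (\<lambda>_. 1)" for c
  define L where "L c = gf n (forests n c) (\<lambda>_. 1)" for c
  define V where "V c = gf n (rooted n c) (\<lambda>_. 1)" for c
  have Y: "Y c = fps_X + V (dual_conn c)" for c
    using assms by (simp add: Y_def V_def gf_kids_const_leaf)
  have V: "V c = Y c * L c" for c
    using gf_long_forests[of n c "\<lambda>_. 1" "\<lambda>_. 1"] by (simp add: V_def Y_def L_def gf_rooted)
  have L: "L c = Y c + V c" for c
    unfolding L_def Y_def V_def gf_rooted by (rule gf_forests)
  have eq: "Y c * (1 - Y (dual_conn c)) = fps_X * (1 - Y (dual_conn c)) + Y (dual_conn c) ^ 2" for c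
  proof -
    have "V (dual_conn c) * (1 - Y (dual_conn c))
        = Y (dual_conn c) * (L (dual_conn c) - Y (dual_conn c) * L (dual_conn c))"
      unfolding V by (simp add: algebra_simps)
    also have "L (dual_conn c) - Y (dual_conn c) * L (dual_conn c) = Y (dual_conn c)"
      using L[of "dual_conn c"] unfolding V by (metis add_diff_cancel_right')
    finally show ?thesis unfolding Y[of c] by (simp add: algebra_simps power2_eq_square)
  qed
  have Yc: "Y c = schroeder" for c
    using schroeder_unique[OF eq[of c]] eq[of "dual_conn c"] by (simp add: Y_def)
  show "gf n (kids n c) (\<lambda>_. 1) = schroeder" using Yc by (simp add: Y_def)
  show "gf n (rooted n c) (\<lambda>_. 1) = schroeder - fps_X"
    using Y[of "dual_conn c"] unfolding Yc V_def dual_conn_dual_conn by (metis add_diff_cancel_left')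
  have "(1 - schroeder) * L c = schroeder" using L[of c] V[of c] Yc[of c] by (simp add: algebra_simps)
  then have "L c = schroeder_inv * schroeder" by (rule mult_one_minus_schroeder_cancel)
  also have "\<dots> = schroeder_inv - 1" using schroeder_inv_mult by (simp add: algebra_simps)
  finally show "gf n (forests n c) (\<lambda>_. 1) = schroeder_inv - 1" by (simp add: L_def)
qed

lemma wt_bounded_gf_le:
  assumes "wt_bounded (gf n X (\<lambda>_. 1))" and "\<And>x. \<bar>\<phi> x\<bar> \<le> 1"
  shows "wt_bounded (gf n X \<phi>)"
  using assms(1) by (rule wt_bounded_mono) (rule gf_abs_le[OF assms(2)])

lemma card_rooted:
  assumes "n \<ge> 1" and "m \<ge> 2"
  shows "real (card (rooted n c m)) = wt m * (2 * real n) ^ m"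
proof -
  have "gf n (rooted n c) (\<lambda>_. 1) $ m = wt m" using assms gf_totals(3)[OF assms(1)] by (simp add: wt_eq)
  then show ?thesis using assms(1) by (simp add: gf_nth field_simps)
qed

lemma assoc_trees_eq: "m \<ge> 2 \<Longrightarrow> assoc_trees m n = rooted n Conj m \<union> rooted n Disj m"
proof (intro set_eqI iffI)
  fix t assume "m \<ge> 2" "t \<in> assoc_trees m n"
  then show "t \<in> rooted n Conj m \<union> rooted n Disj m"
    by (cases t) (auto simp: rooted_def assoc_trees_def intro: connective.exhaust)
qed (auto simp: rooted_def)

lemma card_assoc_trees_filter:
  assumes "m \<ge> 2"
  shows "card {t \<in> assoc_trees m n. P t}
    = card {t \<in> rooted n Conj m. P t} + card {t \<in> rooted n Disj m. P t}"
proof -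
  have "{t \<in> assoc_trees m n. P t} = {t \<in> rooted n Conj m. P t} \<union> {t \<in> rooted n Disj m. P t}"
    using assoc_trees_eq[OF assms] by auto
  then show ?thesis by (simp, subst card_Un_disjoint) (auto simp: rooted_def finite_assoc_trees)
qed

lemma sum_of_bool_card: "finite A \<Longrightarrow> (\<Sum>x\<in>A. of_bool (P x)) = real (card {x \<in> A. P x})"
  by (simp add: sum_of_bool_eq Int_def)

text \<open>From size 2 on, every tree has a root label, and each label accounts for the same number
  of trees; hence the factor 2 in the denominator.\<close>

lemma pmf_True:
  assumes "n \<ge> 1" and "m \<ge> 2"
  shows "pmf (assoc_dist m n) True_fun
    = real (card {t \<in> assoc_trees m n. tree_eval t = True_fun}) / (2 * wt m * (2 * real n) ^ m)"
proof -
  have ne: "assoc_trees m n \<noteq> {}" using assms by (intro assoc_trees_nonempty) auto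
  have "real (card (assoc_trees m n)) = 2 * wt m * (2 * real n) ^ m"
    using card_assoc_trees_filter[OF assms(2), of n "\<lambda>_. True"] card_rooted[OF assms] by simp
  moreover have "assoc_trees m n \<inter> tree_eval -` {True_fun} = {t \<in> assoc_trees m n. tree_eval t = True_fun}"
    by auto
  ultimately show ?thesis
    unfolding assoc_dist_def pmf_map
    by (subst measure_pmf_of_set) (use ne in \<open>auto simp: finite_assoc_trees\<close>)
qed

section \<open>Existence of the limit distribution\<close>

text \<open>A finite set, closed under both connectives, that contains the function of every tree:
  summing over it recovers the total counts.\<close>

definition bool_funs :: "nat \<Rightarrow> ((nat \<Rightarrow> bool) \<Rightarrow> bool) set" where
  "bool_funs n = {f. \<forall>a b. (\<forall>i\<in>{1..n}. a i = b i) \<longrightarrow> f a = f b}"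

lemma bool_funsD: "f \<in> bool_funs n \<Longrightarrow> (\<And>i. i \<in> {1..n} \<Longrightarrow> a i = b i) \<Longrightarrow> f a = f b"
  by (simp add: bool_funs_def)

lemma finite_bool_funs [simp]: "finite (bool_funs n)"
proof (rule inj_on_finite)
  let ?code = "\<lambda>f. {S \<in> Pow {1..n}. f (\<lambda>i. i \<in> S)}"
  show "inj_on ?code (bool_funs n)"
  proof (rule inj_onI, rule ext)
    fix f g a assume f: "f \<in> bool_funs n" and g: "g \<in> bool_funs n" and eq: "?code f = ?code g"
    let ?S = "{i \<in> {1..n}. a i}"
    have "f a = f (\<lambda>i. i \<in> ?S)" by (rule bool_funsD[OF f]) simp
    moreover have "g a = g (\<lambda>i. i \<in> ?S)" by (rule bool_funsD[OF g]) simp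
    moreover have "f (\<lambda>i. i \<in> ?S) = g (\<lambda>i. i \<in> ?S)"
    proof -
      have "?S \<in> ?code f \<longleftrightarrow> ?S \<in> ?code g" by (simp only: eq)
      then show ?thesis by auto
    qed
    ultimately show "f a = g a" by simp
  qed
  show "?code ` bool_funs n \<subseteq> Pow (Pow {1..n})" by auto
qed simp

lemma tree_eval_in_bool_funs: "labelled_assoc n t \<Longrightarrow> tree_eval t \<in> bool_funs n"
  unfolding bool_funs_def by (intro CollectI allI impI tree_eval_cong) auto

lemma tree_eval_Node_in_bool_funs:
  assumes "\<And>t. t \<in> set ts \<Longrightarrow> labelled_assoc n t"
  shows "tree_eval (Node c ts) \<in> bool_funs n"
  unfolding bool_funs_def
proof (intro CollectI allI impI)
  fix a b :: "nat \<Rightarrow> bool" assume "\<forall>i\<in>{1..n}. a i = b i"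
  then have "tree_eval t a = tree_eval t b" if "t \<in> set ts" for t
    using that assms by (intro tree_eval_cong) auto
  then show "tree_eval (Node c ts) a = tree_eval (Node c ts) b" by (cases c) auto
qed

definition conn_fun ::
  "connective \<Rightarrow> ((nat \<Rightarrow> bool) \<Rightarrow> bool) \<Rightarrow> ((nat \<Rightarrow> bool) \<Rightarrow> bool) \<Rightarrow> (nat \<Rightarrow> bool) \<Rightarrow> bool" where
  "conn_fun c f g = (\<lambda>a. if c = Conj then f a \<and> g a else f a \<or> g a)"

text \<open>The constant function which, as the value of some children, decides a node labelled
  \<open>c\<close>.\<close>

definition absorbing :: "connective \<Rightarrow> (nat \<Rightarrow> bool) \<Rightarrow> bool" where
  "absorbing c = (\<lambda>a. c = Disj)"

lemma conn_fun_absorbing [simp]: "conn_fun c f (absorbing c) = absorbing c"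
  by (cases c) (auto simp: conn_fun_def absorbing_def)

lemma absorbing_in_bool_funs [simp]: "absorbing c \<in> bool_funs n"
  by (simp add: absorbing_def bool_funs_def)

lemma conn_fun_in_bool_funs: "f \<in> bool_funs n \<Longrightarrow> g \<in> bool_funs n \<Longrightarrow> conn_fun c f g \<in> bool_funs n"
  unfolding bool_funs_def conn_fun_def by (auto; blast)

lemma tree_eval_single: "tree_eval (Node c [t]) = tree_eval t"
  by (cases c) auto

lemma tree_eval_Cons: "tree_eval (Node c (t # ts)) = conn_fun c (tree_eval t) (tree_eval (Node c ts))"
  by (rule ext) (cases c; simp add: conn_fun_def)

section \<open>Counting series of a single Boolean function\<close>

definition kids_gf :: "nat \<Rightarrow> connective \<Rightarrow> ((nat \<Rightarrow> bool) \<Rightarrow> bool) \<Rightarrow> real fps" where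
  "kids_gf n c f = gf n (kids n c) (\<lambda>t. of_bool (tree_eval t = f))"

definition rooted_gf :: "nat \<Rightarrow> connective \<Rightarrow> ((nat \<Rightarrow> bool) \<Rightarrow> bool) \<Rightarrow> real fps" where
  "rooted_gf n c f = gf n (rooted n c) (\<lambda>t. of_bool (tree_eval t = f))"

definition forests_gf :: "nat \<Rightarrow> connective \<Rightarrow> ((nat \<Rightarrow> bool) \<Rightarrow> bool) \<Rightarrow> real fps" where
  "forests_gf n c f = gf n (forests n c) (\<lambda>ts. of_bool (tree_eval (Node c ts) = f))"

lemma function_gf_nonneg:
  "kids_gf n c f $ m \<ge> 0" "rooted_gf n c f $ m \<ge> 0" "forests_gf n c f $ m \<ge> 0"
  by (simp_all add: kids_gf_def rooted_gf_def forests_gf_def gf_nonneg)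

lemma function_gf_wt_bounded [simp]:
  assumes "n \<ge> 1"
  shows "wt_bounded (kids_gf n c f)" "wt_bounded (rooted_gf n c f)" "wt_bounded (forests_gf n c f)"
  unfolding kids_gf_def rooted_gf_def forests_gf_def
  by (rule wt_bounded_gf_le; use gf_totals[OF assms] in \<open>simp add: wt_bounded_diff\<close>)+

lemma forests_gf_eq: "forests_gf n c f = kids_gf n c f + rooted_gf n c f"
  unfolding forests_gf_def kids_gf_def rooted_gf_def gf_rooted gf_forests
  by (simp add: tree_eval_single del: tree_eval.simps)

text \<open>Single leaves change only the coefficient of index 1, which no oscillation sees.\<close>

lemma osc_kids_gf_le:
  assumes "n \<ge> 1"
  shows "osc (kids_gf n c f) \<le> osc (rooted_gf n (dual_conn c) f)"
proof -
  define d where "d = fps_const ((\<Sum>l\<in>lits n. of_bool (tree_eval (Leaf l) = f)) / (2 * real n)) * fps_X"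
  have d: "wt_bounded d" unfolding d_def by (intro wt_bounded_mult) auto
  have "osc (kids_gf n c f) \<le> osc d + osc (rooted_gf n (dual_conn c) f)"
    unfolding kids_gf_def rooted_gf_def gf_kids d_def[symmetric]
    by (rule osc_add) (use assms d function_gf_wt_bounded(2)[of n "dual_conn c" f] in \<open>auto simp: rooted_gf_def\<close>)
  moreover have "osc d = 0"
    by (rule osc_eventually_proportional[OF d, of 0])
      (use eventually_gt_at_top[of "1::nat"] in eventually_elim, simp add: d_def)
  ultimately show ?thesis by simp
qed

lemma sum_of_bool_eq_one:
  "finite B \<Longrightarrow> g \<in> B \<Longrightarrow> (\<Sum>f\<in>B. of_bool (g = f)) = (1 :: real)"
  by (simp add: of_bool_def)

lemma sum_kids_gf:
  assumes "n \<ge> 1"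
  shows "(\<Sum>f\<in>bool_funs n. kids_gf n c f) = schroeder"
proof -
  have "(\<Sum>f\<in>bool_funs n. kids_gf n c f)
      = gf n (kids n c) (\<lambda>t. \<Sum>f\<in>bool_funs n. of_bool (tree_eval t = f))"
    unfolding kids_gf_def by (rule gf_sum[symmetric])
  also have "\<dots> = gf n (kids n c) (\<lambda>_. 1)"
    by (intro gf_cong sum_of_bool_eq_one finite_bool_funs tree_eval_in_bool_funs)
      (auto simp: kids_def assoc_trees_def)
  finally show ?thesis by (simp add: gf_totals[OF assms])
qed

lemma sum_forests_gf:
  assumes "n \<ge> 1"
  shows "(\<Sum>f\<in>bool_funs n. forests_gf n c f) = schroeder_inv - 1"
proof -
  have "(\<Sum>f\<in>bool_funs n. forests_gf n c f)
      = gf n (forests n c) (\<lambda>ts. \<Sum>f\<in>bool_funs n. of_bool (tree_eval (Node c ts) = f))"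
    unfolding forests_gf_def by (rule gf_sum[symmetric])
  also have "\<dots> = gf n (forests n c) (\<lambda>_. 1)"
    by (intro gf_cong sum_of_bool_eq_one finite_bool_funs tree_eval_Node_in_bool_funs)
      (auto simp: forests_def)
  finally show ?thesis by (simp add: gf_totals[OF assms])
qed

definition conn_pairs where
  "conn_pairs n c f = {p \<in> bool_funs n \<times> bool_funs n. conn_fun c (fst p) (snd p) = f}"

lemma finite_conn_pairs [simp]: "finite (conn_pairs n c f)"
  by (simp add: conn_pairs_def)

lemma rooted_gf_eq:
  "rooted_gf n c f = (\<Sum>p\<in>conn_pairs n c f. kids_gf n c (fst p) * forests_gf n c (snd p))"
proof -
  have "of_bool (tree_eval (Node c ts) = f)
      = (\<Sum>p\<in>conn_pairs n c f. of_bool (tree_eval (hd ts) = fst p)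
          * of_bool (tree_eval (Node c (tl ts)) = snd p) :: real)"
    if tsm: "ts \<in> long_forests n c m" for ts m
  proof -
    obtain u us where ts: "ts = u # us" using tsm by (cases ts) (auto simp: long_forests_def)
    have lab: "labelled_assoc n u" "\<And>v. v \<in> set us \<Longrightarrow> labelled_assoc n v"
      using that by (auto simp: ts long_forests_def forests_def)
    let ?p = "(tree_eval u, tree_eval (Node c us))"
    have "(\<Sum>p\<in>conn_pairs n c f. of_bool (tree_eval u = fst p) * of_bool (tree_eval (Node c us) = snd p))
        = (\<Sum>p\<in>conn_pairs n c f. if p = ?p then 1 else 0 :: real)"
      by (intro sum.cong) auto
    also have "\<dots> = of_bool (?p \<in> conn_pairs n c f)" by simp
    also have "?p \<in> conn_pairs n c f \<longleftrightarrow> tree_eval (Node c ts) = f"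
      using tree_eval_in_bool_funs[OF lab(1)] tree_eval_Node_in_bool_funs[OF lab(2)]
      by (simp add: conn_pairs_def ts tree_eval_Cons del: tree_eval.simps)
    finally show ?thesis by (simp add: ts)
  qed
  then have "rooted_gf n c f = gf n (long_forests n c)
      (\<lambda>ts. \<Sum>p\<in>conn_pairs n c f. of_bool (tree_eval (hd ts) = fst p)
          * of_bool (tree_eval (Node c (tl ts)) = snd p))"
    unfolding rooted_gf_def gf_rooted by (rule gf_cong)
  also have "\<dots> = (\<Sum>p\<in>conn_pairs n c f. kids_gf n c (fst p) * forests_gf n c (snd p))"
    unfolding gf_sum kids_gf_def forests_gf_def by (intro sum.cong refl gf_long_forests)
  finally show ?thesis .
qed

lemma osc_sum_mult_le:
  assumes "n \<ge> 1"
  shows "osc (\<Sum>p\<in>P. kids_gf n c (fst p) * forests_gf n c (snd p))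
    \<le> (\<Sum>p\<in>P. fps_at_rho (kids_gf n c (fst p)) * osc (forests_gf n c (snd p))
        + fps_at_rho (forests_gf n c (snd p)) * osc (kids_gf n c (fst p)))"
  by (rule order_trans[OF osc_sum])
    (use assms in \<open>auto intro!: wt_bounded_mult sum_mono osc_mult function_gf_nonneg\<close>)

text \<open>When the remaining children already force the value of the root, the first child is
  unconstrained, so that its generating functions sum to \<open>schroeder\<close>, which does not oscillate.
  This gains the mass of \<open>absorbing c\<close> in the estimate below.\<close>

lemma osc_rooted_gf_le:
  assumes n: "n \<ge> 1"
  shows "osc (rooted_gf n c f)
    \<le> (\<Sum>p\<in>conn_pairs n c f. fps_at_rho (kids_gf n c (fst p)) * osc (forests_gf n c (snd p))
        + (if snd p = absorbing c then 0 else fps_at_rho (forests_gf n c (snd p)))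
          * osc (kids_gf n c (fst p)))"
proof (cases "f = absorbing c")
  case False
  then have "snd p \<noteq> absorbing c" if "p \<in> conn_pairs n c f" for p
    using that by (auto simp: conn_pairs_def)
  then show ?thesis
    unfolding rooted_gf_eq by (intro order_trans[OF osc_sum_mult_le[OF n]] sum_mono) auto
next
  case True
  define P where "P = {p \<in> conn_pairs n c f. snd p \<noteq> absorbing c}"
  have split: "conn_pairs n c f = P \<union> (\<lambda>g. (g, absorbing c)) ` bool_funs n"
    and disj: "P \<inter> (\<lambda>g. (g, absorbing c)) ` bool_funs n = {}"
    by (auto simp: P_def conn_pairs_def True image_iff)
  have P: "finite P" by (simp add: P_def)
  have sum_split: "(\<Sum>p\<in>conn_pairs n c f. h p) = (\<Sum>p\<in>P. h p) + (\<Sum>g\<in>bool_funs n. h (g, absorbing c))"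
    for h :: "_ \<Rightarrow> 'b::comm_monoid_add"
    unfolding split by (subst sum.union_disjoint[OF P _ disj]) (simp_all add: sum.reindex inj_on_def)
  let ?Q = "\<Sum>p\<in>P. kids_gf n c (fst p) * forests_gf n c (snd p)"
  \<comment> \<open>The recombination precedes the estimate: subadditivity of \<open>osc\<close>
    would lose the cancellation among the functions of the first child.\<close>
  have "rooted_gf n c f = ?Q + schroeder * forests_gf n c (absorbing c)"
    unfolding rooted_gf_eq sum_split by (simp add: sum_distrib_right[symmetric] sum_kids_gf[OF n])
  then have "osc (rooted_gf n c f) \<le> osc ?Q + osc (schroeder * forests_gf n c (absorbing c))"
    using n by (auto intro!: osc_add wt_bounded_sum wt_bounded_mult)
  also have "osc (schroeder * forests_gf n c (absorbing c))
      \<le> fps_at_rho schroeder * osc (forests_gf n c (absorbing c))"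
    using osc_mult[of schroeder "forests_gf n c (absorbing c)"] n
    by (simp add: osc_schroeder function_gf_nonneg)
  also have "fps_at_rho schroeder = (\<Sum>g\<in>bool_funs n. fps_at_rho (kids_gf n c g))"
    unfolding sum_kids_gf[OF n, of c, symmetric] using n by (intro fps_at_rho_sum) auto
  also have "osc ?Q \<le> (\<Sum>p\<in>P. fps_at_rho (kids_gf n c (fst p)) * osc (forests_gf n c (snd p))
        + fps_at_rho (forests_gf n c (snd p)) * osc (kids_gf n c (fst p)))"
    by (rule osc_sum_mult_le[OF n])
  also have "\<dots> = (\<Sum>p\<in>P. fps_at_rho (kids_gf n c (fst p)) * osc (forests_gf n c (snd p))
        + (if snd p = absorbing c then 0 else fps_at_rho (forests_gf n c (snd p)))
          * osc (kids_gf n c (fst p)))"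
    by (intro sum.cong) (auto simp: P_def)
  finally show ?thesis
    unfolding sum_split by (simp add: sum_distrib_right)
qed

lemma sum_conn_pairs:
  "(\<Sum>f\<in>bool_funs n. \<Sum>p\<in>conn_pairs n c f. h p) = (\<Sum>g\<in>bool_funs n. \<Sum>k\<in>bool_funs n. h (g, k))"
proof -
  have "(\<Sum>f\<in>bool_funs n. \<Sum>p\<in>conn_pairs n c f. h p) = (\<Sum>p\<in>bool_funs n \<times> bool_funs n. h p)"
    unfolding conn_pairs_def
    by (rule sum.group) (auto intro: conn_fun_in_bool_funs)
  then show ?thesis by (simp add: sum.cartesian_product)
qed

text \<open>A variable next to its negation already computes the absorbing function, under either
  connective.\<close>

lemma forests_gf_absorbing_pos:
  assumes n: "n \<ge> 1"
  shows "fps_at_rho (forests_gf n c (absorbing c)) > 0"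
proof -
  let ?ts = "[Leaf (Pos 1), Leaf (Neg 1)]" and ?a = "forests_gf n c (absorbing c)"
  have "?ts \<in> forests n c 2" using n by (auto simp: forests_def)
  moreover have "tree_eval (Node c ?ts) = absorbing c" by (cases c) (auto simp: absorbing_def)
  ultimately have "(\<Sum>ts\<in>forests n c 2. of_bool (tree_eval (Node c ts) = absorbing c)) > (0 :: real)"
    by (intro sum_pos2[of _ ?ts]) (auto simp del: tree_eval.simps)
  then have "?a $ 2 > 0" using n by (simp add: forests_gf_def gf_nth del: tree_eval.simps)
  then have "0 < (\<Sum>m\<in>{2}. ?a $ m * rho ^ m)" using rho_pos by simp
  also have "\<dots> \<le> fps_at_rho ?a"
    by (rule partial_sum_le_fps_at_rho) (use n in \<open>auto simp: function_gf_nonneg\<close>)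
  finally show ?thesis .
qed

definition total_osc where
  "total_osc n c = (\<Sum>f\<in>bool_funs n. osc (kids_gf n c f))"

lemma total_osc_nonneg: "n \<ge> 1 \<Longrightarrow> total_osc n c \<ge> 0"
  unfolding total_osc_def by (intro sum_nonneg osc_nonneg) auto

text \<open>At \<open>rho\<close>, children have total mass \<open>\<tau>\<close> and lists
  \<open>sqrt 2 - 1\<close>. Since \<open>\<tau> + sqrt 2 - 1 = 1 - \<tau>\<close>, solving for
  \<open>V\<close> without the term \<open>\<eta>\<close> would give exactly the factor 1.\<close>

lemma sum_osc_rooted_gf_le:
  assumes n: "n \<ge> 1"
  shows "(\<Sum>f\<in>bool_funs n. osc (rooted_gf n c f))
    \<le> (1 - fps_at_rho (forests_gf n c (absorbing c))) * total_osc n c"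
proof -
  define D where "D = total_osc n c"
  define V where "V = (\<Sum>f\<in>bool_funs n. osc (rooted_gf n c f))"
  define L where "L = (\<Sum>f\<in>bool_funs n. osc (forests_gf n c f))"
  define \<eta> where "\<eta> = fps_at_rho (forests_gf n c (absorbing c))"
  define \<tau> :: real where "\<tau> = 1 - sqrt 2 / 2"
  have \<tau>: "(\<Sum>g\<in>bool_funs n. fps_at_rho (kids_gf n c g)) = \<tau>"
    using n by (simp add: \<tau>_def fps_at_rho_sum[symmetric] sum_kids_gf fps_at_rho_schroeder)
  have F: "(\<Sum>k\<in>bool_funs n. fps_at_rho (forests_gf n c k)) = sqrt 2 - 1"
    using n by (simp add: fps_at_rho_sum[symmetric] sum_forests_gf fps_at_rho_diff fps_at_rho_schroeder_inv)
  have F': "(\<Sum>k\<in>bool_funs n. if k = absorbing c then 0 else fps_at_rho (forests_gf n c k)) = sqrt 2 - 1 - \<eta>"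
  proof -
    have "(\<Sum>k\<in>bool_funs n. if k = absorbing c then 0 else fps_at_rho (forests_gf n c k))
        = (\<Sum>k\<in>bool_funs n. fps_at_rho (forests_gf n c k) - (if k = absorbing c then \<eta> else 0))"
      by (intro sum.cong) (auto simp: \<eta>_def)
    then show ?thesis by (simp add: sum_subtractf F)
  qed
  have "V \<le> (\<Sum>f\<in>bool_funs n. \<Sum>p\<in>conn_pairs n c f.
      fps_at_rho (kids_gf n c (fst p)) * osc (forests_gf n c (snd p))
        + (if snd p = absorbing c then 0 else fps_at_rho (forests_gf n c (snd p)))
          * osc (kids_gf n c (fst p)))"
    unfolding V_def by (intro sum_mono osc_rooted_gf_le n)
  also have "\<dots> = (\<Sum>g\<in>bool_funs n. \<Sum>k\<in>bool_funs n. fps_at_rho (kids_gf n c g) * osc (forests_gf n c k)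
        + (if k = absorbing c then 0 else fps_at_rho (forests_gf n c k)) * osc (kids_gf n c g))"
    by (simp only: sum_conn_pairs fst_conv snd_conv)
  also have "\<dots> = \<tau> * L + (sqrt 2 - 1 - \<eta>) * D"
    unfolding sum.distrib sum_distrib_left[symmetric] sum_distrib_right[symmetric] F' \<tau>
    by (simp add: L_def D_def total_osc_def sum_distrib_left)
  finally have VL: "V \<le> \<tau> * L + (sqrt 2 - 1 - \<eta>) * D" .
  have "L \<le> D + V"
    unfolding L_def D_def V_def total_osc_def sum.distrib[symmetric] forests_gf_eq
    using n by (intro sum_mono osc_add) auto
  then have "\<tau> * L \<le> \<tau> * (D + V)" by (intro mult_left_mono) (auto simp: \<tau>_def sqrt2_less_2 less_imp_le)
  with VL have "(1 - \<tau>) * V \<le> (\<tau> + sqrt 2 - 1 - \<eta>) * D" by (simp add: algebra_simps)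
  \<comment> \<open>The multiplier is \<open>1 / (1 - \<tau>)\<close>.\<close>
  then have "sqrt 2 * ((1 - \<tau>) * V) \<le> sqrt 2 * ((\<tau> + sqrt 2 - 1 - \<eta>) * D)"
    by (intro mult_left_mono) auto
  also have "sqrt 2 * ((\<tau> + sqrt 2 - 1 - \<eta>) * D) = (1 - sqrt 2 * \<eta>) * D"
    by (simp add: \<tau>_def algebra_simps)
  also have "sqrt 2 * ((1 - \<tau>) * V) = V" by (simp add: \<tau>_def)
  also have "(1 - sqrt 2 * \<eta>) * D \<le> (1 - \<eta>) * D"
    using forests_gf_absorbing_pos[OF n, of c] total_osc_nonneg[OF n, of c]
    by (intro mult_right_mono) (auto simp: D_def \<eta>_def)
  finally show ?thesis by (simp add: V_def D_def \<eta>_def)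
qed

text \<open>The estimate leads from one connective to its dual; going round both bounds the total
  oscillation by a factor below 1 times itself.\<close>

lemma osc_rooted_gf:
  assumes n: "n \<ge> 1"
  shows "osc (rooted_gf n c f) = 0"
proof -
  have step: "total_osc n (dual_conn c) \<le> (1 - fps_at_rho (forests_gf n c (absorbing c))) * total_osc n c" for c
  proof -
    have "total_osc n (dual_conn c) \<le> (\<Sum>f\<in>bool_funs n. osc (rooted_gf n c f))"
      unfolding total_osc_def using osc_kids_gf_le[OF n, of "dual_conn c"] by (intro sum_mono) simp
    then show ?thesis using sum_osc_rooted_gf_le[OF n, of c] by linarith
  qed
  have le: "total_osc n (dual_conn c) \<le> total_osc n c" for c
  proof -
    have "(1 - fps_at_rho (forests_gf n c (absorbing c))) * total_osc n c \<le> 1 * total_osc n c"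
      using forests_gf_absorbing_pos[OF n, of c] total_osc_nonneg[OF n, of c]
      by (intro mult_right_mono) auto
    then show ?thesis using step[of c] by linarith
  qed
  have "total_osc n c \<le> (1 - fps_at_rho (forests_gf n c (absorbing c))) * total_osc n c"
    using step[of c] le[of "dual_conn c"] by simp
  then have "fps_at_rho (forests_gf n c (absorbing c)) * total_osc n c \<le> 0"
    by (simp add: algebra_simps)
  then have zero: "total_osc n c = 0"
    using forests_gf_absorbing_pos[OF n, of c] total_osc_nonneg[OF n, of c]
    by (simp add: mult_le_0_iff)
  show ?thesis
  proof (cases "f \<in> bool_funs n")
    case True
    have "osc (rooted_gf n c f) \<le> (\<Sum>f\<in>bool_funs n. osc (rooted_gf n c f))"
      by (intro member_le_sum) (use True n in \<open>auto intro: osc_nonneg\<close>)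
    also have "\<dots> \<le> 0" using sum_osc_rooted_gf_le[OF n, of c] zero by simp
    finally show ?thesis using osc_nonneg[of "rooted_gf n c f"] n by simp
  next
    case False
    then have "conn_pairs n c f = {}" by (auto simp: conn_pairs_def intro: conn_fun_in_bool_funs)
    then show ?thesis by (simp add: rooted_gf_eq)
  qed
qed

lemma convergent_pmf_True:
  assumes n: "n \<ge> 1"
  shows "convergent (\<lambda>m. pmf (assoc_dist m n) True_fun)"
proof -
  have conv: "convergent (\<lambda>m. rooted_gf n c True_fun $ m / wt m)" for c
    by (rule osc_zero_convergent) (use n osc_rooted_gf in auto)
  then obtain l where l: "(\<lambda>m. rooted_gf n c True_fun $ m / wt m) \<longlonglongrightarrow> l c" for c
    unfolding convergent_def by metis
  have "(\<lambda>m. (rooted_gf n Conj True_fun $ m / wt m + rooted_gf n Disj True_fun $ m / wt m) / 2)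
      \<longlonglongrightarrow> (l Conj + l Disj) / 2"
    by (intro tendsto_intros l) simp
  moreover have "\<forall>\<^sub>F m in sequentially.
      (rooted_gf n Conj True_fun $ m / wt m + rooted_gf n Disj True_fun $ m / wt m) / 2
        = pmf (assoc_dist m n) True_fun"
    using eventually_ge_at_top[of 2]
  proof eventually_elim
    case (elim m)
    have "rooted_gf n c True_fun $ m = real (card {t \<in> rooted n c m. tree_eval t = True_fun}) / (2 * real n) ^ m" for c
      unfolding rooted_gf_def gf_nth by (subst sum_of_bool_card) simp_all
    then show ?case
      unfolding pmf_True[OF n elim] card_assoc_trees_filter[OF elim]
      using n by (simp add: field_simps)
  qed
  ultimately have "(\<lambda>m. pmf (assoc_dist m n) True_fun) \<longlonglongrightarrow> (l Conj + l Disj) / 2"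
    by (rule Lim_transform_eventually)
  then show ?thesis by (auto simp: convergent_def)
qed

section \<open>Tautologies\<close>

text \<open>A set of leaves whose simultaneous falsification falsifies the tree; the first two children
  of a conjunction are recorded, although either alone would do, to detect independent coincidences.\<close>

fun pattern :: "assoc_tree \<Rightarrow> literal list" where
  "pattern (Leaf l) = [l]"
| "pattern (Node Disj ts) = concat (map pattern ts)"
| "pattern (Node Conj (t # u # ts)) = pattern t @ pattern u"
| "pattern (Node Conj [t]) = []"
| "pattern (Node Conj []) = []"

text \<open>What the children after the first one add to the pattern of a node. With it, both
  connectives obey one rule,
  \<open>pattern (Node c (t # us)) = pattern t @ branch c us\<close>.\<close>

definition branch :: "connective \<Rightarrow> assoc_tree list \<Rightarrow> literal list" where
  "branch c ts = (if c = Disj then concat (map pattern ts) else pattern (hd ts))"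

fun leaf_word :: "assoc_tree \<Rightarrow> literal list" where
  "leaf_word (Leaf l) = [l]"
| "leaf_word (Node c ts) = []"

fun root_word :: "assoc_tree \<Rightarrow> literal list" where
  "root_word (Leaf l) = []"
| "root_word (Node c ts) = concat (map leaf_word ts)"

lemma branch_single [simp]: "branch c [t] = pattern t"
  by (simp add: branch_def)

lemma pattern_Node: "us \<noteq> [] \<Longrightarrow> pattern (Node c (t # us)) = pattern t @ branch c us"
  by (cases c; cases us) (auto simp: branch_def)

lemma pattern_false:
  "labelled_assoc n t \<Longrightarrow> (\<And>l. l \<in> set (pattern t) \<Longrightarrow> \<not> lit_eval a l) \<Longrightarrow> \<not> tree_eval t a"
proof (induction t rule: pattern.induct)
  case (2 ts)
  then show ?case by auto
qed auto

lemma falsifying_assignment: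
  assumes "\<not> complementary w"
  obtains a where "\<And>l. l \<in> set w \<Longrightarrow> \<not> lit_eval a l"
proof (rule that[of "\<lambda>i. Neg i \<in> set w"])
  fix l assume l: "l \<in> set w"
  then have "neg_lit l \<notin> set w" using assms by (auto simp: complementary_def)
  then show "\<not> lit_eval (\<lambda>i. Neg i \<in> set w) l" using l by (cases l) auto
qed

lemma tautology_complementary:
  assumes "labelled_assoc n t" and "tree_eval t = True_fun"
  shows "complementary (pattern t)"
proof (rule ccontr)
  assume "\<not> complementary (pattern t)"
  then obtain a where "\<And>l. l \<in> set (pattern t) \<Longrightarrow> \<not> lit_eval a l"
    using falsifying_assignment by blast
  then have "\<not> tree_eval t a" using pattern_false assms(1) by blast
  then show False by (simp add: assms(2) True_fun_def)
qed

text \<open>Removing \<open>x\<close> and \<open>y\<close> from the set of letters loses no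
  variable, as their negations remain.\<close>

lemma excess_two_pairs:
  assumes "x \<in> set w" and "neg_lit x \<in> set w" and "y \<in> set w" and "neg_lit y \<in> set w"
    and "lit_var x \<noteq> lit_var y"
  shows "excess w \<ge> 2"
proof -
  have ne: "x \<noteq> y" "neg_lit x \<noteq> y" "neg_lit y \<noteq> x" using assms(5) by auto
  have "lit_var ` set w \<subseteq> lit_var ` (set w - {x, y})"
  proof
    fix v assume "v \<in> lit_var ` set w"
    then obtain l where l: "l \<in> set w" "v = lit_var l" by auto
    show "v \<in> lit_var ` (set w - {x, y})"
    proof (cases "l = x \<or> l = y")
      case True
      then have "neg_lit l \<in> set w - {x, y}" using assms(2,4) ne by auto
      then show ?thesis using l(2) by (metis image_eqI lit_var_neg_lit)
    qed (use l in auto)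
  qed
  then have "card (lit_var ` set w) \<le> card (set w - {x, y})"
    by (meson card_image_le card_mono finite_Diff finite_imageI finite_set order_trans)
  moreover have "card (set w - {x, y}) = card (set w) - 2"
    using assms(1,3) ne by (simp add: card_Diff_subset)
  moreover have "card {x, y} \<le> card (set w)"
    using assms(1,3) by (intro card_mono) auto
  ultimately show ?thesis using card_length[of w] ne by (simp add: excess_def)
qed

lemma complementary_append_cases:
  assumes "complementary (v @ w)" and "\<not> complementary v"
  shows "complementary w \<or> lit_var ` set v \<inter> lit_var ` set w \<noteq> {}"
proof -
  obtain l where l: "l \<in> set (v @ w)" "neg_lit l \<in> set (v @ w)"
    using assms(1) by (auto simp: complementary_def)
  show ?thesis
  proof (cases "l \<in> set w \<longleftrightarrow> neg_lit l \<in> set w")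
    case True
    then show ?thesis using l assms(2) by (auto simp: complementary_def)
  next
    case False
    then have "lit_var l \<in> lit_var ` set v \<inter> lit_var ` set w"
      using l by (auto simp: image_iff) (metis lit_var_neg_lit)+
    then show ?thesis by blast
  qed
qed

lemma excess_append_ge:
  assumes "complementary w \<or> lit_var ` set v \<inter> lit_var ` set w \<noteq> {}"
  shows "excess (v @ w) \<ge> excess v + 1"
  using assms
proof
  assume "complementary w"
  then have "excess w \<ge> 1" by (rule complementary_excess)
  then show ?thesis by (simp add: excess_append)
next
  assume "lit_var ` set v \<inter> lit_var ` set w \<noteq> {}"
  then show ?thesis using excess_append_shared[of v w] by simp
qed

text \<open>The first extension brings a repetition. The second one has its own complementary pair
  or shares a variable with \<open>v\<close>, so its letters bring another, possibly of the same
  variable.\<close>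

lemma excess_two_extensions:
  assumes "\<not> complementary v" and "complementary (v @ w)" and "complementary (v @ w')"
  shows "excess (v @ w @ w') \<ge> 2"
proof -
  have "excess (v @ w) \<ge> 1"
    using excess_append_ge[OF complementary_append_cases[OF assms(2,1)]] by simp
  moreover have "excess ((v @ w) @ w') \<ge> excess (v @ w) + 1"
    using complementary_append_cases[OF assms(3,1)] by (intro excess_append_ge) auto
  ultimately show ?thesis by simp
qed

text \<open>Take a variable \<open>x\<close> occurring with both signs in the pattern. If it
  occurred inside a conjunctive child, choosing either of the two recorded grandchildren there would
  produce a second repetition. So \<open>x\<close> and its negation occur only at leaf children of
  the root.\<close>

lemma tautology_Disj:
  assumes lab: "labelled_assoc n (Node Disj ts)" and taut: "tree_eval (Node Disj ts) = True_fun"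
    and ex: "excess (pattern (Node Disj ts)) < 2"
  shows "complementary (concat (map leaf_word ts))"
proof -
  obtain x where x: "x \<in> set (pattern (Node Disj ts))" "neg_lit x \<in> set (pattern (Node Disj ts))"
    using tautology_complementary[OF lab taut] by (auto simp: complementary_def)
  have not_in_conj: "lit_var x \<notin> lit_var ` set (pattern u)"
    if u: "u \<in> set ts" "root_label u = Some Conj" for u
  proof -
    obtain us where us: "u = Node Conj us" using u(2) by (cases u rule: assoc_tree.exhaust) auto
    have labu: "labelled_assoc n u" using u lab by auto
    then obtain t1 t2 r where ts12: "us = t1 # t2 # r"
      unfolding us by (cases us; cases "tl us") auto
    obtain pre post where ts: "ts = pre @ u # post" using u by (meson split_list)
    define R where "R = concat (map pattern (pre @ post))"
    \<comment> \<open>Falsifying one of the two recorded children of \<open>u\<close> together with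
      everything in \<open>R\<close> falsifies the root.\<close>
    have comp: "complementary (R @ pattern s)" if s: "s = t1 \<or> s = t2" for s
    proof (rule ccontr)
      assume "\<not> complementary (R @ pattern s)"
      then obtain a where a: "\<And>l. l \<in> set (R @ pattern s) \<Longrightarrow> \<not> lit_eval a l"
        using falsifying_assignment by blast
      have "labelled_assoc n s" using s labu by (auto simp: us ts12)
      then have "\<not> tree_eval s a" using a by (intro pattern_false) auto
      then have "\<not> tree_eval u a" using s by (auto simp: us ts12)
      moreover have "\<not> tree_eval v a" if "v \<in> set (pre @ post)" for v
        using a that lab by (intro pattern_false[of n]) (auto simp: R_def ts)
      ultimately have "\<not> tree_eval (Node Disj ts) a" by (auto simp: ts)
      then show False by (simp add: taut True_fun_def)
    qed
    have exR: "excess (R @ pattern t1 @ pattern t2) < 2"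
    proof -
      have "excess (pattern (Node Disj ts)) = excess (R @ pattern t1 @ pattern t2)"
        by (rule excess_cong) (auto simp: R_def ts us ts12)
      then show ?thesis using ex by simp
    qed
    have "complementary R"
    proof (rule ccontr)
      assume "\<not> complementary R"
      then have "excess (R @ pattern t1 @ pattern t2) \<ge> 2"
        using comp[of t1] comp[of t2] by (intro excess_two_extensions) auto
      then show False using exR by simp
    qed
    then obtain y where y: "y \<in> set R" "neg_lit y \<in> set R" by (auto simp: complementary_def)
    then have "y \<in> set (pattern (Node Disj ts))" "neg_lit y \<in> set (pattern (Node Disj ts))"
      by (auto simp: R_def ts)
    \<comment> \<open>Complementary pairs on two different variables would already give excess
      2.\<close>
    then have xy: "lit_var x = lit_var y" using excess_two_pairs[OF x] ex by force
    show ?thesis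
    proof
      assume "lit_var x \<in> lit_var ` set (pattern u)"
      \<comment> \<open>The pair of \<open>y\<close> in \<open>R\<close> is one repetition, and a
        further occurrence of its variable below \<open>u\<close> would be the second.\<close>
      then have "lit_var y \<in> lit_var ` set R \<inter> lit_var ` set (pattern t1 @ pattern t2)"
        using y xy by (auto simp: us ts12)
      then have "excess (R @ pattern t1 @ pattern t2) \<ge> excess R + 1"
        by (intro excess_append_ge) blast
      then show False using exR complementary_excess[OF \<open>complementary R\<close>] by simp
    qed
  qed
  have "l \<in> set (concat (map leaf_word ts))"
    if l: "l \<in> set (pattern (Node Disj ts))" "lit_var l = lit_var x" for l
  proof -
    obtain u where u: "u \<in> set ts" "l \<in> set (pattern u)" using l(1) by auto
    have "root_label u \<noteq> Some Conj" using not_in_conj[OF u(1)] u(2) l(2) by (metis image_eqI)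
    moreover have "root_label u \<noteq> Some Disj" using u(1) lab by auto
    ultimately obtain k where "u = Leaf k"
      by (cases u) (auto intro: connective.exhaust)
    then show ?thesis using u by force
  qed
  then have "x \<in> set (concat (map leaf_word ts))" "neg_lit x \<in> set (concat (map leaf_word ts))"
    using x by auto
  then show ?thesis unfolding complementary_def by blast
qed

text \<open>Below a conjunction both recorded children are tautologies, and their patterns are
  disjoint pieces of the word with one repetition each.\<close>

lemma tautology_cases:
  assumes lab: "labelled_assoc n t" and taut: "tree_eval t = True_fun"
  shows "excess (pattern t) \<ge> 2 \<or> root_label t = Some Disj \<and> complementary (root_word t)"
proof (cases t)
  case (Leaf l)
  then show ?thesis using tautology_complementary[OF assms] by (simp add: complementary_def)
next
  case (Node c ts)
  show ?thesis
  proof (cases c)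
    case Conj
    obtain t1 t2 r where ts: "ts = t1 # t2 # r"
      using lab by (cases ts; cases "tl ts") (auto simp: Node)
    have "tree_eval t1 a" "tree_eval t2 a" for a
      using fun_cong[OF taut, of a] by (simp_all add: Node Conj ts True_fun_def)
    then have "tree_eval t1 = True_fun" "tree_eval t2 = True_fun"
      by (auto simp: True_fun_def)
    then have "complementary (pattern t1)" "complementary (pattern t2)"
      using lab by (auto simp: Node ts intro!: tautology_complementary)
    then have "excess (pattern t1) \<ge> 1" "excess (pattern t2) \<ge> 1"
      by (blast dest: complementary_excess)+
    then show ?thesis by (simp add: Node Conj ts excess_append)
  next
    case Disj
    then show ?thesis using tautology_Disj[of n ts] assms unfolding Node by force
  qed
qed

lemma tautology_if_complementary_root_word:
  assumes "root_label t = Some Disj" and "complementary (root_word t)"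
  shows "tree_eval t = True_fun"
proof -
  obtain ts where ts: "t = Node Disj ts" using assms(1) by (cases t) auto
  obtain l where "l \<in> set (concat (map leaf_word ts))" "neg_lit l \<in> set (concat (map leaf_word ts))"
    using assms(2) by (auto simp: complementary_def ts)
  moreover have "Leaf k \<in> set ts" if k: "k \<in> set (concat (map leaf_word ts))" for k
  proof -
    obtain u where "u \<in> set ts" "k \<in> set (leaf_word u)" using k by auto
    then show ?thesis by (cases u rule: assoc_tree.exhaust) auto
  qed
  ultimately have "Leaf l \<in> set ts" "Leaf (neg_lit l) \<in> set ts" by auto
  then have "tree_eval t a" for a unfolding ts by (cases "lit_eval a l") force+
  then show ?thesis by (auto simp: True_fun_def)
qed

text \<open>Lets the fourth moment of the pattern length also control the error made for root
  words.\<close>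

lemma length_root_word_le:
  assumes "root_label t = Some Disj"
  shows "length (root_word t) \<le> length (pattern t)"
proof -
  obtain ts where ts: "t = Node Disj ts" using assms(1) by (cases t) auto
  have "length (leaf_word u) \<le> length (pattern u)" for u by (cases u) auto
  then have "length (concat (map leaf_word us)) \<le> length (concat (map pattern us))" for us
    by (induction us) (auto intro: add_mono)
  then show ?thesis by (simp add: ts)
qed

section \<open>Uniformity of the words read off from trees\<close>

lemma uniform_word_cong: "(\<And>x. x \<in> X \<Longrightarrow> p x = q x) \<Longrightarrow> uniform_word n X p \<longleftrightarrow> uniform_word n X q"
  unfolding uniform_word_def by (simp cong: sum.cong)

lemma uniform_word_rooted:
  "uniform_word n (long_forests n c m) (\<lambda>ts. p (Node c ts)) \<Longrightarrow> uniform_word n (rooted n c m) p"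
  by (simp add: uniform_word_def sum_rooted)

lemma uniform_word_forests:
  "uniform_word n (kids n c m) (\<lambda>t. p [t]) \<Longrightarrow> uniform_word n (long_forests n c m) p
    \<Longrightarrow> uniform_word n (forests n c m) p"
  by (simp add: uniform_word_def sum_forests)

lemma uniform_word_kids:
  assumes "\<And>l. p (Leaf l) = [l]" and "uniform_word n (rooted n (dual_conn c) m) p"
  shows "uniform_word n (kids n c m) p"
proof -
  have "uniform_word n (if m = 1 then Leaf ` lits n else {}) p"
    using assms(1) by (cases "m = 1")
      (auto intro: uniform_word_single_leaf uniform_word_empty_words simp: inj_on_def)
  then show ?thesis
    unfolding kids_eq using assms(2)
    by (intro uniform_word_Un) (auto simp: rooted_def finite_assoc_trees)
qed

text \<open>There are no trees or lists of size 0, so both parts of a list are smaller than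
  \<open>m\<close>. This form of the hypotheses fits an induction on the size.\<close>

lemma uniform_word_long_forests:
  assumes p: "\<And>j. j < m \<Longrightarrow> uniform_word n (kids n c j) p"
    and q: "\<And>j. j < m \<Longrightarrow> uniform_word n (forests n c j) q"
  shows "uniform_word n (long_forests n c m) (\<lambda>ts. p (hd ts) @ q (tl ts))"
  unfolding uniform_word_def sum_long_forests list.sel
proof (intro allI, rule sum.cong[OF refl])
  fix \<Phi> j assume "j \<in> {0..m}"
  then consider "j = 0" | "j = m" | "j < m" "m - j < m" by force
  then show "(\<Sum>t\<in>kids n c j. \<Sum>ts\<in>forests n c (m - j). \<Phi> (p t @ q ts))
      = (\<Sum>t\<in>kids n c j. \<Sum>ts\<in>forests n c (m - j). word_mean n (length (p t @ q ts)) \<Phi>)"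
  proof cases
    case 3
    then show ?thesis by (intro uniform_word_append p q)
  qed auto
qed

lemma long_forestsE:
  assumes "ts \<in> long_forests n c m"
  obtains t us where "ts = t # us" and "us \<noteq> []"
  using assms by (cases ts; cases "tl ts") (auto simp: long_forests_def)

lemma uniform_word_pattern_aux:
  "\<forall>c. uniform_word n (rooted n c m) pattern \<and> uniform_word n (kids n c m) pattern
    \<and> uniform_word n (forests n c m) (branch c)"
proof (induction m rule: less_induct)
  case (less m)
  have long: "uniform_word n (long_forests n c m) (\<lambda>ts. pattern (hd ts) @ branch c (tl ts))" for c
    using less by (intro uniform_word_long_forests) auto
  have rooted: "uniform_word n (rooted n c m) pattern" for c
  proof (rule uniform_word_rooted)
    show "uniform_word n (long_forests n c m) (\<lambda>ts. pattern (Node c ts))"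
      by (rule iffD1[OF uniform_word_cong long]) (auto elim!: long_forestsE simp: pattern_Node)
  qed
  have kids: "uniform_word n (kids n c m) pattern" for c
    using rooted by (intro uniform_word_kids) auto
  have "uniform_word n (long_forests n c m) (branch c)" for c
  proof (cases c)
    case Conj
    \<comment> \<open>The unrecorded children of a conjunction are treated as carrying the empty
      word, which is trivially uniform.\<close>
    have "uniform_word n (long_forests n c m) (\<lambda>ts. pattern (hd ts) @ (\<lambda>_. []) (tl ts))"
      by (rule uniform_word_long_forests) (use less in \<open>auto simp: uniform_word_empty_words\<close>)
    then show ?thesis by (rule iffD1[OF uniform_word_cong, rotated]) (simp add: branch_def Conj)
  next
    case Disj
    show ?thesis
      by (rule iffD1[OF uniform_word_cong long]) (auto elim!: long_forestsE simp: branch_def Disj)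
  qed
  then have "uniform_word n (forests n c m) (branch c)" for c
    using kids by (intro uniform_word_forests) auto
  then show ?case using rooted kids by blast
qed

lemma uniform_word_pattern: "uniform_word n (rooted n c m) pattern"
  using uniform_word_pattern_aux by blast

lemma uniform_word_leaf_word: "uniform_word n (kids n c m) leaf_word"
  by (rule uniform_word_kids) (auto intro!: uniform_word_empty_words simp: rooted_eq)

lemma uniform_word_forests_leaf_word:
  "uniform_word n (forests n c m) (\<lambda>ts. concat (map leaf_word ts))"
proof (induction m rule: less_induct)
  case (less m)
  have "uniform_word n (long_forests n c m)
      (\<lambda>ts. leaf_word (hd ts) @ (\<lambda>us. concat (map leaf_word us)) (tl ts))"
    using less by (intro uniform_word_long_forests uniform_word_leaf_word) auto
  then have "uniform_word n (long_forests n c m) (\<lambda>ts. concat (map leaf_word ts))"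
    by (rule iffD1[OF uniform_word_cong, rotated]) (auto elim!: long_forestsE)
  then show ?case using uniform_word_leaf_word by (intro uniform_word_forests) auto
qed

lemma uniform_word_root_word: "uniform_word n (rooted n c m) root_word"
proof (rule uniform_word_rooted)
  have "uniform_word n (long_forests n c m)
      (\<lambda>ts. leaf_word (hd ts) @ (\<lambda>us. concat (map leaf_word us)) (tl ts))"
    by (intro uniform_word_long_forests uniform_word_leaf_word uniform_word_forests_leaf_word)
  then show "uniform_word n (long_forests n c m) (\<lambda>ts. root_word (Node c ts))"
    by (rule iffD1[OF uniform_word_cong, rotated]) (auto elim!: long_forestsE)
qed

section \<open>Moments and the limit\<close>

definition nonneg_fps :: "real fps \<Rightarrow> bool" where
  "nonneg_fps a \<longleftrightarrow> (\<forall>m. a $ m \<ge> 0)"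

lemma nonneg_fps_add [intro]: "nonneg_fps a \<Longrightarrow> nonneg_fps b \<Longrightarrow> nonneg_fps (a + b)"
  by (simp add: nonneg_fps_def)

lemma nonneg_fps_mult [intro]: "nonneg_fps a \<Longrightarrow> nonneg_fps b \<Longrightarrow> nonneg_fps (a * b)"
  by (simp add: nonneg_fps_def fps_mult_nth sum_nonneg)

lemma nonneg_fps_sum [intro]: "(\<And>i. i \<in> I \<Longrightarrow> nonneg_fps (f i)) \<Longrightarrow> nonneg_fps (\<Sum>i\<in>I. f i)"
  by (simp add: nonneg_fps_def fps_sum_nth sum_nonneg)

lemma nonneg_fps_basic [simp]:
  "nonneg_fps fps_X" "nonneg_fps schroeder" "nonneg_fps (fps_const (real k))" "nonneg_fps 1"
  "nonneg_fps (schroeder_inv - 1)" "nonneg_fps (numeral l)"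
  by (simp_all add: nonneg_fps_def schroeder_inv_nth numeral_fps_const del: fps_sub_nth)

lemma nonneg_fps_schroeder_inv [simp]: "nonneg_fps schroeder_inv"
  using nonneg_fps_add[of "schroeder_inv - 1" 1] by simp

text \<open>The linear equations satisfied by the generating functions \<open>P k\<close>, \<open>Q k\<close>, \<open>L k\<close> of the
  \<open>k\<close>-th moments of the length of \<open>pattern\<close> on children of conjunctions, on children of disjunctions
  and on lists of the latter.\<close>

definition moment_system :: "(nat \<Rightarrow> real fps) \<Rightarrow> (nat \<Rightarrow> real fps) \<Rightarrow> (nat \<Rightarrow> real fps) \<Rightarrow> bool" where
  "moment_system P Q L \<longleftrightarrow> P 0 = schroeder \<and> Q 0 = schroeder \<and> L 0 = schroeder_inv - 1
    \<and> (\<forall>k. nonneg_fps (P k) \<and> nonneg_fps (Q k) \<and> nonneg_fps (L k)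
      \<and> Q k = fps_X + (\<Sum>i\<le>k. fps_const (real (k choose i)) * (P i * (P (k - i) * schroeder_inv)))
      \<and> P k = fps_X + (\<Sum>i\<le>k. fps_const (real (k choose i)) * (Q i * L (k - i)))
      \<and> L k = Q k + (P k - fps_X))"

lemma moment_systemD:
  assumes "moment_system P Q L"
  shows "P 0 = schroeder" and "Q 0 = schroeder" and "L 0 = schroeder_inv - 1"
    and "nonneg_fps (P k)" and "nonneg_fps (Q k)" and "nonneg_fps (L k)"
    and "Q k = fps_X + (\<Sum>i\<le>k. fps_const (real (k choose i)) * (P i * (P (k - i) * schroeder_inv)))"
    and "P k = fps_X + (\<Sum>i\<le>k. fps_const (real (k choose i)) * (Q i * L (k - i)))"
    and "L k = Q k + (P k - fps_X)"
  using assms unfolding moment_system_def by blast+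

text \<open>The composition of two linear steps: the factor
  \<open>2 * schroeder * schroeder_inv\<close> takes \<open>P k\<close> to \<open>Q k\<close>, and
  \<open>schroeder_inv ^ 2 - 1\<close> takes \<open>Q k\<close> back to \<open>P k\<close>.\<close>

definition moment_kernel :: "real fps" where
  "moment_kernel = ((schroeder_inv - 1) * (schroeder_inv + 1)) * (2 * schroeder * schroeder_inv)"

lemma sum_binomial_ends:
  fixes f :: "nat \<Rightarrow> real fps"
  assumes "k \<ge> 1"
  shows "(\<Sum>i\<le>k. fps_const (real (k choose i)) * f i)
    = f 0 + f k + (\<Sum>i\<in>{0<..<k}. fps_const (real (k choose i)) * f i)"
proof -
  have "{..k} = insert 0 (insert k {0<..<k})" using assms by auto
  then show ?thesis using assms by simp
qed

text \<open>Only the terms \<open>i = 0\<close> and \<open>i = k\<close> of the binomial sums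
  contain \<open>k\<close>-th moments, so the system is linear in these, with \<open>SC\<close> and
  \<open>SD\<close> built from lower moments. Eliminating \<open>L k\<close> and \<open>Q k\<close>
  leaves a renewal equation for \<open>P k\<close>.\<close>

lemma moment_system_solution:
  assumes sys: "moment_system P Q L" and k: "k \<ge> 1"
  defines "SC \<equiv> \<Sum>i\<in>{0<..<k}. fps_const (real (k choose i)) * (P i * (P (k - i) * schroeder_inv))"
    and "SD \<equiv> \<Sum>i\<in>{0<..<k}. fps_const (real (k choose i)) * (Q i * L (k - i))"
  shows "Q k = fps_X + 2 * schroeder * schroeder_inv * P k + SC"
    and "L k = schroeder_inv * (Q k * schroeder_inv + SD)"
    and "P k = (fps_X + schroeder_inv * SD + (schroeder_inv - 1) * (schroeder_inv + 1) * (fps_X + SC))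
      + moment_kernel * P k"
proof -
  note P0 = moment_systemD(1)[OF sys] and Q0 = moment_systemD(2)[OF sys]
    and L0 = moment_systemD(3)[OF sys]
  note Qk = moment_systemD(7)[OF sys, of k] and Pk = moment_systemD(8)[OF sys, of k]
    and Lk = moment_systemD(9)[OF sys, of k]
  show Q: "Q k = fps_X + 2 * schroeder * schroeder_inv * P k + SC"
    by (subst Qk, subst sum_binomial_ends[OF k]) (simp add: P0 SC_def algebra_simps)
  have PD: "P k = fps_X + (schroeder * L k + Q k * (schroeder_inv - 1) + SD)"
    by (subst Pk, subst sum_binomial_ends[OF k]) (simp add: Q0 L0 SD_def)
  have Lrec: "L k = Q k + (schroeder * L k + Q k * (schroeder_inv - 1) + SD)"
    by (subst Lk, subst PD) simp
  have "(1 - schroeder) * L k = L k - schroeder * L k" by (simp add: algebra_simps)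
  also have "\<dots> = Q k * schroeder_inv + SD"
    by (subst Lrec) (simp add: algebra_simps)
  finally show L: "L k = schroeder_inv * (Q k * schroeder_inv + SD)"
    by (rule mult_one_minus_schroeder_cancel)
  have "P k = fps_X + L k - Q k" using Lk by simp
  also have "\<dots> = fps_X + schroeder_inv * SD + (schroeder_inv - 1) * (schroeder_inv + 1) * Q k"
    unfolding L by (simp add: algebra_simps)
  also have "\<dots> = (fps_X + schroeder_inv * SD + (schroeder_inv - 1) * (schroeder_inv + 1) * (fps_X + SC))
      + moment_kernel * P k"
    unfolding moment_kernel_def by (subst Q) (simp add: algebra_simps)
  finally show "P k = (fps_X + schroeder_inv * SD + (schroeder_inv - 1) * (schroeder_inv + 1) * (fps_X + SC))
      + moment_kernel * P k" .
qed

lemma moment_kernel_0: "moment_kernel $ 0 = 0"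
  by (simp add: moment_kernel_def)

lemma moment_kernel_nonneg: "nonneg_fps moment_kernel"
  unfolding moment_kernel_def by (intro nonneg_fps_mult nonneg_fps_add) simp_all

lemma moment_kernel_wt_bounded: "wt_bounded moment_kernel"
  unfolding moment_kernel_def by (intro wt_bounded_mult wt_bounded_add wt_bounded_diff) auto

lemma moment_kernel_at_rho: "fps_at_rho moment_kernel < 1"
proof -
  have "fps_at_rho moment_kernel = 2 * sqrt 2 - 2"
    unfolding moment_kernel_def
    by (simp add: fps_at_rho_mult fps_at_rho_add fps_at_rho_diff fps_at_rho_schroeder
        fps_at_rho_schroeder_inv wt_bounded_mult wt_bounded_add wt_bounded_diff algebra_simps)
  moreover have "2 * sqrt 2 < 3" by (rule power2_less_imp_less) (auto simp: power_mult_distrib)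
  ultimately show ?thesis by simp
qed

lemma moment_system_wt_bounded:
  assumes sys: "moment_system P Q L"
  shows "wt_bounded (P k) \<and> wt_bounded (Q k) \<and> wt_bounded (L k)"
proof (induction k rule: less_induct)
  case (less k)
  note nonneg = moment_systemD(4-6)[OF sys]
  show ?case
  proof (cases "k = 0")
    case True
    then show ?thesis by (simp add: moment_systemD(1-3)[OF sys] wt_bounded_diff)
  next
    case False
    then have k: "k \<ge> 1" by simp
    define SC where "SC = (\<Sum>i\<in>{0<..<k}. fps_const (real (k choose i)) * (P i * (P (k - i) * schroeder_inv)))"
    define SD where "SD = (\<Sum>i\<in>{0<..<k}. fps_const (real (k choose i)) * (Q i * L (k - i)))"
    note sol = moment_system_solution[OF sys k, folded SC_def SD_def]
    define H where "H = fps_X + schroeder_inv * SD + (schroeder_inv - 1) * (schroeder_inv + 1) * (fps_X + SC)"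
    have S: "wt_bounded SC" "wt_bounded SD"
      unfolding SC_def SD_def using less by (auto intro!: wt_bounded_sum wt_bounded_mult)
    have S': "nonneg_fps SC" "nonneg_fps SD"
      unfolding SC_def SD_def using nonneg by (auto intro!: nonneg_fps_sum nonneg_fps_mult)
    have H: "wt_bounded H"
      unfolding H_def using S by (auto intro!: wt_bounded_mult wt_bounded_add wt_bounded_diff)
    have H': "nonneg_fps H"
      unfolding H_def by (intro nonneg_fps_add nonneg_fps_mult S') simp_all
    have "wt_bounded (P k)"
      by (rule wt_bounded_renewal[OF moment_kernel_wt_bounded H _ _ _ moment_kernel_0
            moment_kernel_at_rho sol(3)[folded H_def]])
        (use moment_kernel_nonneg H' nonneg in \<open>auto simp: nonneg_fps_def\<close>)
    moreover from this have "wt_bounded (Q k)"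
      unfolding sol(1) using S by (auto intro!: wt_bounded_mult wt_bounded_add)
    moreover from this have "wt_bounded (L k)"
      unfolding sol(2) using S by (auto intro!: wt_bounded_mult wt_bounded_add)
    ultimately show ?thesis by blast
  qed
qed

text \<open>Shows that the moments do not depend on \<open>n\<close>. In the induction,
  \<open>1 - moment_kernel\<close> has constant coefficient 1 and can be cancelled.\<close>

lemma moment_system_unique:
  assumes sys: "moment_system P Q L" and sys': "moment_system P' Q' L'"
  shows "P k = P' k \<and> Q k = Q' k \<and> L k = L' k"
proof (induction k rule: less_induct)
  case (less k)
  show ?case
  proof (cases "k = 0")
    case True
    then show ?thesis by (simp add: moment_systemD(1-3)[OF sys] moment_systemD(1-3)[OF sys'])
  next
    case False
    then have k: "k \<ge> 1" by simp
    have SC: "(\<Sum>i\<in>{0<..<k}. fps_const (real (k choose i)) * (P i * (P (k - i) * schroeder_inv)))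
        = (\<Sum>i\<in>{0<..<k}. fps_const (real (k choose i)) * (P' i * (P' (k - i) * schroeder_inv)))"
      and SD: "(\<Sum>i\<in>{0<..<k}. fps_const (real (k choose i)) * (Q i * L (k - i)))
        = (\<Sum>i\<in>{0<..<k}. fps_const (real (k choose i)) * (Q' i * L' (k - i)))"
      using less by (auto intro!: sum.cong)
    note sol = moment_system_solution[OF sys k, unfolded SC SD]
    note sol' = moment_system_solution[OF sys' k]
    have "P k - P' k = moment_kernel * P k - moment_kernel * P' k"
      by (subst sol(3), subst sol'(3)) simp
    then have "(1 - moment_kernel) * (P k - P' k) = 0" by (simp add: algebra_simps)
    moreover have "1 - moment_kernel \<noteq> 0"
      by (rule fps_nonzeroI[of _ 0]) (simp add: moment_kernel_0)
    ultimately have "P k = P' k" by (simp add: mult_eq_0_iff)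
    moreover from this have "Q k = Q' k" by (simp only: sol(1) sol'(1))
    moreover from this have "L k = L' k" by (simp only: sol(2) sol'(2))
    ultimately show ?thesis by blast
  qed
qed

section \<open>Moments of the pattern length\<close>

definition kids_moment where
  "kids_moment n c k = gf n (kids n c) (\<lambda>t. real (length (pattern t)) ^ k)"

definition forests_moment where
  "forests_moment n c k = gf n (forests n c) (\<lambda>ts. real (length (branch c ts)) ^ k)"

definition rooted_moment where
  "rooted_moment n c k = gf n (rooted n c) (\<lambda>t. real (length (pattern t)) ^ k)"

lemma rooted_moment_eq:
  "rooted_moment n c k
    = (\<Sum>i\<le>k. fps_const (real (k choose i)) * (kids_moment n c i * forests_moment n c (k - i)))"
proof -
  have "real (length (pattern (Node c ts))) ^ k
      = (\<Sum>i\<le>k. real (k choose i) * (real (length (pattern (hd ts))) ^ i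
          * real (length (branch c (tl ts))) ^ (k - i)))" if "ts \<in> long_forests n c m" for ts m
    using that by (elim long_forestsE) (simp add: pattern_Node binomial_ring mult.assoc)
  then have "rooted_moment n c k = gf n (long_forests n c)
      (\<lambda>ts. \<Sum>i\<le>k. real (k choose i) * (real (length (pattern (hd ts))) ^ i
          * real (length (branch c (tl ts))) ^ (k - i)))"
    unfolding rooted_moment_def gf_rooted by (rule gf_cong)
  moreover have "gf n (long_forests n c)
      (\<lambda>ts. real (length (pattern (hd ts))) ^ i * real (length (branch c (tl ts))) ^ (k - i))
      = kids_moment n c i * forests_moment n c (k - i)" for i
    unfolding kids_moment_def forests_moment_def
    by (rule gf_long_forests[of n c "\<lambda>t. real (length (pattern t)) ^ i"])
  ultimately show ?thesis by (simp only: gf_sum gf_cmult)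
qed

lemma forests_moment_Disj:
  "forests_moment n Disj k = kids_moment n Disj k + rooted_moment n Disj k"
  unfolding forests_moment_def kids_moment_def rooted_moment_def gf_rooted
  by (simp add: gf_forests) (simp add: branch_def)

text \<open>Only the first child counts; the possibly empty list of the others contributes the plain
  factor \<open>schroeder_inv\<close>.\<close>

lemma forests_moment_Conj:
  assumes "n \<ge> 1"
  shows "forests_moment n Conj k = kids_moment n Conj k * schroeder_inv"
proof -
  have "gf n (long_forests n Conj) (\<lambda>ts. real (length (branch Conj ts)) ^ k)
      = kids_moment n Conj k * gf n (forests n Conj) (\<lambda>_. 1)"
    unfolding kids_moment_def
    using gf_long_forests[of n Conj "\<lambda>t. real (length (pattern t)) ^ k" "\<lambda>_. 1"]
    by (simp add: branch_def)
  then have "gf n (long_forests n Conj) (\<lambda>ts. real (length (branch Conj ts)) ^ k)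
      = kids_moment n Conj k * (schroeder_inv - 1)"
    unfolding gf_totals(2)[OF assms] .
  then show ?thesis
    unfolding forests_moment_def gf_forests by (simp add: kids_moment_def algebra_simps)
qed

lemma moment_system_pattern:
  assumes "n \<ge> 1"
  shows "moment_system (kids_moment n Conj) (kids_moment n Disj) (forests_moment n Disj)"
proof -
  have "kids_moment n c k = fps_X + rooted_moment n (dual_conn c) k" for c k
    unfolding kids_moment_def rooted_moment_def using assms by (intro gf_kids_const_leaf) auto
  then have kids: "kids_moment n Conj k = fps_X + rooted_moment n Disj k"
    "kids_moment n Disj k = fps_X + rooted_moment n Conj k" for k by simp_all
  show ?thesis
    unfolding moment_system_def
  proof (intro conjI allI)
    fix k
    show "kids_moment n Disj k = fps_X + (\<Sum>i\<le>k. fps_const (real (k choose i))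
        * (kids_moment n Conj i * (kids_moment n Conj (k - i) * schroeder_inv)))"
      unfolding kids(2) rooted_moment_eq forests_moment_Conj[OF assms] ..
    show "kids_moment n Conj k = fps_X + (\<Sum>i\<le>k. fps_const (real (k choose i))
        * (kids_moment n Disj i * forests_moment n Disj (k - i)))"
      unfolding kids(1) rooted_moment_eq ..
    show "forests_moment n Disj k = kids_moment n Disj k + (kids_moment n Conj k - fps_X)"
      unfolding forests_moment_Disj kids(1) by simp
  qed (use assms in \<open>auto simp: nonneg_fps_def kids_moment_def forests_moment_def gf_nonneg gf_totals\<close>)
qed

text \<open>By uniqueness, the bounds for \<open>n = 1\<close> hold for every \<open>n\<close>, so
  that \<open>K\<close> depends on \<open>k\<close> alone.\<close>

lemma moment_bound:
  obtains K where "K > 0" and "\<And>n m c. n \<ge> 1 \<Longrightarrow>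
    (\<Sum>t\<in>rooted n c m. real (length (pattern t)) ^ k) \<le> K * wt m * (2 * real n) ^ m"
proof -
  have sys1: "moment_system (kids_moment 1 Conj) (kids_moment 1 Disj) (forests_moment 1 Disj)"
    by (rule moment_system_pattern) simp
  obtain A where A: "A > 0" "\<And>m. \<bar>kids_moment 1 Conj k $ m\<bar> \<le> A * wt m"
    using moment_system_wt_bounded[OF sys1, of k] wt_boundedE by metis
  obtain B where B: "B > 0" "\<And>m. \<bar>kids_moment 1 Disj k $ m\<bar> \<le> B * wt m"
    using moment_system_wt_bounded[OF sys1, of k] wt_boundedE by metis
  show ?thesis
  proof (rule that[of "max A B"])
    show "max A B > 0" using A by simp
    fix n m :: nat and c assume n: "n \<ge> 1"
    have eq: "kids_moment n d k = kids_moment 1 d k" for d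
      using moment_system_unique[OF moment_system_pattern[OF n] sys1, of k] by (cases d) auto
    have "(\<Sum>t\<in>rooted n c m. real (length (pattern t)) ^ k) / (2 * real n) ^ m
        \<le> (\<Sum>t\<in>kids n (dual_conn c) m. real (length (pattern t)) ^ k) / (2 * real n) ^ m"
      by (intro divide_right_mono sum_mono2) (auto simp: kids_eq split: if_splits)
    also have "\<dots> = kids_moment 1 (dual_conn c) k $ m"
      unfolding eq[symmetric] by (simp add: kids_moment_def gf_nth)
    also have "\<dots> \<le> max A B * wt m"
    proof -
      have "A * wt m \<le> max A B * wt m" "B * wt m \<le> max A B * wt m"
        by (intro mult_right_mono; simp)+
      then have "kids_moment 1 Conj k $ m \<le> max A B * wt m" "kids_moment 1 Disj k $ m \<le> max A B * wt m"
        using A(2)[of m] B(2)[of m] by linarith+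
      then show ?thesis by (cases c) simp_all
    qed
    finally show "(\<Sum>t\<in>rooted n c m. real (length (pattern t)) ^ k) \<le> max A B * wt m * (2 * real n) ^ m"
      using n by (simp add: divide_le_eq)
  qed
qed

text \<open>Choosing two leaf children of the root leaves three arbitrary, possibly empty, lists:
  before, between and after them.\<close>

lemma gf_root_word_pairs:
  assumes n: "n \<ge> 1"
  shows "gf n (rooted n c) (\<lambda>t. real (length (root_word t) choose 2))
    = fps_X ^ 2 * schroeder_inv ^ 3"
proof -
  let ?w = "\<lambda>ts. concat (map leaf_word ts)"
  define b where "b = gf n (kids n c) (\<lambda>t. real (length (leaf_word t)))"
  define B1 where "B1 = gf n (forests n c) (\<lambda>ts. real (length (?w ts)))"
  define B2 where "B2 = gf n (forests n c) (\<lambda>ts. real (length (?w ts) choose 2))"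
  define V2 where "V2 = gf n (long_forests n c) (\<lambda>ts. real (length (?w ts) choose 2))"
  have b: "b = fps_X"
  proof -
    have "gf n (rooted n (dual_conn c)) (\<lambda>t. real (length (leaf_word t))) = gf n (rooted n (dual_conn c)) (\<lambda>_. 0)"
      by (rule gf_cong) (auto simp: rooted_eq)
    then show ?thesis unfolding b_def using n by (subst gf_kids_const_leaf) auto
  qed
  have le1: "length (leaf_word t) \<le> 1" for t by (cases t) auto
  have "gf n (long_forests n c) (\<lambda>ts. real (length (?w ts)))
      = gf n (long_forests n c) (\<lambda>ts. real (length (leaf_word (hd ts))) * 1 + 1 * real (length (?w (tl ts))))"
    by (rule gf_cong) (auto elim!: long_forestsE)
  also have "\<dots> = b * (schroeder_inv - 1) + schroeder * B1"
    unfolding gf_add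
    using gf_long_forests[of n c "\<lambda>t. real (length (leaf_word t))" "\<lambda>_. 1"]
      gf_long_forests[of n c "\<lambda>_. 1" "\<lambda>ts. real (length (?w ts))"] n
    by (simp add: b_def B1_def gf_totals)
  finally have "B1 = b + (b * (schroeder_inv - 1) + schroeder * B1)"
    unfolding B1_def gf_forests b_def by simp
  then have "(1 - schroeder) * B1 = fps_X * schroeder_inv"
    unfolding b by (simp add: algebra_simps)
  then have B1: "B1 = schroeder_inv * (fps_X * schroeder_inv)" by (rule mult_one_minus_schroeder_cancel)
  have "V2 = gf n (long_forests n c) (\<lambda>ts. real (length (leaf_word (hd ts))) * real (length (?w (tl ts)))
      + 1 * real (length (?w (tl ts)) choose 2))"
    unfolding V2_def
  proof (rule gf_cong)
    fix m ts assume "ts \<in> long_forests n c m"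
    then obtain t us where ts: "ts = t # us" by (rule long_forestsE)
    \<comment> \<open>A child contributes at most one letter, so the first child lies in as many new
      pairs as the rest has letters, or in none.\<close>
    from le1[of t] consider "length (leaf_word t) = 0" | "length (leaf_word t) = 1" by linarith
    then show "real (length (?w ts) choose 2) = real (length (leaf_word (hd ts))) * real (length (?w (tl ts)))
      + 1 * real (length (?w (tl ts)) choose 2)"
      by cases (simp_all add: ts numeral_2_eq_2)
  qed
  also have "\<dots> = b * B1 + schroeder * B2"
    unfolding gf_add
    using gf_long_forests[of n c "\<lambda>t. real (length (leaf_word t))" "\<lambda>ts. real (length (?w ts))"]
      gf_long_forests[of n c "\<lambda>_. 1" "\<lambda>ts. real (length (?w ts) choose 2)"] n
    by (simp add: b_def B1_def B2_def gf_totals)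
  finally have V2: "V2 = b * B1 + schroeder * B2" .
  have "B2 = gf n (kids n c) (\<lambda>_. 0) + V2"
  proof -
    have "gf n (kids n c) (\<lambda>t. real (length (?w [t]) choose 2)) = gf n (kids n c) (\<lambda>_. 0)"
      using le1 by (intro gf_cong) (simp add: binomial_eq_0 less_Suc_eq_le numeral_2_eq_2)
    then show ?thesis unfolding B2_def V2_def gf_forests by simp
  qed
  then have "B2 = V2" by simp
  then have "(1 - schroeder) * V2 = fps_X * B1" using V2 unfolding b by (simp add: algebra_simps)
  then have "V2 = schroeder_inv * (fps_X * B1)" by (rule mult_one_minus_schroeder_cancel)
  then show ?thesis
    unfolding gf_rooted V2_def[symmetric, simplified] root_word.simps
    by (simp add: V2_def B1 power2_eq_square power3_eq_cube mult_ac)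
qed

text \<open>Linear in \<open>schroeder_inv\<close>, so coefficients become finite combinations of
  shifted tree counts.\<close>

lemma schroeder_inv_cube:
  "schroeder_inv ^ 3 = (7 - 6 * fps_X + fps_X ^ 2) * schroeder_inv - 2 * (3 - fps_X)"
proof -
  have "schroeder_inv ^ 3 = schroeder_inv * schroeder_inv ^ 2"
    by (simp add: power3_eq_cube power2_eq_square)
  also have "\<dots> = schroeder_inv * ((3 - fps_X) * schroeder_inv - 2)"
    by (simp only: schroeder_inv_square)
  also have "\<dots> = (3 - fps_X) * schroeder_inv ^ 2 - 2 * schroeder_inv"
    by (simp add: algebra_simps power2_eq_square)
  also have "\<dots> = (3 - fps_X) * ((3 - fps_X) * schroeder_inv - 2) - 2 * schroeder_inv"
    by (simp only: schroeder_inv_square)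
  also have "\<dots> = (7 - 6 * fps_X + fps_X ^ 2) * schroeder_inv - 2 * (3 - fps_X)"
    by (simp add: algebra_simps power2_eq_square)
  finally show ?thesis .
qed

lemma root_word_pairs_limit:
  "(\<lambda>m. (fps_X ^ 2 * schroeder_inv ^ 3) $ m / wt m) \<longlonglongrightarrow> 4 * (51 - 36 * sqrt 2)"
proof -
  have "(\<lambda>m. 14 * (wt (m - 2) / wt m) - 12 * (wt (m - 3) / wt m) + 2 * (wt (m - 4) / wt m))
      \<longlonglongrightarrow> 14 * rho ^ 2 - 12 * rho ^ 3 + 2 * rho ^ 4"
    by (intro tendsto_intros wt_ratio)
  \<comment> \<open>Both sides equal \<open>12 * rho ^ 2\<close>, because
    \<open>6 * rho - rho ^ 2 = 1\<close>.\<close>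
  moreover have "14 * rho ^ 2 - 12 * rho ^ 3 + 2 * rho ^ 4 = 4 * (51 - 36 * sqrt 2)"
    by (simp add: rho_def power2_eq_square power3_eq_cube power4_eq_xxxx algebra_simps)
  moreover have "\<forall>\<^sub>F m in sequentially.
      14 * (wt (m - 2) / wt m) - 12 * (wt (m - 3) / wt m) + 2 * (wt (m - 4) / wt m)
      = (fps_X ^ 2 * schroeder_inv ^ 3) $ m / wt m"
    using eventually_ge_at_top[of 6]
  proof eventually_elim
    case (elim m)
    have "fps_X ^ 2 * schroeder_inv ^ 3
        = 7 * (fps_X ^ 2 * schroeder_inv) - 6 * (fps_X ^ 3 * schroeder_inv)
          + fps_X ^ 4 * schroeder_inv - 6 * fps_X ^ 2 + 2 * fps_X ^ 3"
      unfolding schroeder_inv_cube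
      by (simp add: algebra_simps power2_eq_square power3_eq_cube power4_eq_xxxx)
    \<comment> \<open>At index 1 the coefficient is 1 rather than 2; with \<open>m \<ge> 6\<close>
      all shifted indices stay at least 2.\<close>
    moreover have "schroeder_inv $ j = 2 * wt j" if "j \<ge> 2" for j
      using that by (simp add: schroeder_inv_def wt_eq numeral_fps_const)
    ultimately have "(fps_X ^ 2 * schroeder_inv ^ 3) $ m
        = 7 * (2 * wt (m - 2)) - 6 * (2 * wt (m - 3)) + 2 * wt (m - 4)"
      using elim by (simp add: fps_X_power_mult_nth numeral_fps_const)
    then show ?case by (simp add: add_divide_distrib diff_divide_distrib)
  qed
  ultimately show ?thesis by (simp only: Lim_transform_eventually)
qed

text \<open>Every tautology either has a complementary pair of leaf children at a disjunctive root,
  or has excess at least 2 in its pattern. \<open>K\<close> is independent of both \<open>n\<close>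
  and \<open>m\<close>, so the bound survives the limit in \<open>m\<close>.\<close>

lemma pmf_True_estimate:
  obtains K where "\<And>n m. n \<ge> 1 \<Longrightarrow> m \<ge> 2 \<Longrightarrow>
    \<bar>pmf (assoc_dist m n) True_fun - (fps_X ^ 2 * schroeder_inv ^ 3) $ m / wt m / (4 * real n)\<bar>
      \<le> K / real n ^ 2"
proof -
  obtain K where K: "K > 0" "\<And>n m c. n \<ge> 1 \<Longrightarrow>
    (\<Sum>t\<in>rooted n c m. real (length (pattern t)) ^ 4) \<le> K * wt m * (2 * real n) ^ m"
    using moment_bound[of 4] by blast
  \<comment> \<open>The exceptional trees cost \<open>K\<close> for each root label and the
    approximation of \<open>S\<close> costs another \<open>K\<close>; the total count
    \<open>2 * W\<close> halves the sum.\<close>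
  show ?thesis
  proof (rule that[of "3 / 2 * K"])
    fix n m :: nat assume n: "n \<ge> 1" and m: "m \<ge> 2"
    define W where "W = wt m * (2 * real n) ^ m"
    have W: "W > 0" using n by (simp add: W_def)
    define N where "N = real (card {t \<in> assoc_trees m n. tree_eval t = True_fun})"
    define S where "S = real (card {t \<in> rooted n Disj m. complementary (root_word t)})"
    define E where "E = real (card {t \<in> assoc_trees m n. excess (pattern t) \<ge> 2})"
    define B where "B = (\<Sum>t\<in>rooted n Disj m. real (length (root_word t) choose 2))"
    have "S \<le> N"
      unfolding S_def N_def of_nat_le_iff
      by (rule card_mono) (auto simp: finite_assoc_trees rooted_def tautology_if_complementary_root_word)
    moreover have "N \<le> S + E"
    proof -
      have "{t \<in> assoc_trees m n. tree_eval t = True_fun}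
          \<subseteq> {t \<in> rooted n Disj m. complementary (root_word t)} \<union> {t \<in> assoc_trees m n. excess (pattern t) \<ge> 2}"
        using tautology_cases by (auto simp: rooted_def assoc_trees_def)
      then have "card {t \<in> assoc_trees m n. tree_eval t = True_fun}
          \<le> card ({t \<in> rooted n Disj m. complementary (root_word t)} \<union> {t \<in> assoc_trees m n. excess (pattern t) \<ge> 2})"
        by (rule card_mono[rotated]) (simp add: finite_assoc_trees)
      also have "\<dots> \<le> card {t \<in> rooted n Disj m. complementary (root_word t)}
          + card {t \<in> assoc_trees m n. excess (pattern t) \<ge> 2}"
        by (rule card_Un_le)
      finally show ?thesis unfolding N_def S_def E_def by linarith
    qed
    moreover have "E \<le> 2 * (K * W / real n ^ 2)"
    proof -
      have "real (card {t \<in> rooted n c m. excess (pattern t) \<ge> 2}) \<le> K * W / real n ^ 2" for c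
      proof -
        have "real (card {t \<in> rooted n c m. excess (pattern t) \<ge> 2})
            = (\<Sum>t\<in>rooted n c m. of_bool (excess (pattern t) \<ge> 2))"
          by (subst sum_of_bool_card) simp_all
        also have "\<dots> = (\<Sum>t\<in>rooted n c m. word_mean n (length (pattern t)) (\<lambda>w. of_bool (excess w \<ge> 2)))"
          by (rule uniform_wordD[OF uniform_word_pattern])
        also have "\<dots> \<le> (\<Sum>t\<in>rooted n c m. real (length (pattern t)) ^ 4 / real n ^ 2)"
          by (intro sum_mono mean_excess_ge_2 n)
        also have "\<dots> = (\<Sum>t\<in>rooted n c m. real (length (pattern t)) ^ 4) / real n ^ 2"
          by (simp add: sum_divide_distrib)
        also have "\<dots> \<le> K * W / real n ^ 2"
          using K(2)[OF n, of c m] by (intro divide_right_mono) (auto simp: W_def mult.assoc)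
        finally show ?thesis .
      qed
      from this[of Conj] this[of Disj] show ?thesis
        unfolding E_def card_assoc_trees_filter[OF m] by simp
    qed
    moreover have "\<bar>S - B / (2 * real n)\<bar> \<le> K * W / real n ^ 2"
    proof -
      have "S = (\<Sum>t\<in>rooted n Disj m. of_bool (complementary (root_word t)))"
        unfolding S_def by (subst sum_of_bool_card) simp_all
      also have "\<dots> = (\<Sum>t\<in>rooted n Disj m. word_mean n (length (root_word t)) (\<lambda>w. of_bool (complementary w)))"
        by (rule uniform_wordD[OF uniform_word_root_word])
      finally have "\<bar>S - B / (2 * real n)\<bar>
          = \<bar>\<Sum>t\<in>rooted n Disj m. word_mean n (length (root_word t)) (\<lambda>w. of_bool (complementary w))
              - real (length (root_word t) choose 2) / (2 * real n)\<bar>"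
        by (simp add: B_def sum_subtractf sum_divide_distrib)
      also have "\<dots> \<le> (\<Sum>t\<in>rooted n Disj m. \<bar>word_mean n (length (root_word t)) (\<lambda>w. of_bool (complementary w))
              - real (length (root_word t) choose 2) / (2 * real n)\<bar>)"
        by (rule sum_abs)
      also have "\<dots> \<le> (\<Sum>t\<in>rooted n Disj m. real (length (pattern t)) ^ 4 / real n ^ 2)"
      proof (rule sum_mono)
        fix t assume "t \<in> rooted n Disj m"
        then have "length (root_word t) \<le> length (pattern t)"
          by (intro length_root_word_le) (simp add: rooted_def)
        then have "real (length (root_word t)) ^ 4 / real n ^ 2 \<le> real (length (pattern t)) ^ 4 / real n ^ 2"
          by (intro divide_right_mono power_mono) auto
        then show "\<bar>word_mean n (length (root_word t)) (\<lambda>w. of_bool (complementary w))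
              - real (length (root_word t) choose 2) / (2 * real n)\<bar> \<le> real (length (pattern t)) ^ 4 / real n ^ 2"
          using mean_complementary[OF n, of "length (root_word t)"] by linarith
      qed
      also have "\<dots> = (\<Sum>t\<in>rooted n Disj m. real (length (pattern t)) ^ 4) / real n ^ 2"
        by (simp add: sum_divide_distrib)
      also have "\<dots> \<le> K * W / real n ^ 2"
        using K(2)[OF n, of Disj m] by (intro divide_right_mono) (auto simp: W_def mult.assoc)
      finally show ?thesis .
    qed
    ultimately have "\<bar>N - B / (2 * real n)\<bar> \<le> 3 * (K * W / real n ^ 2)" by linarith
    then have "\<bar>N - B / (2 * real n)\<bar> / (2 * W) \<le> 3 * (K * W / real n ^ 2) / (2 * W)"
      using W by (intro divide_right_mono) auto
    moreover have "\<bar>N - B / (2 * real n)\<bar> / (2 * W) = \<bar>(N - B / (2 * real n)) / (2 * W)\<bar>"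
      using W by (simp add: abs_divide)
    moreover have "3 * (K * W / real n ^ 2) / (2 * W) = 3 / 2 * K / real n ^ 2"
      using W by (simp add: field_simps)
    \<comment> \<open>The factor 4 combines the probability \<open>1 / (2 * n)\<close> of a
      complementary pair with the share one half of disjunctive roots.\<close>
    moreover have "(N - B / (2 * real n)) / (2 * W) = N / (2 * W) - B / W / (4 * real n)"
      by (simp add: diff_divide_distrib)
    moreover have "pmf (assoc_dist m n) True_fun = N / (2 * W)"
      unfolding pmf_True[OF n m] N_def W_def by (simp add: mult.assoc)
    moreover have "B / W = (fps_X ^ 2 * schroeder_inv ^ 3) $ m / wt m"
      unfolding gf_root_word_pairs[OF n, of Disj, symmetric] gf_nth B_def W_def by simp
    ultimately show "\<bar>pmf (assoc_dist m n) True_fun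
        - (fps_X ^ 2 * schroeder_inv ^ 3) $ m / wt m / (4 * real n)\<bar> \<le> 3 / 2 * K / real n ^ 2"
      by simp
  qed
qed

theorem theorem4:
  shows "(\<forall>n\<ge>1. convergent (\<lambda>m. pmf (assoc_dist m n) True_fun)) \<and>
         (\<lambda>n. lim (\<lambda>m. pmf (assoc_dist m n) True_fun) - (51 - 36 * sqrt 2) / real n)
           \<in> O(\<lambda>n. 1 / (real n)\<^sup>2)"
proof
  show "\<forall>n\<ge>1. convergent (\<lambda>m. pmf (assoc_dist m n) True_fun)"
    using convergent_pmf_True by blast
  obtain K where K: "\<And>n m. n \<ge> 1 \<Longrightarrow> m \<ge> 2 \<Longrightarrow>
    \<bar>pmf (assoc_dist m n) True_fun - (fps_X ^ 2 * schroeder_inv ^ 3) $ m / wt m / (4 * real n)\<bar>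
      \<le> K / real n ^ 2"
    using pmf_True_estimate by blast
  have "\<bar>lim (\<lambda>m. pmf (assoc_dist m n) True_fun) - (51 - 36 * sqrt 2) / real n\<bar> \<le> K / real n ^ 2"
    if n: "n \<ge> 1" for n
  \<comment> \<open>For fixed \<open>n\<close> both approximated and approximating quantity converge
    in \<open>m\<close>, while the right-hand side is constant.\<close>
  proof (rule tendsto_upperbound)
    have "(\<lambda>m. pmf (assoc_dist m n) True_fun) \<longlonglongrightarrow> lim (\<lambda>m. pmf (assoc_dist m n) True_fun)"
      using convergent_pmf_True[OF n] by (simp add: convergent_LIMSEQ_iff)
    moreover have "(\<lambda>m. (fps_X ^ 2 * schroeder_inv ^ 3) $ m / wt m / (4 * real n))
        \<longlonglongrightarrow> 4 * (51 - 36 * sqrt 2) / (4 * real n)"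
      using n by (intro tendsto_divide root_word_pairs_limit tendsto_const) simp
    ultimately have "(\<lambda>m. \<bar>pmf (assoc_dist m n) True_fun
          - (fps_X ^ 2 * schroeder_inv ^ 3) $ m / wt m / (4 * real n)\<bar>)
        \<longlonglongrightarrow> \<bar>lim (\<lambda>m. pmf (assoc_dist m n) True_fun) - 4 * (51 - 36 * sqrt 2) / (4 * real n)\<bar>"
      by (intro tendsto_rabs tendsto_diff)
    moreover have "4 * (51 - 36 * sqrt 2) / (4 * real n) = (51 - 36 * sqrt 2) / real n"
      by (rule mult_divide_mult_cancel_left) simp
    ultimately show "(\<lambda>m. \<bar>pmf (assoc_dist m n) True_fun
          - (fps_X ^ 2 * schroeder_inv ^ 3) $ m / wt m / (4 * real n)\<bar>)
        \<longlonglongrightarrow> \<bar>lim (\<lambda>m. pmf (assoc_dist m n) True_fun) - (51 - 36 * sqrt 2) / real n\<bar>"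
      by (simp only:)
    show "\<forall>\<^sub>F m in sequentially. \<bar>pmf (assoc_dist m n) True_fun
          - (fps_X ^ 2 * schroeder_inv ^ 3) $ m / wt m / (4 * real n)\<bar> \<le> K / real n ^ 2"
      using eventually_ge_at_top[of 2] by eventually_elim (rule K[OF n])
  qed simp
  then show "(\<lambda>n. lim (\<lambda>m. pmf (assoc_dist m n) True_fun) - (51 - 36 * sqrt 2) / real n)
      \<in> O(\<lambda>n. 1 / (real n)\<^sup>2)"
    by (intro bigoI[of _ K] eventually_mono[OF eventually_ge_at_top[of 1]]) simp
qed

end
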